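(* Let $d\ge p\ge 1$ be integers, let $A$ be a real symmetric positive definite $p\times p$ matrix and $\Sigma$ a real symmetric positive definite $d\times d$ matrix, let $\sigma_{(1)}\ge\cdots\ge\sigma_{(d)}$ denote the ordered eigenvalues of $\Sigma$, and set $N_d=\tfrac12(d+2)(d-1)$. Then for all integers $m\ge1$, $$\Phi_{d,p;m}(A,\Sigma)\ \ge\ (2+m)^{mN_d}\,(1+m)^{-(1+m)N_d}\sum_{k=m}^\infty\left(\frac{1+m}{2+m}\right)^{kN_d}\frac{(\sigma_{(p)}\,\mathrm{tr}\,A)^k}{k!}.$$
   Context: Partitions: a partition $\kappa=(\kappa_1,\kappa_2,\ldots)$ is a weakly decreasing sequence of nonnegative integers with finitely many non-zero entries (trailing zeros are immaterial); its length $\ell(\kappa)$ is the number of non-zero $\kappa_j$ and its weight is $|\kappa|=\sum_j\kappa_j$. Shifted factorials: $(a)_k = a(a+1)\cdots(a+k-1)$, $(a)_0=1$; and $(a)_\kappa = \prod_{i\ge1} \bigl(a-\tfrac12(i-1)\bigr)_{\kappa_i}$ for a partition $\kappa$. Zonal polynomials: for an $n\times n$ real symmetric matrix $S$ and a partition $\kappa$ with $\ell(\kappa)\le n$, $$C_\kappa(S) = C_\kappa(I_n)\int_{\mathrm{O}(n)} \prod_{j=1}^{\ell(\kappa)} \bigl[\det{}_j(H'SH)\bigr]^{\kappa_j-\kappa_{j+1}}\,dH,$$ where $\det_j$ is the leading $j\times j$ principal minor, $dH$ is normalized Haar measure on the orthogonal group $\mathrm{O}(n)$, zeroth powers equal $1$,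 and $$C_\kappa(I_n) = 2^{2|\kappa|}\,|\kappa|!\,(n/2)_\kappa\, \frac{\prod_{1\le i<j\le \ell(\kappa)} (2\kappa_i-2\kappa_j-i+j)}{\prod_{i=1}^{\ell(\kappa)} (2\kappa_i+\ell(\kappa)-i)!}.$$ (With this normalization $(\mathrm{tr}\,S)^k=\sum_{|\kappa|=k}C_\kappa(S)$, the sum being over $\ell(\kappa)\le n$.) Remainder: the normalizing constant of the matrix Bingham distribution on the Stiefel manifold $V_{d,p}=\{x\in\mathbb{R}^{d\times p}: x'x=I_p\}$ with density proportional to $\exp(\mathrm{tr}\,Ax'\Sigma x)$ with respect to the invariant probability measure is $$\Phi_{d,p}(A,\Sigma)=\sum_{k=0}^\infty \frac1{k!}\sum_{|\kappa|=k}\frac{C_\kappa(A)C_\kappa(\Sigma)}{C_\kappa(I_d)},$$ the inner sum being over partitions with $\ell(\kappa)\le p$; the remainder after truncation is $$\Phi_{d,p;m}(A,\Sigma)=\sum_{k=m}^\infty \frac1{k!}\sum_{|\kappa|=k}\frac{C_\kappa(A)C_\kappa(\Sigma)}{C_\kappa(I_d)},$$ again with $\ell(\kappa)\le p$ (the series converges absolutely). *)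

theory Defs
  imports
    "HOL-Probability.Probability"
    "Jordan_Normal_Form.Char_Poly"
begin

text \<open>
  Partitions are weakly decreasing, finitely supported sequences indexed from \<open>0\<close>:
  \<open>\<kappa> i\<close> is the part usually written \<open>\<kappa>\<^sub>i\<^sub>+\<^sub>1\<close>. Trailing zeros are part of the
  sequence, so every partition has a single representation.
\<close>

definition is_partition :: "(nat \<Rightarrow> nat) \<Rightarrow> bool" where
  "is_partition \<kappa> \<longleftrightarrow> antimono \<kappa> \<and> finite {i. \<kappa> i \<noteq> 0}"

definition plength :: "(nat \<Rightarrow> nat) \<Rightarrow> nat" where
  "plength \<kappa> = card {i. \<kappa> i \<noteq> 0}"

definition pweight :: "(nat \<Rightarrow> nat) \<Rightarrow> nat" where
  "pweight \<kappa> = (\<Sum>i | \<kappa> i \<noteq> 0. \<kappa> i)"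

definition partitions_of :: "nat \<Rightarrow> nat \<Rightarrow> (nat \<Rightarrow> nat) set" where
  "partitions_of k p = {\<kappa>. is_partition \<kappa> \<and> pweight \<kappa> = k \<and> plength \<kappa> \<le> p}"

definition shifted_factorial :: "real \<Rightarrow> (nat \<Rightarrow> nat) \<Rightarrow> real" where
  "shifted_factorial a \<kappa> = (\<Prod>i<plength \<kappa>. pochhammer (a - real i / 2) (\<kappa> i))"

definition orthogonal_group :: "nat \<Rightarrow> real mat set" where
  "orthogonal_group n =
     {H \<in> carrier_mat n n. transpose_mat H * H = 1\<^sub>m n \<and> H * transpose_mat H = 1\<^sub>m n}"

text \<open>
  The type \<open>real mat\<close> carries no topology. The Borel sets of \<open>O(n)\<close> are obtained from the
  embedding of \<open>O(n)\<close> into \<open>\<real>\<^sup>n\<^sup>\<times>\<^sup>n\<close> by its entries.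
\<close>

definition orthogonal_borel :: "nat \<Rightarrow> real mat measure" where
  "orthogonal_borel n =
     vimage_algebra (orthogonal_group n)
       (\<lambda>H. \<lambda>ij \<in> {..<n} \<times> {..<n}. H $$ ij)
       (\<Pi>\<^sub>M ij \<in> {..<n} \<times> {..<n}. borel)"

text \<open>
  Invariance of \<open>\<mu>\<close> under left translations, together with total mass \<open>1\<close>, determines
  \<open>\<mu>\<close> uniquely; since \<open>O(n)\<close> is compact, \<open>\<mu>\<close> is also invariant under right translations.
\<close>

definition is_normalized_haar :: "nat \<Rightarrow> real mat measure \<Rightarrow> bool" where
  "is_normalized_haar n \<mu> \<longleftrightarrow>
     prob_space \<mu> \<and> space \<mu> = orthogonal_group n \<and> sets \<mu> = sets (orthogonal_borel n) \<and>
     (\<forall>Q \<in> orthogonal_group n. distr \<mu> \<mu> (\<lambda>H. Q * H) = \<mu>)"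

definition haar :: "nat \<Rightarrow> real mat measure" where
  "haar n = (SOME \<mu>. is_normalized_haar n \<mu>)"

definition leading_minor :: "nat \<Rightarrow> real mat \<Rightarrow> real" where
  "leading_minor j M = Determinant.det (Matrix.mat j j (\<lambda>ij. M $$ ij))"

text \<open>The value \<open>C\<^sub>\<kappa>(I\<^sub>n)\<close>; the factor \<open>-i+j\<close> is not affected by the index shift.\<close>

definition zonal_const :: "nat \<Rightarrow> (nat \<Rightarrow> nat) \<Rightarrow> real" where
  "zonal_const n \<kappa> =
     (let l = plength \<kappa>; k = pweight \<kappa> in
      2 ^ (2 * k) * fact k * shifted_factorial (real n / 2) \<kappa> *
      (\<Prod>j<l. \<Prod>i<j. 2 * real (\<kappa> i) - 2 * real (\<kappa> j) - real i + real j) /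
      (\<Prod>i<l. fact (2 * \<kappa> i + l - Suc i)))"

definition zonal :: "(nat \<Rightarrow> nat) \<Rightarrow> real mat \<Rightarrow> real" where
  "zonal \<kappa> S =
     (let n = dim_row S in
      zonal_const n \<kappa> *
      (\<integral>H. (\<Prod>j<plength \<kappa>.
              leading_minor (Suc j) (transpose_mat H * S * H) ^ (\<kappa> j - \<kappa> (Suc j))) \<partial>haar n))"

definition bingham_term :: "nat \<Rightarrow> nat \<Rightarrow> real mat \<Rightarrow> real mat \<Rightarrow> nat \<Rightarrow> real" where
  "bingham_term d p A S k =
     (\<Sum>\<kappa> \<in> partitions_of k p. zonal \<kappa> A * zonal \<kappa> S / zonal \<kappa> (1\<^sub>m d)) / fact k"

text \<open>The normalizing constant \<open>\<Phi>\<^sub>d\<^sub>,\<^sub>p\<close> and its remainder \<open>\<Phi>\<^sub>d\<^sub>,\<^sub>p\<^sub>;\<^sub>m\<close>, the sum over \<open>k \<ge> m\<close>.\<close>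

definition bingham_const :: "nat \<Rightarrow> nat \<Rightarrow> real mat \<Rightarrow> real mat \<Rightarrow> real" where
  "bingham_const d p A S = (\<Sum>k. bingham_term d p A S k)"

definition bingham_remainder :: "nat \<Rightarrow> nat \<Rightarrow> nat \<Rightarrow> real mat \<Rightarrow> real mat \<Rightarrow> real" where
  "bingham_remainder d p m A S = (\<Sum>k. bingham_term d p A S (k + m))"

definition sym_pos_def :: "nat \<Rightarrow> real mat \<Rightarrow> bool" where
  "sym_pos_def n S \<longleftrightarrow>
     S \<in> carrier_mat n n \<and> transpose_mat S = S \<and>
     (\<forall>x \<in> carrier_vec n. x \<noteq> 0\<^sub>v n \<longrightarrow> x \<bullet> (S *\<^sub>v x) > 0)"

definition mat_trace :: "real mat \<Rightarrow> real" where
  "mat_trace S = (\<Sum>i<dim_row S. S $$ (i, i))"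

text \<open>
  The \<open>j\<close>-th largest eigenvalue \<open>\<sigma>\<^sub>(\<^sub>j\<^sub>)\<close>, for \<open>1 \<le> j \<le> n\<close>, counted with multiplicity as a root
  of the characteristic polynomial (all of whose roots are real if \<open>S\<close> is symmetric).
\<close>

definition ordered_eigenvalue :: "real mat \<Rightarrow> nat \<Rightarrow> real" where
  "ordered_eigenvalue S j = rev (sorted_list_of_multiset (proots (char_poly S))) ! (j - 1)"

end

theory Submission
  imports Defs "Jordan_Normal_Form.Schur_Decomposition"
begin

text \<open>
  Write \<open>f(M) = \<Prod>\<^sub>j det\<^sub>j(M)\<^bsup>\<kappa>\<^sub>j - \<kappa>\<^sub>j\<^sub>+\<^sub>1\<^esup>\<close>, so that the summand of \<open>\<kappa>\<close> is
  \<open>C\<^sub>\<kappa>(A)\<close> times the Haar mean of \<open>f(H'\<Sigma>H)\<close>. For a standard Gaussian matrix \<open>G\<close> the QR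
  decomposition and the invariance of Haar measure give
  \<open>E f(G'SG) = E f(G'G) \<cdot> \<integral> f(H'SH) dH\<close>, and \<open>E f(G'G)\<close> is a product of chi-square moments.
  The left-hand side is bounded below by \<open>det\<^sub>j(G'AG) \<ge> a\<^sub>1 \<cdots> a\<^sub>j det\<^sub>j(G)\<^sup>2\<close> for \<open>A\<close> with
  eigenvalues \<open>a\<^sub>1 \<ge> \<dots> \<ge> a\<^sub>p\<close>, and by \<open>det\<^sub>j(G'\<Sigma>G) \<ge> \<sigma>\<^sub>(\<^sub>p\<^sub>)\<^sup>j det\<^sub>j(X'X)\<close>, with \<open>X\<close> the leading
  \<open>p \<times> p\<close> block of \<open>G\<close>, for \<open>\<Sigma>\<close>. With the formula for \<open>C\<^sub>\<kappa>(I\<^sub>p)\<close> the summand is at least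
  \<open>(k!/\<Prod>\<kappa>\<^sub>i!) \<Prod>a\<^sub>i\<^bsup>\<kappa>\<^sub>i\<^esup> \<sigma>\<^sub>(\<^sub>p\<^sub>)\<^sup>k\<close> divided by a power of \<open>1 + k\<close>. Taking for \<open>\<kappa>\<close> the largest term of the
  multinomial expansion of \<open>(tr A)\<^sup>k\<close> bounds the \<open>k\<close>-th term of the series below by
  \<open>(1 + k)\<^bsup>-N\<^esup> (\<sigma>\<^sub>(\<^sub>p\<^sub>) tr A)\<^sup>k / k!\<close>; Bernoulli's inequality turns the power of \<open>1 + k\<close> into the stated
  geometric weight.
\<close>

section \<open>Determinants and positive semidefinite forms\<close>

text \<open>The obstacle is that a Haar average of a product of minors admits no direct estimate:
  the columns of an orthogonal matrix are dependent. The entries of a Gaussian matrix are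
  independent, so its moments factor, and the Haar average is a quotient of two of them. For A the
  explicit moment in the denominator cancels against a factor of C_\<kappa>(I_p); for \<Sigma> it
  leaves the ratio of the moments in dimensions p and d.

  The exponent (d+2)(d-1)/2 collects the polynomial losses in 1+k: p(p-1)/2 from the factors over
  pairs i<j in C_\<kappa>(I_p), p(d-p) from the moment ratio, p-1 from picking one multinomial term.
  With t = d-p their sum falls short of the exponent by t(t+1)/2.

  Since \<open>haar\<close> is chosen by \<open>SOME\<close>, existence of Haar measure has to be
  proved before its properties can be used. It comes from the same Gaussian matrices; their rotation
  invariance is reduced to reflections, which generate O(n), and reflections to shears and a change
  of one coordinate.\<close>

lemma index_congruence:
  fixes S :: "real mat"
  assumes S: "S \<in> carrier_mat n n" and G: "G \<in> carrier_mat n m" and a: "a < m" "b < m"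
  shows "(transpose_mat G * S * G) $$ (a, b) = (\<Sum>c<n. \<Sum>e<n. G $$ (c, a) * S $$ (c, e) * G $$ (e, b))"
proof -
  have "(transpose_mat G * S * G) $$ (a, b) = (\<Sum>e<n. (\<Sum>c<n. G $$ (c, a) * S $$ (c, e)) * G $$ (e, b))"
    using assms by (subst index_mult_mat) (auto simp: scalar_prod_def atLeast0LessThan)
  also have "\<dots> = (\<Sum>e<n. \<Sum>c<n. G $$ (c, a) * S $$ (c, e) * G $$ (e, b))"
    by (simp add: sum_distrib_right)
  finally show ?thesis by (subst sum.swap)
qed

lemma index_gram:
  fixes G :: "real mat"
  assumes G: "G \<in> carrier_mat n m" and a: "a < m" "b < m"
  shows "(transpose_mat G * G) $$ (a, b) = (\<Sum>c<n. G $$ (c, a) * G $$ (c, b))"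
  using assms by (simp add: scalar_prod_def atLeast0LessThan)

lemma det_congruence:
  assumes "A \<in> carrier_mat n n" "B \<in> carrier_mat n n"
  shows "Determinant.det (transpose_mat A * B * A) = (Determinant.det A)\<^sup>2 * Determinant.det (B :: real mat)"
proof -
  have "Determinant.det (transpose_mat A * B * A) = Determinant.det (transpose_mat A * B) * Determinant.det A"
    using assms by (intro det_mult[of _ n]) auto
  also have "Determinant.det (transpose_mat A * B) = Determinant.det A * Determinant.det B"
    using assms det_mult[of "transpose_mat A" n B] by (simp add: det_transpose)
  finally show ?thesis by (simp add: power2_eq_square mult_ac)
qed

text \<open>The first j columns of an upper triangular matrix vanish below row j, so the leading
  block of the congruence is the congruence of the leading blocks.\<close>

lemma leading_minor_upper_congruence:
  fixes T M :: "real mat"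
  assumes T: "T \<in> carrier_mat n n" and M: "M \<in> carrier_mat n n"
    and up: "\<And>a c. c < n \<Longrightarrow> a < c \<Longrightarrow> T $$ (c, a) = 0" and j: "j \<le> n"
  shows "leading_minor j (transpose_mat T * M * T) = (\<Prod>i<j. T $$ (i, i))\<^sup>2 * leading_minor j M"
proof -
  let ?T = "Matrix.mat j j (\<lambda>ij. T $$ ij)" and ?M = "Matrix.mat j j (\<lambda>ij. M $$ ij)"
  have entry: "(transpose_mat T * M * T) $$ (a, b) = (transpose_mat ?T * ?M * ?T) $$ (a, b)"
    if ab: "a < j" "b < j" for a b
  proof -
    have "(transpose_mat T * M * T) $$ (a, b) = (\<Sum>c<n. \<Sum>e<n. T $$ (c, a) * M $$ (c, e) * T $$ (e, b))"
      using index_congruence[OF M T] ab j by simp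
    also have "\<dots> = (\<Sum>c<j. \<Sum>e<n. T $$ (c, a) * M $$ (c, e) * T $$ (e, b))"
      using ab j up by (intro sum.mono_neutral_right) auto
    also have "\<dots> = (\<Sum>c<j. \<Sum>e<j. T $$ (c, a) * M $$ (c, e) * T $$ (e, b))"
      using ab j up by (intro sum.cong refl sum.mono_neutral_right) auto
    also have "\<dots> = (transpose_mat ?T * ?M * ?T) $$ (a, b)"
      using ab by (subst index_congruence[where n=j and m=j]) auto
    finally show ?thesis .
  qed
  have "Matrix.mat j j (\<lambda>ij. (transpose_mat T * M * T) $$ ij) = transpose_mat ?T * ?M * ?T"
    by (rule eq_matI) (use entry in auto)
  moreover have "Determinant.det ?T = (\<Prod>i<j. T $$ (i, i))"
  proof -
    have "upper_triangular ?T" using up j by (auto simp: upper_triangular_def)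
    then have "Determinant.det ?T = prod_list (diag_mat ?T)"
      by (rule det_upper_triangular[where n=j]) simp
    also have "\<dots> = (\<Prod>i<j. T $$ (i, i))"
      by (simp add: prod_list_diag_prod atLeast0LessThan)
    finally show ?thesis .
  qed
  ultimately show ?thesis
    unfolding leading_minor_def
    using det_congruence[of ?T j ?M] by simp
qed

section \<open>Schur complements and monotonicity of determinants\<close>

abbreviation mdet :: "nat \<Rightarrow> (nat \<times> nat \<Rightarrow> real) \<Rightarrow> real" where
  "mdet j F \<equiv> Determinant.det (Matrix.mat j j F)"

text \<open>Matrices are entry functions on all of \<open>nat\<close>, the size entering only
  through \<open>mdet j\<close> and \<open>qform j\<close>. Eliminating row and column 0 is then a
  shift of indices, which suits inductions on the size.\<close>

definition Schur_complement :: "(nat \<Rightarrow> nat \<Rightarrow> real) \<Rightarrow> nat \<Rightarrow> nat \<Rightarrow> real" where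
  "Schur_complement F a b = F (Suc a) (Suc b) - F (Suc a) 0 * F 0 (Suc b) / F 0 0"

text \<open>One step of Gaussian elimination: the matrix is \<open>L * U\<close> with
  \<open>L\<close> unit lower triangular and the first column of \<open>U\<close> zero below the
  corner, so that \<open>U\<close> splits into blocks.\<close>

lemma det_Schur_complement:
  fixes F :: "nat \<Rightarrow> nat \<Rightarrow> real"
  assumes F: "F 0 0 \<noteq> 0"
  shows "mdet (Suc j) (case_prod F) =
    F 0 0 * mdet j (case_prod (Schur_complement F))"
proof -
  define C where "C = Matrix.mat j j (case_prod (Schur_complement F))"
  define L where "L = Matrix.mat (Suc j) (Suc j) (\<lambda>(a, b). if a = b then 1 else if b = 0 then F a 0 / F 0 0 else 0)"
  define U where "U = Matrix.mat (Suc j) (Suc j) (\<lambda>(a, b). if a = 0 then F 0 b else if b = 0 then 0 else C $$ (a - 1, b - 1))"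
  have "Matrix.mat (Suc j) (Suc j) (case_prod F) = L * U"
  proof (rule eq_matI)
    fix a b assume "a < dim_row (L * U)" "b < dim_col (L * U)"
    then have ab: "a < Suc j" "b < Suc j" by (auto simp: L_def U_def)
    have "(L * U) $$ (a, b) = (\<Sum>c<Suc j. L $$ (a, c) * U $$ (c, b))"
      using ab by (simp add: L_def U_def scalar_prod_def atLeast0LessThan del: sum.lessThan_Suc)
    also have "\<dots> = (\<Sum>c\<in>{0, a}. L $$ (a, c) * U $$ (c, b))"
      using ab by (intro sum.mono_neutral_right) (auto simp: L_def)
    also have "\<dots> = F a b"
      using ab F by (cases a; cases b) (auto simp: L_def U_def C_def Schur_complement_def)
    finally show "Matrix.mat (Suc j) (Suc j) (case_prod F) $$ (a, b) = (L * U) $$ (a, b)" using ab by simp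
  qed (auto simp: L_def U_def)
  moreover have "Determinant.det L = 1"
  proof -
    have "Determinant.det L = prod_list (diag_mat L)"
      by (rule det_lower_triangular[where n="Suc j"]) (auto simp: L_def)
    also have "\<dots> = (\<Prod>i<Suc j. L $$ (i, i))" by (simp add: prod_list_diag_prod L_def atLeast0LessThan)
    also have "\<dots> = 1" by (intro prod.neutral) (auto simp: L_def)
    finally show ?thesis .
  qed
  moreover have "Determinant.det U = F 0 0 * Determinant.det C"
  proof -
    have "U = four_block_mat (Matrix.mat 1 1 (case_prod F)) (Matrix.mat 1 j (\<lambda>(a, b). F 0 (Suc b))) (0\<^sub>m j 1) C"
      by (rule eq_matI) (auto simp: U_def C_def four_block_mat_def)
    then have "Determinant.det U = mdet 1 (case_prod F) * Determinant.det C"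
      by (simp only:) (rule det_four_block_mat_lower_left_zero_col, auto simp: C_def)
    then show ?thesis by (simp add: det_single)
  qed
  moreover have "Determinant.det (L * U) = Determinant.det L * Determinant.det U"
    by (rule det_mult[where n="Suc j"]) (auto simp: L_def U_def)
  ultimately show ?thesis by (simp add: C_def)
qed

lemma det_zero_row:
  fixes F :: "nat \<Rightarrow> nat \<Rightarrow> real"
  assumes "\<And>b. b \<le> j \<Longrightarrow> F 0 b = 0"
  shows "mdet (Suc j) (case_prod F) = 0"
proof -
  let ?A = "Matrix.mat (Suc j) (Suc j) (case_prod F)"
  have "Determinant.det ?A = (\<Sum>b<Suc j. ?A $$ (0, b) * cofactor ?A 0 b)"
    by (rule laplace_expansion_row) auto
  also have "\<dots> = 0" using assms by (intro sum.neutral) auto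
  finally show ?thesis .
qed

definition qform :: "nat \<Rightarrow> (nat \<Rightarrow> nat \<Rightarrow> real) \<Rightarrow> (nat \<Rightarrow> real) \<Rightarrow> real" where
  "qform j F x = (\<Sum>a<j. \<Sum>b<j. F a b * x a * x b)"

lemma qform_Suc:
  assumes sym: "\<And>a b. F a b = F b a"
  shows "qform (Suc j) F x = F 0 0 * (x 0)\<^sup>2 + 2 * x 0 * (\<Sum>b<j. F 0 (Suc b) * x (Suc b)) +
    qform j (\<lambda>a b. F (Suc a) (Suc b)) (\<lambda>a. x (Suc a))"
proof -
  have "qform (Suc j) F x = (\<Sum>b<Suc j. F 0 b * x 0 * x b) + (\<Sum>a<j. \<Sum>b<Suc j. F (Suc a) b * x (Suc a) * x b)"
    unfolding qform_def by (rule sum.lessThan_Suc_shift)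
  also have "(\<Sum>b<Suc j. F 0 b * x 0 * x b) = F 0 0 * (x 0)\<^sup>2 + x 0 * (\<Sum>b<j. F 0 (Suc b) * x (Suc b))"
    by (simp add: sum.lessThan_Suc_shift sum_distrib_left power2_eq_square mult_ac del: sum.lessThan_Suc)
  also have "(\<Sum>a<j. \<Sum>b<Suc j. F (Suc a) b * x (Suc a) * x b) =
     x 0 * (\<Sum>a<j. F 0 (Suc a) * x (Suc a)) + (\<Sum>a<j. \<Sum>b<j. F (Suc a) (Suc b) * x (Suc a) * x (Suc b))"
    by (simp add: sum.lessThan_Suc_shift sum.distrib sum_distrib_left mult_ac sym[of "Suc _" 0] del: sum.lessThan_Suc)
  finally show ?thesis by (simp add: qform_def)
qed

text \<open>Completing the square in \<open>x 0\<close>. For a positive corner it exhibits the form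
  of the Schur complement as what is left after minimising over \<open>x 0\<close>.\<close>

lemma qform_Schur:
  assumes sym: "\<And>a b. F a b = F b a" and F: "F 0 0 \<noteq> 0"
  shows "qform (Suc j) F x = F 0 0 * (x 0 + (\<Sum>b<j. F 0 (Suc b) * x (Suc b)) / F 0 0)\<^sup>2 +
    qform j (Schur_complement F) (\<lambda>a. x (Suc a))"
proof -
  let ?s = "\<Sum>b<j. F 0 (Suc b) * x (Suc b)"
  have "qform j (Schur_complement F) (\<lambda>a. x (Suc a)) =
     qform j (\<lambda>a b. F (Suc a) (Suc b)) (\<lambda>a. x (Suc a)) -
     (\<Sum>a<j. \<Sum>b<j. (F 0 (Suc a) * x (Suc a)) * (F 0 (Suc b) * x (Suc b))) / F 0 0"
    by (simp add: qform_def Schur_complement_def sum_subtractf sum_divide_distrib algebra_simps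
        diff_divide_distrib sym[of "Suc _" 0])
  also have "(\<Sum>a<j. \<Sum>b<j. (F 0 (Suc a) * x (Suc a)) * (F 0 (Suc b) * x (Suc b))) = ?s\<^sup>2"
    by (simp add: sum_product power2_eq_square)
  finally have *: "qform j (Schur_complement F) (\<lambda>a. x (Suc a)) =
    qform j (\<lambda>a b. F (Suc a) (Suc b)) (\<lambda>a. x (Suc a)) - ?s\<^sup>2 / F 0 0" .
  have "F 0 0 * (x 0 + ?s / F 0 0)\<^sup>2 = F 0 0 * (x 0)\<^sup>2 + 2 * x 0 * ?s + ?s\<^sup>2 / F 0 0"
    using F by (simp add: power2_eq_square field_simps)
  then show ?thesis unfolding * by (subst qform_Suc[of F, OF sym]) simp
qed

lemma qform_unit:
  assumes "i < j"
  shows "qform j F (\<lambda>a. if a = i then 1 else 0) = F i i"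
proof -
  have "qform j F (\<lambda>a. if a = i then 1 else 0) = (\<Sum>a<j. \<Sum>b<j. if b = i then F a b * (if a = i then 1 else 0) else 0)"
    unfolding qform_def by (intro sum.cong refl) auto
  also have "\<dots> = (\<Sum>a<j. if a = i then F a i else 0)"
    using assms by (intro sum.cong refl) (auto simp: sum.delta)
  finally show ?thesis using assms by (simp add: sum.delta)
qed

text \<open>The Schur complement is a partial minimum of the quadratic form, hence monotone.\<close>

lemma Schur_complement_psd_mono:
  assumes sym: "\<And>a b. F a b = F b a" "\<And>a b. E a b = E b a"
    and E: "E 0 0 > 0" and F: "F 0 0 > 0" and le: "\<And>x. qform (Suc j) E x \<le> qform (Suc j) F x"
  shows "qform j (Schur_complement E) x \<le> qform j (Schur_complement F) x"
proof -
  \<comment> \<open>\<open>y\<close> extends \<open>x\<close> by the value of coordinate 0 at which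
    the form of \<open>F\<close> is minimal. For \<open>E\<close> any extension gives an upper
    bound, since its square term is nonnegative.\<close>
  define y where "y = (\<lambda>a. case a of 0 \<Rightarrow> - (\<Sum>b<j. F 0 (Suc b) * x b) / F 0 0 | Suc a \<Rightarrow> x a)"
  have "qform j (Schur_complement E) x \<le> qform (Suc j) E y"
    using E by (subst qform_Schur[of E, OF sym(2)]) (auto simp: y_def)
  also have "\<dots> \<le> qform (Suc j) F y" by (rule le)
  also have "\<dots> = qform j (Schur_complement F) x"
    using F by (subst qform_Schur[of F, OF sym(1)]) (auto simp: y_def)
  finally show ?thesis .
qed

lemma Schur_complement_psd:
  assumes sym: "\<And>a b. F a b = F b a" and F: "F 0 0 > 0" and le: "\<And>x. 0 \<le> qform (Suc j) F x"
  shows "0 \<le> qform j (Schur_complement F) x"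
proof -
  define y where "y = (\<lambda>a. case a of 0 \<Rightarrow> - (\<Sum>b<j. F 0 (Suc b) * x b) / F 0 0 | Suc a \<Rightarrow> x a)"
  have "0 \<le> qform (Suc j) F y" by (rule le)
  also have "\<dots> = qform j (Schur_complement F) x"
    using F by (subst qform_Schur[of F, OF sym(1)]) (auto simp: y_def)
  finally show ?thesis .
qed

text \<open>A vanishing diagonal entry of a positive semidefinite form forces its row to vanish: the
  vector with entry t at 0 and 1 at b gives \<open>2 * t * F 0 b + F b b\<close>, which must stay
  nonnegative for all t.\<close>

lemma det_psd_zero_corner:
  assumes sym: "\<And>a b. F a b = F b a" and pos: "\<And>x. 0 \<le> qform (Suc j) F x" and F: "F 0 0 = 0"
  shows "mdet (Suc j) (case_prod F) = 0"
proof (rule det_zero_row)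
  fix b assume b: "b \<le> j"
  show "F 0 b = 0"
  proof (cases b)
    case (Suc c)
    then have c: "c < j" using b by simp
    have t: "0 \<le> 2 * t * F 0 b + F b b" for t
    proof -
      define x where "x = (\<lambda>a. if a = 0 then t else if a = b then 1 else 0)"
      have x: "x (Suc a) = (if a = c then 1 else 0)" for a by (simp add: x_def Suc)
      have "qform (Suc j) F x = 2 * t * (\<Sum>b<j. F 0 (Suc b) * x (Suc b)) +
          qform j (\<lambda>a b. F (Suc a) (Suc b)) (\<lambda>a. x (Suc a))"
        by (subst qform_Suc[of F, OF sym]) (simp add: F x_def)
      also have "\<dots> = 2 * t * F 0 b + F b b"
        using c unfolding x by (subst qform_unit) (auto simp: Suc if_distrib sum.delta cong: if_cong)
      finally show ?thesis using pos[of x] by simp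
    qed
    have "F 0 b = 0"
    proof (rule ccontr)
      assume "F 0 b \<noteq> 0"
      \<comment> \<open>The argument is chosen so that the affine function of t takes the value
        -1.\<close>
      then have "2 * (- (F b b + 1) / (2 * F 0 b)) * F 0 b = - (F b b + 1)" by simp
      with t[of "- (F b b + 1) / (2 * F 0 b)"] show False by linarith
    qed
    then show ?thesis .
  qed (use F in simp)
qed

text \<open>Monotonicity of the determinant in the Loewner order. Both the corner and the
  determinant of the Schur complement grow from \<open>E\<close> to \<open>F\<close>; nonnegativity
  is carried along because products are compared.\<close>

lemma det_mono_psd:
  assumes "\<And>a b. F a b = F b a" "\<And>a b. E a b = E b a"
    and "\<And>x. 0 \<le> qform j E x" "\<And>x. qform j E x \<le> qform j F x"
  shows "0 \<le> mdet j (case_prod E) \<and>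
    mdet j (case_prod E) \<le> mdet j (case_prod F)"
  using assms
proof (induction j arbitrary: F E)
  case 0
  then show ?case by simp
next
  case (Suc j)
  note F = Suc.prems(1) and E = Suc.prems(2)
  have posF: "0 \<le> qform (Suc j) F x" for x using Suc.prems(3,4) order_trans by blast
  have sym: "Schur_complement H a b = Schur_complement H b a" if "\<And>a b. H a b = H b a" for H a b
    using that[of "Suc a" "Suc b"] that[of "Suc a" 0] that[of "Suc b" 0] by (simp add: Schur_complement_def)
  have corner: "0 \<le> E 0 0" "E 0 0 \<le> F 0 0"
    using Suc.prems(3,4)[of "\<lambda>a. if a = 0 then 1 else 0"] by (simp_all add: qform_unit)
  show ?case
  \<comment> \<open>The Schur complement requires a nonzero corner. With a zero corner the
    determinant of \<open>E\<close> vanishes and only nonnegativity for \<open>F\<close>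
    remains.\<close>
  proof (cases "E 0 0 = 0")
    case True
    then have "mdet (Suc j) (case_prod E) = 0"
      using det_psd_zero_corner[of E, OF E] Suc.prems(3) by blast
    moreover have "0 \<le> mdet (Suc j) (case_prod F)"
    proof (cases "F 0 0 = 0")
      case True
      then show ?thesis using det_psd_zero_corner[of F, OF F posF] by simp
    next
      case False
      then have F0: "F 0 0 > 0" using corner by simp
      \<comment> \<open>Applied to the pair (\<open>F\<close>, \<open>F\<close>), the induction
        hypothesis is just nonnegativity.\<close>
      have "0 \<le> mdet j (case_prod (Schur_complement F))"
        using Suc.IH[of "Schur_complement F" "Schur_complement F"] sym[of F]
          Schur_complement_psd[of F j, OF F F0 posF] F by blast
      then show ?thesis using F0 by (subst det_Schur_complement) simp_all
    qed
    ultimately show ?thesis by simp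
  next
    case False
    then have E0: "E 0 0 > 0" and F0: "F 0 0 > 0" using corner by auto
    have "0 \<le> mdet j (case_prod (Schur_complement E)) \<and>
        mdet j (case_prod (Schur_complement E))
        \<le> mdet j (case_prod (Schur_complement F))"
      using Schur_complement_psd[of E j, OF E E0 Suc.prems(3)]
        Schur_complement_psd_mono[of F E j, OF F E E0 F0 Suc.prems(4)]
      by (intro Suc.IH sym F E) auto
    with E0 F0 corner show ?thesis
      by (simp add: det_Schur_complement mult_mono)
  qed
qed

lemma qform_weighted_gram:
  "qform j (\<lambda>a b. \<Sum>r<n. e r * G r a * G r b) x = (\<Sum>r<n. e r * (\<Sum>a<j. G r a * x a)\<^sup>2)"
proof -
  have "qform j (\<lambda>a b. \<Sum>r<n. e r * G r a * G r b) x =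
      (\<Sum>a<j. \<Sum>b<j. \<Sum>r<n. e r * (G r a * x a) * (G r b * x b))"
    unfolding qform_def sum_distrib_right by (intro sum.cong refl) (simp add: mult_ac)
  also have "\<dots> = (\<Sum>a<j. \<Sum>r<n. \<Sum>b<j. e r * (G r a * x a) * (G r b * x b))"
    by (intro sum.cong refl sum.swap)
  also have "\<dots> = (\<Sum>r<n. \<Sum>a<j. \<Sum>b<j. e r * (G r a * x a) * (G r b * x b))"
    by (rule sum.swap)
  also have "\<dots> = (\<Sum>r<n. e r * (\<Sum>a<j. G r a * x a)\<^sup>2)"
    by (simp add: power2_eq_square sum_product sum_distrib_left mult_ac)
  finally show ?thesis .
qed

text \<open>The form of a weighted Gram matrix is a sum of squares with coefficients
  \<open>e r\<close>, hence increases with the weights. The later bounds on minors of G' diag(e) G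
  all lower or raise weights.\<close>

lemma det_weighted_gram_mono:
  fixes G :: "nat \<Rightarrow> nat \<Rightarrow> real"
  assumes "\<And>r. r < n \<Longrightarrow> 0 \<le> e r" "\<And>r. r < n \<Longrightarrow> e r \<le> f r"
  defines "F \<equiv> \<lambda>e a b. \<Sum>r<n. e r * G r a * G r b"
  shows "0 \<le> mdet j (case_prod (F e)) \<and>
    mdet j (case_prod (F e)) \<le> mdet j (case_prod (F f))"
proof (rule det_mono_psd)
  show "0 \<le> qform j (F e) x" for x
    unfolding F_def qform_weighted_gram using assms(1) by (intro sum_nonneg) auto
  show "qform j (F e) x \<le> qform j (F f) x" for x
    unfolding F_def qform_weighted_gram using assms(1,2) by (intro sum_mono mult_right_mono) auto
qed (auto simp: F_def mult_ac)

section \<open>Reflections and the QR decomposition\<close>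

text \<open>If \<open>w\<close> vanishes below \<open>n\<close>, the division by zero gives 0 and
  the matrix is the identity. Hence it is orthogonal for every \<open>w\<close>, without a case
  distinction for the user.\<close>

definition householder :: "nat \<Rightarrow> (nat \<Rightarrow> real) \<Rightarrow> real mat" where
  "householder n w = Matrix.mat n n
     (\<lambda>(i, j). (if i = j then 1 else 0) - 2 * w i * w j / (\<Sum>c<n. (w c)\<^sup>2))"

lemma householder_carrier [simp]: "householder n w \<in> carrier_mat n n"
  and householder_dim [simp]: "dim_row (householder n w) = n" "dim_col (householder n w) = n"
  by (auto simp: householder_def)

lemma householder_mult:
  assumes G: "G \<in> carrier_mat n m" and ij: "i < n" "j < m"
  shows "(householder n w * G) $$ (i, j) =
    G $$ (i, j) - 2 * w i * (\<Sum>c<n. w c * G $$ (c, j)) / (\<Sum>c<n. (w c)\<^sup>2)"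
proof -
  have "(householder n w * G) $$ (i, j) =
      (\<Sum>c<n. ((if i = c then 1 else 0) - 2 * w i * w c / (\<Sum>c<n. (w c)\<^sup>2)) * G $$ (c, j))"
    using assms by (simp add: householder_def scalar_prod_def atLeast0LessThan)
  also have "\<dots> = (\<Sum>c<n. if c = i then G $$ (c, j) else 0) -
      (\<Sum>c<n. 2 * w i * w c / (\<Sum>c<n. (w c)\<^sup>2) * G $$ (c, j))"
    unfolding sum_subtractf[symmetric] by (intro sum.cong refl) (auto simp: algebra_simps)
  also have "(\<Sum>c<n. if c = i then G $$ (c, j) else 0) = G $$ (i, j)"
    using ij by simp
  also have "(\<Sum>c<n. 2 * w i * w c / (\<Sum>c<n. (w c)\<^sup>2) * G $$ (c, j)) =
      2 * w i * (\<Sum>c<n. w c * G $$ (c, j)) / (\<Sum>c<n. (w c)\<^sup>2)"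
    by (simp add: sum_distrib_left sum_divide_distrib mult_ac)
  finally show ?thesis .
qed

lemma orthogonal_groupI:
  assumes "Q \<in> carrier_mat n n" "transpose_mat Q * Q = 1\<^sub>m n"
  shows "Q \<in> orthogonal_group n"
  using assms mat_mult_left_right_inverse[of "transpose_mat Q" n Q]
  by (auto simp: orthogonal_group_def)

lemma orthogonal_groupD:
  assumes "Q \<in> orthogonal_group n"
  shows "Q \<in> carrier_mat n n" "transpose_mat Q * Q = 1\<^sub>m n" "Q * transpose_mat Q = 1\<^sub>m n"
    "dim_row Q = n" "dim_col Q = n"
  using assms by (auto simp: orthogonal_group_def)

lemma orthogonal_group_one [simp]: "1\<^sub>m n \<in> orthogonal_group n"
  by (simp add: orthogonal_group_def)

lemma orthogonal_group_transpose: "Q \<in> orthogonal_group n \<Longrightarrow> transpose_mat Q \<in> orthogonal_group n"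
  by (auto simp: orthogonal_group_def)

lemma orthogonal_group_mult:
  assumes "P \<in> orthogonal_group n" "Q \<in> orthogonal_group n"
  shows "P * Q \<in> orthogonal_group n"
proof (rule orthogonal_groupI)
  note P = orthogonal_groupD[OF assms(1)] and Q = orthogonal_groupD[OF assms(2)]
  show "P * Q \<in> carrier_mat n n" using P Q by auto
  have "transpose_mat (P * Q) * (P * Q) = transpose_mat Q * (transpose_mat P * (P * Q))"
    using P(1) Q(1) by (simp add: transpose_mult[of P n n Q n] assoc_mult_mat[of _ n n _ n _ n])
  also have "transpose_mat P * (P * Q) = Q"
    using P(1,2) Q(1) by (simp flip: assoc_mult_mat[of _ n n _ n _ n])
  finally show "transpose_mat (P * Q) * (P * Q) = 1\<^sub>m n" using Q(2) by simp
qed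

lemma householder_orthogonal: "householder n w \<in> orthogonal_group n"
proof (rule orthogonal_groupI)
  let ?s = "\<Sum>c<n. (w c)\<^sup>2"
  have tr: "transpose_mat (householder n w) = householder n w"
    by (rule eq_matI) (auto simp: householder_def)
  show "transpose_mat (householder n w) * householder n w = 1\<^sub>m n"
  proof (rule eq_matI)
    fix i j assume "i < dim_row (1\<^sub>m n :: real mat)" "j < dim_col (1\<^sub>m n :: real mat)"
    then have ij: "i < n" "j < n" by auto
    have "(\<Sum>c<n. w c * householder n w $$ (c, j)) =
        (\<Sum>c<n. (if c = j then w c else 0) - (w c)\<^sup>2 * (2 * w j / ?s))"
      using ij by (intro sum.cong refl) (auto simp: householder_def algebra_simps power2_eq_square)
    also have "\<dots> = w j - ?s * (2 * w j / ?s)"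
      using ij by (simp only: sum_subtractf sum_distrib_right[symmetric]) simp
    finally have *: "(\<Sum>c<n. w c * householder n w $$ (c, j)) = w j - ?s * (2 * w j / ?s)" .
    have "(householder n w * householder n w) $$ (i, j) = (if i = j then 1 else 0)"
      using ij unfolding householder_mult[OF householder_carrier ij] *
      by (cases "?s = 0") (simp_all add: householder_def field_simps)
    then show "(transpose_mat (householder n w) * householder n w) $$ (i, j) = 1\<^sub>m n $$ (i, j)"
      using ij tr by simp
  qed auto
qed auto

text \<open>Products of reflections instead of arbitrary orthogonal matrices: invariance of the
  Gaussian measure is proved for one reflection and passes to products by induction.\<close>

inductive_set reflection_products :: "nat \<Rightarrow> real mat set" for n where
  one: "1\<^sub>m n \<in> reflection_products n"
| reflect: "Q \<in> reflection_products n \<Longrightarrow> householder n w * Q \<in> reflection_products n"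

lemma reflection_products_orthogonal: "Q \<in> reflection_products n \<Longrightarrow> Q \<in> orthogonal_group n"
  by (induction rule: reflection_products.induct)
     (auto intro: orthogonal_group_mult householder_orthogonal)

text \<open>Householder elimination, one column at a time. After m steps the first m columns are
  triangular with nonnegative diagonal, and the next reflection leaves them alone.\<close>

lemma QR_decomposition:
  assumes G: "G \<in> carrier_mat n n"
  obtains Q where "Q \<in> reflection_products n"
    "\<And>i j. i < n \<Longrightarrow> j < i \<Longrightarrow> (Q * G) $$ (i, j) = 0" "\<And>j. j < n \<Longrightarrow> 0 \<le> (Q * G) $$ (j, j)"
proof -
  have "\<exists>Q\<in>reflection_products n. \<forall>j<m. (\<forall>i<n. j < i \<longrightarrow> (Q * G) $$ (i, j) = 0) \<and> 0 \<le> (Q * G) $$ (j, j)"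
    if "m \<le> n" for m
    using that
  proof (induction m)
    case 0
    then show ?case using reflection_products.one by blast
  next
    case (Suc m)
    then obtain Q where Q: "Q \<in> reflection_products n"
      and tri: "\<And>i j. j < m \<Longrightarrow> i < n \<Longrightarrow> j < i \<Longrightarrow> (Q * G) $$ (i, j) = 0"
      and diag: "\<And>j. j < m \<Longrightarrow> 0 \<le> (Q * G) $$ (j, j)"
      by force
    have m: "m < n" using Suc.prems by simp
    define M where "M = Q * G"
    have M: "M \<in> carrier_mat n n"
      using G orthogonal_groupD(1)[OF reflection_products_orthogonal[OF Q]] by (simp add: M_def)
    define v where "v i = M $$ (i, m)" for i
    define \<alpha> where "\<alpha> = sqrt (\<Sum>i\<in>{m..<n}. (v i)\<^sup>2)"
    \<comment> \<open>\<open>w\<close> is the part of \<open>v\<close> from row m on, minus \<alpha>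
      times the m-th unit vector. It is zero above row m and hence orthogonal to the columns already
      treated, which are zero from row m on.\<close>
    define w where "w i = (if m \<le> i then v i - (if i = m then \<alpha> else 0) else 0)" for i
    let ?s = "\<Sum>c<n. (w c)\<^sup>2"
    have \<alpha>2: "\<alpha>\<^sup>2 = (\<Sum>i\<in>{m..<n}. (v i)\<^sup>2)"
      unfolding \<alpha>_def by (simp add: sum_nonneg)
    have split: "(\<Sum>i<n. if m \<le> i then f i else 0) = (\<Sum>i\<in>{m..<n}. f i)" for f :: "nat \<Rightarrow> real"
      by (rule sum.mono_neutral_cong_right) auto
    have remove: "(\<Sum>i\<in>{m..<n}. f i) = f m + (\<Sum>i\<in>{m<..<n}. f i)" for f :: "nat \<Rightarrow> real"
    proof -
      have "{m..<n} = insert m {m<..<n}" using m by auto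
      then show ?thesis by simp
    qed
    have "?s = (\<Sum>i\<in>{m..<n}. (v i - (if i = m then \<alpha> else 0))\<^sup>2)"
      by (subst split[symmetric]) (intro sum.cong refl, auto simp: w_def)
    also have "\<dots> = (v m - \<alpha>)\<^sup>2 + (\<Sum>i\<in>{m<..<n}. (v i)\<^sup>2)"
      by (subst remove) (auto intro!: sum.cong)
    also have "\<dots> = 2 * (\<alpha>\<^sup>2 - \<alpha> * v m)"
      using \<alpha>2 by (subst (asm) remove) (simp add: power2_eq_square algebra_simps)
    finally have s: "?s = 2 * (\<alpha>\<^sup>2 - \<alpha> * v m)" .
    have "(\<Sum>c<n. w c * v c) = (\<Sum>i\<in>{m..<n}. (v i - (if i = m then \<alpha> else 0)) * v i)"
      by (subst split[symmetric]) (intro sum.cong refl, auto simp: w_def)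
    also have "\<dots> = (v m - \<alpha>) * v m + (\<Sum>i\<in>{m<..<n}. (v i)\<^sup>2)"
      by (subst remove) (auto intro!: sum.cong simp: power2_eq_square)
    also have "\<dots> = \<alpha>\<^sup>2 - \<alpha> * v m"
      using \<alpha>2 by (subst (asm) remove) (simp add: power2_eq_square algebra_simps)
    \<comment> \<open>The inner product of \<open>w\<close> with \<open>v\<close> is half the
      squared norm of \<open>w\<close>, so the reflection takes \<open>v\<close> to
      \<open>v - w\<close>, whose entries from row m on are \<alpha>, 0, ..., 0.\<close>
    finally have wv: "(\<Sum>c<n. w c * v c) = ?s / 2" using s by simp
    have refl: "(householder n w * M) $$ (i, m) = v i - w i" if "i < n" for i
    proof (cases "?s = 0")
      case True
      then have "w i = 0" using that by (simp add: sum_nonneg_eq_0_iff)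
      then show ?thesis using householder_mult[OF M that m] by (simp add: v_def)
    next
      case False
      have "(householder n w * M) $$ (i, m) = v i - 2 * w i * (?s / 2) / ?s"
        using householder_mult[OF M that m, of w] unfolding v_def[symmetric] wv .
      then show ?thesis using False by simp
    qed
    have old: "(householder n w * M) $$ (i, j) = M $$ (i, j)" if ij: "i < n" "j < m" for i j
    proof -
      have "(\<Sum>c<n. w c * M $$ (c, j)) = 0"
        using tri ij by (intro sum.neutral) (auto simp: w_def M_def)
      then show ?thesis using householder_mult[OF M ij(1), of j w] ij m by simp
    qed
    have assoc: "householder n w * Q * G = householder n w * M"
      using G orthogonal_groupD(1)[OF reflection_products_orthogonal[OF Q]]
      by (simp add: M_def assoc_mult_mat[of _ n n _ n _ n])
    show ?case
    proof (intro bexI[of _ "householder n w * Q"] allI impI conjI)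
      show "householder n w * Q \<in> reflection_products n" using Q by (rule reflection_products.reflect)
      show "(householder n w * Q * G) $$ (i, j) = 0" if "j < Suc m" "i < n" "j < i" for i j
        using that tri[of j i] old[of i j] refl[of i] unfolding assoc
        by (cases "j = m") (auto simp: w_def M_def)
      have "0 \<le> \<alpha>" by (simp add: \<alpha>_def sum_nonneg)
      then show "0 \<le> (householder n w * Q * G) $$ (j, j)" if "j < Suc m" for j
        using that diag[of j] old[of j j] refl[of j] m unfolding assoc
        by (cases "j = m") (auto simp: w_def M_def)
    qed
  qed
  from this[of n] show ?thesis using that by auto
qed

text \<open>By induction on the rows, column i is \<open>T $$ (i, i)\<close> times a unit vector:
  its entries above the diagonal lie in rows already known, those below vanish. Orthonormality and
  the sign of the diagonal then fix row i.\<close>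

lemma orthogonal_upper_triangular_one:
  assumes T: "T \<in> orthogonal_group n"
    and up: "\<And>i j. i < n \<Longrightarrow> j < i \<Longrightarrow> T $$ (i, j) = 0" and pos: "\<And>j. j < n \<Longrightarrow> 0 \<le> T $$ (j, j)"
  shows "T = 1\<^sub>m n"
proof -
  note C = orthogonal_groupD[OF T]
  have gram: "(\<Sum>c<n. T $$ (c, i) * T $$ (c, j)) = (if i = j then 1 else 0)" if "i < n" "j < n" for i j
    using index_gram[OF C(1) that] that C(2) by simp
  have "T $$ (i, j) = (if i = j then 1 else 0)" if "i < n" "j < n" for i j
    using that
  proof (induction i arbitrary: j rule: less_induct)
    case (less i)
    have sum: "(\<Sum>c<n. T $$ (c, i) * T $$ (c, j)) = T $$ (i, i) * T $$ (i, j)" if j: "j < n" for j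
    proof (subst sum.remove[of _ i])
      have "T $$ (c, i) = 0" if "c < n" "c \<noteq> i" for c
        using that less.IH[of c i] less.prems up[of c i] by (cases "c < i") auto
      then have "(\<Sum>c\<in>{..<n} - {i}. T $$ (c, i) * T $$ (c, j)) = 0" by (intro sum.neutral) auto
      then show "T $$ (i, i) * T $$ (i, j) + (\<Sum>c\<in>{..<n} - {i}. T $$ (c, i) * T $$ (c, j)) = T $$ (i, i) * T $$ (i, j)"
        by simp
    qed (use less.prems in auto)
    have "T $$ (i, i) * T $$ (i, i) = 1" using sum[of i] gram[of i i] less.prems by simp
    then have Tii: "T $$ (i, i) = 1"
      using pos[OF less.prems(1)] by (metis abs_of_nonneg abs_1 power2_eq_1_iff power2_eq_square abs_minus_cancel)
    then show ?case using sum[OF less.prems(2)] gram[OF less.prems] less.prems by auto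
  qed
  then show ?thesis using C by (intro eq_matI) auto
qed

text \<open>Triangularising \<open>Q'\<close> by reflections leaves an orthogonal triangular matrix, hence the identity.\<close>

lemma orthogonal_group_eq_reflection_products: "orthogonal_group n = reflection_products n"
proof
  show "orthogonal_group n \<subseteq> reflection_products n"
  proof
    fix Q assume Q: "Q \<in> orthogonal_group n"
    note C = orthogonal_groupD[OF Q]
    have "transpose_mat Q \<in> carrier_mat n n" using C by auto
    from QR_decomposition[OF this] obtain P where P: "P \<in> reflection_products n"
      and tri: "\<And>i j. i < n \<Longrightarrow> j < i \<Longrightarrow> (P * transpose_mat Q) $$ (i, j) = 0"
        "\<And>j. j < n \<Longrightarrow> 0 \<le> (P * transpose_mat Q) $$ (j, j)"
      by blast
    have PO: "P \<in> orthogonal_group n" by (rule reflection_products_orthogonal[OF P])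
    have "P * transpose_mat Q = 1\<^sub>m n"
      using orthogonal_upper_triangular_one[OF orthogonal_group_mult[OF PO orthogonal_group_transpose[OF Q]] tri] .
    then have "(P * transpose_mat Q) * Q = Q" using C by simp
    moreover have "(P * transpose_mat Q) * Q = P"
      using C orthogonal_groupD[OF PO] by (simp add: assoc_mult_mat[of _ n n _ n _ n])
    ultimately show "Q \<in> reflection_products n" using P by simp
  qed
qed (use reflection_products_orthogonal in blast)

section \<open>The spectral theorem with ordered eigenvalues\<close>

lemma sum_lessThan_single:
  fixes f :: "nat \<Rightarrow> 'a :: comm_monoid_add"
  assumes "\<And>c. c < n \<Longrightarrow> c \<noteq> j \<Longrightarrow> f c = 0" "j < n"
  shows "(\<Sum>c<n. f c) = f j"
  using assms sum.mono_neutral_right[of "{..<n}" "{j}" f] by auto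

text \<open>For an eigenvector z the number \<open>q\<close> = z* S z equals \<open>x\<close> times
  the squared norm of z and, S being real and symmetric, its own conjugate.\<close>

lemma symmetric_real_root_char_poly:
  fixes S :: "real mat"
  assumes S: "S \<in> carrier_mat n n" "transpose_mat S = S"
    and root: "poly (char_poly (map_mat complex_of_real S)) x = 0"
  shows "x \<in> \<real>"
proof -
  let ?C = "map_mat complex_of_real S"
  have C: "?C \<in> carrier_mat n n" using S by simp
  from root have "eigenvalue ?C x" using eigenvalue_root_char_poly[OF C] by simp
  then obtain v where v: "v \<in> carrier_vec n" "v \<noteq> 0\<^sub>v n" and ev: "?C *\<^sub>v v = x \<cdot>\<^sub>v v"
    using C by (auto simp: eigenvalue_def eigenvector_def)
  define z where "z i = vec_index v i" for i
  have row: "(\<Sum>j<n. complex_of_real (S $$ (i, j)) * z j) = x * z i" if "i < n" for i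
  proof -
    have "vec_index (?C *\<^sub>v v) i = vec_index (x \<cdot>\<^sub>v v) i" using ev by simp
    then show ?thesis using that v S by (simp add: scalar_prod_def atLeast0LessThan z_def)
  qed
  have sym: "S $$ (i, j) = S $$ (j, i)" if "i < n" "j < n" for i j
  proof -
    have "transpose_mat S $$ (i, j) = S $$ (j, i)" using that S(1) by simp
    then show ?thesis using S(2) by simp
  qed
  define q where "q = (\<Sum>i<n. \<Sum>j<n. cnj (z i) * complex_of_real (S $$ (i, j)) * z j)"
  have "q = (\<Sum>i<n. cnj (z i) * (x * z i))"
    unfolding q_def by (intro sum.cong refl) (simp add: row[symmetric] sum_distrib_left mult_ac)
  also have "\<dots> = x * of_real (\<Sum>i<n. (cmod (z i))\<^sup>2)"
    unfolding of_real_sum sum_distrib_left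
    by (intro sum.cong refl) (simp add: complex_norm_square[unfolded of_real_power[symmetric]] mult_ac del: of_real_power)
  finally have q: "q = x * of_real (\<Sum>i<n. (cmod (z i))\<^sup>2)" .
  have "cnj q = (\<Sum>i<n. \<Sum>j<n. cnj (z j) * complex_of_real (S $$ (j, i)) * z i)"
    unfolding q_def cnj_sum by (intro sum.cong refl) (simp add: sym mult_ac)
  also have "\<dots> = q" unfolding q_def by (rule sum.swap)
  finally have "q \<in> \<real>" by (simp add: Reals_cnj_iff)
  have pos: "(\<Sum>i<n. (cmod (z i))\<^sup>2) \<noteq> 0"
  proof
    assume "(\<Sum>i<n. (cmod (z i))\<^sup>2) = 0"
    then have "\<forall>i<n. z i = 0" by (simp add: sum_nonneg_eq_0_iff)
    then have "v = 0\<^sub>v n" using v by (intro eq_vecI) (auto simp: z_def)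
    with v show False by simp
  qed
  have "x = q / of_real (\<Sum>i<n. (cmod (z i))\<^sup>2)"
    unfolding q using pos by (simp del: of_real_sum)
  then show ?thesis using \<open>q \<in> \<real>\<close> by (metis Reals_divide Reals_of_real)
qed

text \<open>All complex roots are real, so the factorisation over the complex numbers is the image
  of one over the reals, and the embedding of polynomials is injective.\<close>

lemma symmetric_char_poly_splits:
  fixes S :: "real mat"
  assumes S: "S \<in> carrier_mat n n" "transpose_mat S = S"
  obtains es where "char_poly S = (\<Prod>e\<leftarrow>es. [:- e, 1:])" "length es = n"
proof -
  let ?C = "map_mat complex_of_real S"
  interpret hom: map_poly_inj_idom_hom complex_of_real ..
  obtain as where as: "char_poly ?C = (\<Prod>a\<leftarrow>as. [:- a, 1:])" "length as = n"
    using char_poly_factorized[of ?C n] S by auto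
  have "a \<in> \<real>" if "a \<in> set as" for a
    using symmetric_real_root_char_poly[OF S, of a] that
    by (auto simp: as(1) poly_prod_list prod_list_zero_iff o_def)
  then have real: "as = map (complex_of_real \<circ> Re) as"
    by (intro map_idI[symmetric]) (auto elim: Reals_cases)
  have "map_poly complex_of_real (char_poly S) = char_poly ?C"
    using of_real_hom.char_poly_hom[OF S(1), where ?'a = complex] by simp
  also have "\<dots> = map_poly complex_of_real (\<Prod>e\<leftarrow>map Re as. [:- e, 1:])"
    unfolding as(1) by (subst real) (simp add: hom.hom_prod_list o_def)
  finally have "char_poly S = (\<Prod>e\<leftarrow>map Re as. [:- e, 1:])" by simp
  then show ?thesis using that[of "map Re as"] as(2) by simp
qed

text \<open>The Schur decomposition supplies a similarity by an invertible \<open>P\<close>.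
  Triangularising \<open>P\<close> by an orthogonal \<open>R\<close> turns it into
  \<open>D * T = T * B\<close> with D = R S R' symmetric and \<open>T\<close>, \<open>B\<close>
  upper triangular; thus \<open>D\<close> is triangular, hence diagonal, with the diagonal of
  \<open>B\<close>.\<close>

theorem spectral_theorem_ordered:
  fixes S :: "real mat"
  assumes S: "S \<in> carrier_mat n n" "transpose_mat S = S"
  obtains Q where "Q \<in> orthogonal_group n"
    "transpose_mat Q * S * Q = Matrix.mat n n (\<lambda>(i, j). if i = j then ordered_eigenvalue S (Suc i) else 0)"
    "\<And>i j. i \<le> j \<Longrightarrow> j < n \<Longrightarrow> ordered_eigenvalue S (Suc j) \<le> ordered_eigenvalue S (Suc i)"
proof -
  obtain es0 where es0: "char_poly S = (\<Prod>e\<leftarrow>es0. [:- e, 1:])" "length es0 = n"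
    by (rule symmetric_char_poly_splits[OF S])
  \<comment> \<open>The Schur decomposition puts the eigenvalues on the diagonal in the order of the
    given list, so the list is sorted decreasingly in advance.\<close>
  define es where "es = rev (sort es0)"
  have es: "char_poly S = (\<Prod>e\<leftarrow>es. [:- e, 1:])" "length es = n"
    using es0 by (auto simp: es_def rev_map[symmetric] simp flip: prod_mset_prod_list)
  have "proots (char_poly S) = mset es0"
    unfolding es0 proof (induction es0)
    case (Cons a es)
    have "(\<Prod>e\<leftarrow>es. [:- e, 1:]) \<noteq> (0 :: real poly)" by (auto simp: prod_list_zero_iff)
    then have "proots ([:- a, 1:] * (\<Prod>e\<leftarrow>es. [:- e, 1:])) = proots [:- a, 1:] + proots (\<Prod>e\<leftarrow>es. [:- e, 1:])"
      by (intro proots_mult) auto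
    then show ?case using Cons by (simp only: list.map prod_list.Cons proots_linear_factor) simp
  qed simp
  then have ev: "ordered_eigenvalue S (Suc i) = es ! i" for i
    by (simp add: ordered_eigenvalue_def es_def)
  have sorted: "es ! j \<le> es ! i" if "i \<le> j" "j < n" for i j
    using that es0(2) sorted_rev_nth_mono[of es i j] by (simp add: es_def)
  obtain B P P' where "schur_decomposition S es = (B, P, P')" by (cases "schur_decomposition S es")
  from schur_decomposition[OF S(1) es(1) this]
  have sim: "similar_mat_wit S B P P'" and B_up: "upper_triangular B" and B_diag: "diag_mat B = es" by auto
  from similar_mat_witD2[OF S(1) sim]
  have carr: "B \<in> carrier_mat n n" "P \<in> carrier_mat n n" "P' \<in> carrier_mat n n"
    and PP': "P * P' = 1\<^sub>m n" "P' * P = 1\<^sub>m n" and SB: "S = P * B * P'" by auto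
  obtain R where "R \<in> reflection_products n"
    and T_up: "\<And>i j. i < n \<Longrightarrow> j < i \<Longrightarrow> (R * P) $$ (i, j) = 0" by (rule QR_decomposition[OF carr(2)]) blast
  then have R: "R \<in> orthogonal_group n" using reflection_products_orthogonal by blast
  note RC = orthogonal_groupD[OF R]
  define T where "T = R * P"
  define D where "D = R * S * transpose_mat R"
  have T: "T \<in> carrier_mat n n" and D: "D \<in> carrier_mat n n" using RC carr S by (auto simp: T_def D_def)
  note assoc = assoc_mult_mat[of _ n n _ n _ n]
  have DT: "D * T = T * B"
  proof -
    have "D * T = R * (S * (transpose_mat R * (R * P)))"
      using RC(1) carr S by (simp add: T_def D_def assoc)
    also have "transpose_mat R * (R * P) = P"
      using RC(1,2) carr by (simp flip: assoc)
    also have "S * P = P * B"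
      unfolding SB using carr PP' by (simp add: assoc)
    finally show ?thesis using RC(1) carr by (simp add: T_def assoc)
  qed
  have D_sym: "D $$ (i, j) = D $$ (j, i)" if "i < n" "j < n" for i j
  proof -
    have "transpose_mat D = D"
      using RC(1) S unfolding D_def by (simp add: transpose_mult[of _ n n _ n] assoc)
    then show ?thesis using that D by (metis carrier_matD index_transpose_mat(1))
  qed
  have T_diag: "T $$ (j, j) \<noteq> 0" if "j < n" for j
  proof -
    have "T * (P' * transpose_mat R) = R * (P * P') * transpose_mat R"
      using RC(1) carr by (simp add: T_def assoc)
    also have "\<dots> = 1\<^sub>m n" using RC(1,3) PP' by simp
    finally have "Determinant.det T * Determinant.det (P' * transpose_mat R) = 1"
      using T carr RC(1) by (simp add: det_mult[of T n, symmetric])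
    moreover have "Determinant.det T = (\<Prod>i = 0..<n. T $$ (i, i))"
      using T T_up by (subst det_upper_triangular[of T n]) (auto simp: T_def upper_triangular_def prod_list_diag_prod)
    ultimately have "(\<Prod>i = 0..<n. T $$ (i, i)) \<noteq> 0" by (metis mult_zero_left zero_neq_one)
    then show ?thesis using that by (metis atLeastLessThan_iff finite_atLeastLessThan le0 prod_zero_iff)
  qed
  have DT_index: "(D * T) $$ (i, j) = (\<Sum>c<n. D $$ (i, c) * T $$ (c, j))" if "i < n" "j < n" for i j
    using D T that by (simp add: scalar_prod_def atLeast0LessThan)
  have TB_index: "(T * B) $$ (i, j) = (\<Sum>c<n. T $$ (i, c) * B $$ (c, j))" if "i < n" "j < n" for i j
    using carr T that by (simp add: scalar_prod_def atLeast0LessThan)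
  have T_up': "T $$ (i, j) = 0" if "i < n" "j < i" for i j using T_up that by (simp add: T_def)
  have B_up': "B $$ (i, j) = 0" if "i < n" "j < i" for i j
    using B_up carr that by (auto simp: upper_triangular_def)
  \<comment> \<open>Entry (i, j) of \<open>D * T\<close> reduces to one product, since
    \<open>T\<close> cuts off the columns after j and the induction hypothesis those before
    j.\<close>
  have D_up: "D $$ (i, j) = 0" if "i < n" "j < i" for i j
    using that
  proof (induction j rule: less_induct)
    case (less j)
    have "(D * T) $$ (i, j) = D $$ (i, j) * T $$ (j, j)"
    proof -
      have "D $$ (i, c) * T $$ (c, j) = 0" if "c < n" "c \<noteq> j" for c
        using that less.IH[of c] less.prems T_up'[of c j] by (cases "c < j") auto
      then show ?thesis using less.prems by (subst DT_index) (auto intro: sum_lessThan_single)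
    qed
    moreover have "(T * B) $$ (i, j) = 0"
    proof -
      have "T $$ (i, c) * B $$ (c, j) = 0" if "c < n" for c
        using that less.prems T_up'[of i c] B_up'[of c j] by (cases "c < i") auto
      then show ?thesis using less.prems by (subst TB_index) (auto intro: sum.neutral)
    qed
    ultimately show ?case using DT T_diag[of j] less.prems by simp
  qed
  have D_diag: "D $$ (j, j) = es ! j" if j: "j < n" for j
  proof -
    have "D $$ (j, c) * T $$ (c, j) = 0" if "c < n" "c \<noteq> j" for c
      using that j D_up[of j c] T_up'[of c j] by (cases "c < j") auto
    then have "(D * T) $$ (j, j) = D $$ (j, j) * T $$ (j, j)"
      using j by (subst DT_index) (auto intro: sum_lessThan_single)
    moreover have "T $$ (j, c) * B $$ (c, j) = 0" if "c < n" "c \<noteq> j" for c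
      using that j T_up'[of j c] B_up'[of c j] by (cases "c < j") auto
    then have "(T * B) $$ (j, j) = T $$ (j, j) * B $$ (j, j)"
      using j by (subst TB_index) (auto intro: sum_lessThan_single)
    moreover have "B $$ (j, j) = es ! j" using j carr unfolding B_diag[symmetric] diag_mat_def by simp
    ultimately show ?thesis using DT T_diag[OF j] by simp
  qed
  have "D = Matrix.mat n n (\<lambda>(i, j). if i = j then ordered_eigenvalue S (Suc i) else 0)"
  proof (rule eq_matI)
    fix i j assume "i < dim_row (Matrix.mat n n (\<lambda>(i, j). if i = j then ordered_eigenvalue S (Suc i) else 0))"
      "j < dim_col (Matrix.mat n n (\<lambda>(i, j). if i = j then ordered_eigenvalue S (Suc i) else 0))"
    then show "D $$ (i, j) = Matrix.mat n n (\<lambda>(i, j). if i = j then ordered_eigenvalue S (Suc i) else 0) $$ (i, j)"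
      using D_diag D_up[of i j] D_up[of j i] D_sym[of i j] ev by (cases i j rule: linorder_cases) auto
  qed (use D in auto)
  then show ?thesis
    using orthogonal_group_transpose[OF R] sorted
    by (intro that[of "transpose_mat R"]) (auto simp: D_def ev)
qed

section \<open>Gaussian measures and reflections\<close>

abbreviation leb :: "'i set \<Rightarrow> ('i \<Rightarrow> real) measure" where
  "leb I \<equiv> \<Pi>\<^sub>M i\<in>I. lborel"

definition gaussian :: "'i set \<Rightarrow> ('i \<Rightarrow> real) measure" where
  "gaussian I = (\<Pi>\<^sub>M i\<in>I. std_normal_distribution)"

interpretation lborel_product: product_sigma_finite "\<lambda>_::'i. lborel :: real measure"
  by (standard) 

text \<open>Integrating coordinate c first, the map acts on the line by a factor e with |e| = 1 and
  a translation, which preserves Lebesgue measure. The translation may depend on the remaining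
  coordinates only.\<close>

lemma nn_integral_leb_coordinate:
  fixes f :: "('i \<Rightarrow> real) \<Rightarrow> ennreal"
  assumes I: "finite I" "c \<in> I" and f: "f \<in> borel_measurable (leb I)"
    and \<phi>: "\<phi> \<in> borel_measurable (leb I)" "\<And>x y. \<phi> (x(c := y)) = \<phi> x" and e: "\<bar>e\<bar> = 1"
  shows "(\<integral>\<^sup>+x. f (x(c := e * x c + \<phi> x)) \<partial>leb I) = (\<integral>\<^sup>+x. f x \<partial>leb I)"
proof -
  define J where "J = I - {c}"
  have J: "I = insert c J" "finite J" "c \<notin> J" using I by (auto simp: J_def)
  have upd: "(\<lambda>x. x(c := e * x c + \<phi> x)) \<in> measurable (leb I) (leb I)"
  proof (rule measurable_fun_upd[where J=I])
    have [measurable]: "(\<lambda>x. x c) \<in> borel_measurable (leb I)"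
      using measurable_component_singleton[OF I(2), of "\<lambda>_. lborel"] by simp
    note \<phi>(1)[measurable]
    show "(\<lambda>x. e * x c + \<phi> x) \<in> measurable (leb I) lborel" by simp measurable
  qed (use I in auto)
  have "(\<integral>\<^sup>+x. f (x(c := e * x c + \<phi> x)) \<partial>leb I) =
      (\<integral>\<^sup>+x. (\<integral>\<^sup>+y. f (x(c := e * y + \<phi> x)) \<partial>lborel) \<partial>leb J)"
    using measurable_compose[OF upd f] J(2,3) unfolding J(1)
    by (subst lborel_product.product_nn_integral_insert) (auto simp: \<phi>(2))
  also have "\<dots> = (\<integral>\<^sup>+x. (\<integral>\<^sup>+y. f (x(c := y)) \<partial>lborel) \<partial>leb J)"
  proof (rule nn_integral_cong)
    fix x assume x: "x \<in> space (leb J)"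
    have "(\<lambda>y. f (x(c := y))) \<in> borel_measurable lborel"
      using measurable_compose[OF measurable_component_update[OF x J(3)] f[unfolded J(1)]] .
    then show "(\<integral>\<^sup>+y. f (x(c := e * y + \<phi> x)) \<partial>lborel) = (\<integral>\<^sup>+y. f (x(c := y)) \<partial>lborel)"
      using e nn_integral_real_affine[of "\<lambda>y. f (x(c := y))" e "\<phi> x"] by (auto simp: add.commute)
  qed
  also have "\<dots> = (\<integral>\<^sup>+x. f x \<partial>leb I)"
    using f J(2,3) unfolding J(1) by (subst lborel_product.product_nn_integral_insert) auto
  finally show ?thesis .
qed

lemma measurable_leb_component [measurable (raw)]:
  assumes "i \<in> I" shows "(\<lambda>x. x i) \<in> borel_measurable (leb I)"
  using measurable_component_singleton[OF assms, of "\<lambda>_. lborel"] by simp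

lemma measurable_leb_I:
  assumes "\<And>i. i \<in> I \<Longrightarrow> (\<lambda>x. h x i) \<in> borel_measurable N"
    and "\<And>x i. x \<in> space N \<Longrightarrow> i \<notin> I \<Longrightarrow> h x i = undefined"
  shows "h \<in> measurable N (leb I)"
proof (rule measurable_PiM_single')
  show "h \<in> space N \<rightarrow> (\<Pi>\<^sub>E i\<in>I. space lborel)" using assms(2) by (auto simp: PiE_iff extensional_def)
qed (use assms in auto)

text \<open>The shear is a composition of coordinate maps, one for each index in \<open>A\<close>;
  coordinate c never changes, so they do not interfere.\<close>

lemma nn_integral_leb_shear:
  fixes f :: "('i \<Rightarrow> real) \<Rightarrow> ennreal"
  assumes I: "finite I" "c \<in> I" "c \<notin> A" "A \<subseteq> I" and f: "f \<in> borel_measurable (leb I)"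
  shows "(\<integral>\<^sup>+x. f (\<lambda>i. if i \<in> A then x i + t i * x c else x i) \<partial>leb I) = (\<integral>\<^sup>+x. f x \<partial>leb I)"
proof -
  have "finite A" using I(1,4) by (rule finite_subset[rotated])
  then show ?thesis using I(3,4)
  proof (induction A)
    case (insert a A)
    let ?S = "\<lambda>x i. if i \<in> A then x i + t i * x c else x i"
    have "?S \<in> measurable (leb I) (leb I)"
    proof (rule measurable_leb_I)
      show "(\<lambda>x. ?S x i) \<in> borel_measurable (leb I)" if "i \<in> I" for i
        using that I(2) by (cases "i \<in> A") auto
      show "?S x i = undefined" if "x \<in> space (leb I)" "i \<notin> I" for x i
        using that insert.prems by (auto simp: space_PiM PiE_iff extensional_def)
    qed
    from measurable_compose[OF this f] have fS: "(\<lambda>x. f (?S x)) \<in> borel_measurable (leb I)" .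
    have "(\<integral>\<^sup>+x. f (\<lambda>i. if i \<in> insert a A then x i + t i * x c else x i) \<partial>leb I) =
        (\<integral>\<^sup>+x. f (?S (x(a := 1 * x a + t a * x c))) \<partial>leb I)"
      using insert by (intro nn_integral_cong arg_cong[of _ _ f]) auto
    also have "\<dots> = (\<integral>\<^sup>+x. f (?S x) \<partial>leb I)"
      using insert.prems I fS by (intro nn_integral_leb_coordinate) auto
    also have "\<dots> = (\<integral>\<^sup>+x. f x \<partial>leb I)" using insert by simp
    finally show ?case .
  qed simp
qed

text \<open>The Householder reflection over an arbitrary index set. A single column of a matrix is
  reflected by taking \<open>w\<close> supported on that column. The restriction to \<open>I\<close>
  keeps the values in the product space.\<close>

definition reflect :: "'i set \<Rightarrow> ('i \<Rightarrow> real) \<Rightarrow> ('i \<Rightarrow> real) \<Rightarrow> 'i \<Rightarrow> real" where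
  "reflect I w x = (\<lambda>i\<in>I. x i - 2 * w i * (\<Sum>c\<in>I. w c * x c) / (\<Sum>c\<in>I. (w c)\<^sup>2))"

lemma measurable_reflect: "reflect I w \<in> measurable (leb I) (leb I)"
  by (rule measurable_leb_I) (auto simp: reflect_def)

text \<open>With \<open>S\<close> the shear sending the \<open>c\<close>-th unit vector to \<open>w / w c\<close>, the reflection is
  \<open>S B S\<^sup>-\<^sup>1\<close> where \<open>B\<close> changes the \<open>c\<close>-th coordinate only.\<close>

lemma nn_integral_leb_reflect:
  fixes f :: "('i \<Rightarrow> real) \<Rightarrow> ennreal"
  assumes I: "finite I" and f: "f \<in> borel_measurable (leb I)"
  shows "(\<integral>\<^sup>+x. f (reflect I w x) \<partial>leb I) = (\<integral>\<^sup>+x. f x \<partial>leb I)"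
proof (cases "\<exists>c\<in>I. w c \<noteq> 0")
  case False
  then have "reflect I w x = x" if "x \<in> space (leb I)" for x
    using that by (auto simp: reflect_def space_PiM PiE_iff extensional_def fun_eq_iff)
  then show ?thesis by (simp cong: nn_integral_cong)
next
  case True
  \<comment> \<open>The pivot c has \<open>w c\<close> nonzero because the shear divides by
    it.\<close>
  then obtain c where c: "c \<in> I" "w c \<noteq> 0" by blast
  define s where "s = (\<Sum>i\<in>I. (w i)\<^sup>2)"
  have "s > 0" unfolding s_def using I c by (intro sum_pos2[of _ c]) auto
  define A where "A = I - {c}"
  define S where "S t = (\<lambda>x i. if i \<in> A then x i + t i * x c else x i)" for t :: "'i \<Rightarrow> real" and x :: "'i \<Rightarrow> real"
  define t where "t i = w i / w c" for i
  \<comment> \<open>In sheared coordinates the c-th unit vector changes sign and every other unit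
    vector moves in direction c only; \<phi> collects the resulting coefficients.\<close>
  define \<phi> where "\<phi> x = - (2 * (w c / s) * (\<Sum>i\<in>A. w i * x i))" for x
  define B where "B x = x(c := -1 * x c + \<phi> x)" for x
  have sA: "s = (w c)\<^sup>2 + (\<Sum>i\<in>A. (w i)\<^sup>2)"
    unfolding s_def A_def using I c by (subst sum.remove[of _ c]) auto
  have dec: "reflect I w x = S t (B (S (\<lambda>i. - t i) x))" if x: "x \<in> space (leb I)" for x
  proof -
    have wx: "(\<Sum>i\<in>I. w i * x i) = w c * x c + (\<Sum>i\<in>A. w i * x i)"
      unfolding A_def using I c by (subst sum.remove[of _ c]) auto
    have "(\<Sum>i\<in>A. w i * S (\<lambda>i. - t i) x i) = (\<Sum>i\<in>A. w i * x i - (w i)\<^sup>2 * (x c / w c))"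
      by (intro sum.cong refl) (auto simp: S_def t_def power2_eq_square algebra_simps)
    also have "\<dots> = (\<Sum>i\<in>A. w i * x i) - (s - (w c)\<^sup>2) * (x c / w c)"
      unfolding sA sum_subtractf sum_distrib_right[symmetric] by simp
    finally have sum: "(\<Sum>i\<in>A. w i * S (\<lambda>i. - t i) x i) = (\<Sum>i\<in>A. w i * x i) - (s - (w c)\<^sup>2) * (x c / w c)" .
    have Bc: "B (S (\<lambda>i. - t i) x) c = x c - 2 * w c * (\<Sum>i\<in>I. w i * x i) / s"
      unfolding B_def \<phi>_def sum wx using c \<open>s > 0\<close>
      by (simp add: S_def A_def field_simps power2_eq_square)
    have "reflect I w x i = S t (B (S (\<lambda>i. - t i) x)) i" for i
    proof (cases "i \<in> A")
      case True
      then have "S t (B (S (\<lambda>i. - t i) x)) i = x i - t i * x c + t i * B (S (\<lambda>i. - t i) x) c"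
        unfolding S_def[of t] by (simp add: B_def S_def A_def)
      also have "\<dots> = reflect I w x i"
      proof -
        have "t i * w c = w i" using c by (simp add: t_def)
        then have "t i * (2 * w c * q / s) = 2 * w i * q / s" for q
          by (metis (no_types, opaque_lifting) mult.commute mult.left_commute times_divide_eq_right)
        then show ?thesis
          unfolding Bc using True by (simp add: reflect_def A_def s_def[symmetric] right_diff_distrib)
      qed
      finally show ?thesis by simp
    next
      case False
      then have S: "S t (B (S (\<lambda>i. - t i) x)) i = B (S (\<lambda>i. - t i) x) i" by (simp add: S_def[of t])
      show ?thesis
      proof (cases "i = c")
        case True
        then show ?thesis unfolding S using Bc c by (simp add: reflect_def s_def)
      next
        case ic: False
        with False have "i \<notin> I" by (simp add: A_def)
        then show ?thesis unfolding S using False ic x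
          by (simp add: reflect_def B_def S_def space_PiM PiE_iff extensional_def)
      qed
    qed
    then show ?thesis by blast
  qed
  have S_meas: "S t \<in> measurable (leb I) (leb I)" for t
  proof (rule measurable_leb_I)
    show "(\<lambda>x. S t x i) \<in> borel_measurable (leb I)" if "i \<in> I" for i
      using that c by (cases "i \<in> A") (auto simp: S_def)
  qed (auto simp: S_def A_def space_PiM PiE_iff extensional_def)
  have \<phi>_meas: "\<phi> \<in> borel_measurable (leb I)"
    unfolding \<phi>_def by (auto simp: A_def)
  have B_meas: "B \<in> measurable (leb I) (leb I)"
  proof (rule measurable_leb_I)
    show "(\<lambda>x. B x i) \<in> borel_measurable (leb I)" if "i \<in> I" for i
      using that c \<phi>_meas by (cases "i = c") (auto simp: B_def)
  qed (use c in \<open>auto simp: B_def space_PiM PiE_iff extensional_def\<close>)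
  have f1: "(\<lambda>x. f (S t x)) \<in> borel_measurable (leb I)" by (rule measurable_compose[OF S_meas f])
  have f2: "(\<lambda>x. f (S t (B x))) \<in> borel_measurable (leb I)" by (rule measurable_compose[OF B_meas f1])
  have "(\<integral>\<^sup>+x. f (reflect I w x) \<partial>leb I) = (\<integral>\<^sup>+x. f (S t (B (S (\<lambda>i. - t i) x))) \<partial>leb I)"
    by (intro nn_integral_cong) (simp add: dec)
  also have "\<dots> = (\<integral>\<^sup>+x. f (S t (B x)) \<partial>leb I)"
    unfolding S_def[of "\<lambda>i. - t i"]
    by (rule nn_integral_leb_shear[where f="\<lambda>x. f (S t (B x))"]) (use I c f2 in \<open>auto simp: A_def\<close>)
  also have "\<dots> = (\<integral>\<^sup>+x. f (S t x) \<partial>leb I)"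
    unfolding B_def using I c f1 \<phi>_meas
    by (intro nn_integral_leb_coordinate[where f="\<lambda>x. f (S t x)"]) (auto simp: \<phi>_def A_def intro!: sum.cong)
  also have "\<dots> = (\<integral>\<^sup>+x. f x \<partial>leb I)"
    unfolding S_def by (rule nn_integral_leb_shear) (use I c f in \<open>auto simp: A_def\<close>)
  finally show ?thesis .
qed

section \<open>The standard Gaussian product measure\<close>

interpretation std_normal: prob_space std_normal_distribution
  by (rule prob_space_normal_density) simp

interpretation normal_product: product_sigma_finite "\<lambda>_::'i. std_normal_distribution"
  by standard

lemma sets_gaussian [measurable_cong]: "sets (gaussian I) = sets (\<Pi>\<^sub>M i\<in>I. borel)"
  by (auto simp: gaussian_def intro!: sets_PiM_cong)

lemma sets_leb: "sets (leb I) = sets (\<Pi>\<^sub>M i\<in>I. borel)"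
  by (intro sets_PiM_cong) auto

lemma measurable_gaussian_eq: "measurable (gaussian I) N = measurable (leb I) N"
  by (rule measurable_cong_sets) (simp_all only: sets_gaussian sets_leb)

lemma space_gaussian: "space (gaussian I) = (\<Pi>\<^sub>E i\<in>I. UNIV)"
  by (simp add: gaussian_def space_PiM)

lemma prob_space_gaussian: "prob_space (gaussian I)"
  unfolding gaussian_def by (rule prob_space_PiM) (rule std_normal.prob_space_axioms)

lemma gaussian_eq_density:
  assumes I: "finite I"
  shows "gaussian I = density (leb I) (\<lambda>x. \<Prod>i\<in>I. ennreal (std_normal_density (x i)))"
  unfolding gaussian_def
proof (rule normal_product.PiM_eqI[OF I, symmetric])
  show "sets (density (leb I) (\<lambda>x. \<Prod>i\<in>I. ennreal (std_normal_density (x i)))) = sets (\<Pi>\<^sub>M i\<in>I. std_normal_distribution)"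
    by (auto intro!: sets_PiM_cong)
  fix A :: "'a \<Rightarrow> real set" assume "\<And>i. i \<in> I \<Longrightarrow> A i \<in> sets std_normal_distribution"
  then have A: "A i \<in> sets borel" if "i \<in> I" for i using that by simp
  have "emeasure (density (leb I) (\<lambda>x. \<Prod>i\<in>I. ennreal (std_normal_density (x i)))) (Pi\<^sub>E I A) =
      (\<integral>\<^sup>+x. (\<Prod>i\<in>I. ennreal (std_normal_density (x i))) * indicator (Pi\<^sub>E I A) x \<partial>leb I)"
    using A I by (intro emeasure_density) (auto intro!: sets_PiM_I_finite)
  also have "\<dots> = (\<integral>\<^sup>+x. (\<Prod>i\<in>I. ennreal (std_normal_density (x i)) * indicator (A i) (x i)) \<partial>leb I)"
  proof (rule nn_integral_cong)
    fix x assume "x \<in> space (leb I)"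
    then have "indicator (Pi\<^sub>E I A) x = (\<Prod>i\<in>I. indicator (A i) (x i) :: ennreal)"
      using I by (auto simp: indicator_def space_PiM PiE_iff)
    then show "(\<Prod>i\<in>I. ennreal (std_normal_density (x i))) * indicator (Pi\<^sub>E I A) x =
        (\<Prod>i\<in>I. ennreal (std_normal_density (x i)) * indicator (A i) (x i))"
      by (simp add: prod.distrib)
  qed
  also have "\<dots> = (\<Prod>i\<in>I. \<integral>\<^sup>+x. ennreal (std_normal_density x) * indicator (A i) x \<partial>lborel)"
  proof (rule lborel_product.product_nn_integral_prod[OF I])
    fix i assume "i \<in> I"
    from A[OF this] have [measurable]: "A i \<in> sets borel" .
    show "(\<lambda>x. ennreal (std_normal_density x) * indicator (A i) x) \<in> borel_measurable lborel"
      by measurable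
  qed
  also have "\<dots> = (\<Prod>i\<in>I. emeasure std_normal_distribution (A i))"
  proof (rule prod.cong[OF refl])
    fix i assume "i \<in> I"
    from A[OF this] show "(\<integral>\<^sup>+x. ennreal (std_normal_density x) * indicator (A i) x \<partial>lborel) =
        emeasure std_normal_distribution (A i)"
      by (intro emeasure_density[symmetric]) auto
  qed
  finally show "emeasure (density (leb I) (\<lambda>x. \<Prod>i\<in>I. ennreal (std_normal_density (x i)))) (Pi\<^sub>E I A) =
      (\<Prod>i\<in>I. emeasure std_normal_distribution (A i))" .
qed

lemma sum_squares_reflect:
  assumes "finite I"
  shows "(\<Sum>i\<in>I. (reflect I w x i)\<^sup>2) = (\<Sum>i\<in>I. (x i)\<^sup>2)"
proof -
  define s where "s = (\<Sum>c\<in>I. (w c)\<^sup>2)"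
  define q where "q = (\<Sum>c\<in>I. w c * x c)"
  have "(\<Sum>i\<in>I. (reflect I w x i)\<^sup>2) = (\<Sum>i\<in>I. (x i)\<^sup>2 - w i * x i * (4 * q / s) + (w i)\<^sup>2 * (4 * q\<^sup>2 / s\<^sup>2))"
    by (intro sum.cong refl)
       (simp add: reflect_def s_def[symmetric] q_def[symmetric] power2_diff power_mult_distrib power_divide algebra_simps)
  also have "\<dots> = (\<Sum>i\<in>I. (x i)\<^sup>2) - q * (4 * q / s) + s * (4 * q\<^sup>2 / s\<^sup>2)"
    unfolding sum.distrib sum_subtractf sum_distrib_right[symmetric] q_def s_def by simp
  also have "q * (4 * q / s) = s * (4 * q\<^sup>2 / s\<^sup>2)"
    by (cases "s = 0") (auto simp: power2_eq_square)
  finally show ?thesis by simp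
qed

text \<open>The Gaussian density depends on \<open>x\<close> only through the sum of squares, which
  reflections preserve; the rest is invariance of Lebesgue measure.\<close>

lemma nn_integral_gaussian_reflect:
  fixes f :: "('i \<Rightarrow> real) \<Rightarrow> ennreal"
  assumes I: "finite I" and f: "f \<in> borel_measurable (gaussian I)"
  shows "(\<integral>\<^sup>+x. f (reflect I w x) \<partial>gaussian I) = (\<integral>\<^sup>+x. f x \<partial>gaussian I)"
proof -
  define p where "p x = (\<Prod>i\<in>I. ennreal (std_normal_density (x i)))" for x :: "'i \<Rightarrow> real"
  have p: "p x = ennreal ((1 / sqrt (2 * pi)) ^ card I * exp (- (\<Sum>i\<in>I. (x i)\<^sup>2) / 2))" for x
  proof -
    have "p x = ennreal (\<Prod>i\<in>I. std_normal_density (x i))"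
      unfolding p_def by (rule prod_ennreal) simp
    also have "(\<Prod>i\<in>I. std_normal_density (x i)) = (\<Prod>i\<in>I. 1 / sqrt (2 * pi)) * (\<Prod>i\<in>I. exp (- (x i)\<^sup>2 / 2))"
      unfolding prod.distrib[symmetric] by (intro prod.cong refl) (simp add: normal_density_def)
    also have "(\<Prod>i\<in>I. exp (- (x i)\<^sup>2 / 2)) = exp (\<Sum>i\<in>I. - (x i)\<^sup>2 / 2)"
      using I by (rule exp_sum[symmetric])
    also have "(\<Sum>i\<in>I. - (x i)\<^sup>2 / 2) = - (\<Sum>i\<in>I. (x i)\<^sup>2) / 2"
      by (simp only: sum_divide_distrib[symmetric] sum_negf)
    finally show ?thesis by (simp only: prod_constant)
  qed
  have density: "gaussian I = density (leb I) p"
    unfolding gaussian_eq_density[OF I] using p_def by presburger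
  have p_reflect: "p (reflect I w x) = p x" for x
    unfolding p sum_squares_reflect[OF I] ..
  have p_meas: "p \<in> borel_measurable (leb I)" unfolding p_def
  proof (rule borel_measurable_prod_ennreal)
    fix i assume "i \<in> I"
    then show "(\<lambda>x. ennreal (std_normal_density (x i))) \<in> borel_measurable (leb I)"
      by (intro measurable_compose[OF measurable_leb_component, of i I "\<lambda>y. ennreal (std_normal_density y)"]) auto
  qed
  have f': "f \<in> borel_measurable (leb I)"
    using f unfolding measurable_gaussian_eq .
  have fr: "(\<lambda>x. f (reflect I w x)) \<in> borel_measurable (leb I)"
    by (rule measurable_compose[OF measurable_reflect f'])
  have pf: "(\<lambda>x. p x * f x) \<in> borel_measurable (leb I)"
    using p_meas f' by (rule borel_measurable_times_ennreal)
  have "(\<integral>\<^sup>+x. f (reflect I w x) \<partial>gaussian I) = (\<integral>\<^sup>+x. p (reflect I w x) * f (reflect I w x) \<partial>leb I)"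
    unfolding density nn_integral_density[OF p_meas fr] p_reflect ..
  also have "\<dots> = (\<integral>\<^sup>+x. p x * f x \<partial>leb I)"
    by (rule nn_integral_leb_reflect[OF I pf])
  also have "\<dots> = (\<integral>\<^sup>+x. f x \<partial>gaussian I)"
    unfolding density nn_integral_density[OF p_meas f'] ..
  finally show ?thesis .
qed

lemma measurable_gaussian_component [measurable (raw)]:
  assumes "i \<in> I" shows "(\<lambda>x. x i) \<in> borel_measurable (gaussian I)"
  unfolding measurable_gaussian_eq by (rule measurable_leb_component[OF assms])

lemma measurable_gaussian_I:
  assumes "\<And>i. i \<in> I \<Longrightarrow> (\<lambda>x. h x i) \<in> borel_measurable N"
    and "\<And>x i. x \<in> space N \<Longrightarrow> i \<notin> I \<Longrightarrow> h x i = undefined"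
  shows "h \<in> measurable N (gaussian I)"
proof -
  have "measurable N (gaussian I) = measurable N (leb I)"
    by (rule measurable_cong_sets) (simp_all only: sets_gaussian sets_leb)
  then show ?thesis using measurable_leb_I[OF assms] by simp
qed

lemma nn_integral_gaussian_insert:
  assumes "finite J" "c \<notin> J" "f \<in> borel_measurable (gaussian (insert c J))"
  shows "(\<integral>\<^sup>+x. f x \<partial>gaussian (insert c J)) =
    (\<integral>\<^sup>+x. (\<integral>\<^sup>+y. f (x(c := y)) \<partial>std_normal_distribution) \<partial>gaussian J)"
  using normal_product.product_nn_integral_insert[OF assms(1,2)] assms(3)
  unfolding gaussian_def .

lemma nn_integral_gaussian_fold:
  assumes "I \<inter> J = {}" "finite I" "finite J" "f \<in> borel_measurable (gaussian (I \<union> J))"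
  shows "(\<integral>\<^sup>+x. f x \<partial>gaussian (I \<union> J)) = (\<integral>\<^sup>+x. (\<integral>\<^sup>+y. f (merge I J (x, y)) \<partial>gaussian J) \<partial>gaussian I)"
  using normal_product.product_nn_integral_fold[OF assms(1,2,3)] assms(4)
  unfolding gaussian_def .

text \<open>Coordinates are independent, so any injective choice of them is again standard Gaussian.
  This is how a Gaussian matrix is cut down to a block.\<close>

lemma nn_integral_gaussian_reindex:
  assumes t: "inj_on t I" "t \<in> I \<rightarrow> K" and f: "f \<in> borel_measurable (gaussian I)"
  shows "(\<integral>\<^sup>+x. f (\<lambda>i\<in>I. x (t i)) \<partial>gaussian K) = (\<integral>\<^sup>+x. f x \<partial>gaussian I)"
proof -
  have m: "(\<lambda>x. \<lambda>i\<in>I. x (t i)) \<in> measurable (gaussian K) (gaussian I)"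
    using t(2) by (intro measurable_gaussian_I) (auto intro!: measurable_gaussian_component)
  have "distr (gaussian K) (gaussian I) (\<lambda>x. \<lambda>i\<in>I. x (t i)) = gaussian I"
    unfolding gaussian_def using t std_normal.prob_space_axioms by (intro distr_PiM_reindex) auto
  then show ?thesis using nn_integral_distr[OF m, of f] f by simp
qed

lemma nn_integral_gaussian_const: "(\<integral>\<^sup>+x. c \<partial>gaussian I) = c"
  using prob_space.emeasure_space_1[OF prob_space_gaussian[of I]] by simp

text \<open>Only the columns in \<open>J\<close> are stored and multiplied. Taking for
  \<open>J\<close> the columns after the first allows them to be rotated while the first one is held
  fixed.\<close>

definition left_mult :: "nat \<Rightarrow> nat set \<Rightarrow> real mat \<Rightarrow> (nat \<times> nat \<Rightarrow> real) \<Rightarrow> nat \<times> nat \<Rightarrow> real" where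
  "left_mult n J Q g = (\<lambda>ij\<in>{..<n} \<times> J. \<Sum>c<n. Q $$ (fst ij, c) * g (c, snd ij))"

lemma measurable_left_mult: "left_mult n J Q \<in> measurable (gaussian ({..<n} \<times> J)) (gaussian ({..<n} \<times> J))"
  by (rule measurable_gaussian_I) (auto simp: left_mult_def intro!: borel_measurable_sum)

lemma householder_sum:
  assumes "i < n"
  shows "(\<Sum>c<n. householder n w $$ (i, c) * v c) = v i - 2 * w i * (\<Sum>c<n. w c * v c) / (\<Sum>c<n. (w c)\<^sup>2)"
  using householder_mult[of "Matrix.mat n 1 (\<lambda>(c, _). v c)" n 1 i 0 w] assms
  by (simp add: scalar_prod_def atLeast0LessThan householder_def)

text \<open>The columns are reflected one after another; reflecting column b is a reflection of the
  whole array, by the vector \<open>W\<close> that equals \<open>w\<close> on column b and 0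
  elsewhere.\<close>

lemma nn_integral_gaussian_householder:
  fixes f :: "(nat \<times> nat \<Rightarrow> real) \<Rightarrow> ennreal"
  assumes J: "finite J" and f: "f \<in> borel_measurable (gaussian ({..<n} \<times> J))"
  shows "(\<integral>\<^sup>+g. f (left_mult n J (householder n w) g) \<partial>gaussian ({..<n} \<times> J)) = (\<integral>\<^sup>+g. f g \<partial>gaussian ({..<n} \<times> J))"
proof -
  let ?I = "{..<n} \<times> J"
  define h where "h A g = (\<lambda>ij\<in>?I. if snd ij \<in> A then \<Sum>c<n. householder n w $$ (fst ij, c) * g (c, snd ij) else g ij)"
    for A g
  have h_meas: "h A \<in> measurable (gaussian ?I) (gaussian ?I)" for A
  proof (rule measurable_gaussian_I)
    show "(\<lambda>x. h A x ij) \<in> borel_measurable (gaussian ?I)" if "ij \<in> ?I" for ij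
      using that by (cases "snd ij \<in> A") (auto simp: h_def intro!: borel_measurable_sum)
  qed (auto simp: h_def)
  have "(\<integral>\<^sup>+g. f (h A g) \<partial>gaussian ?I) = (\<integral>\<^sup>+g. f g \<partial>gaussian ?I)" if "A \<subseteq> J" for A
    using finite_subset[OF that J] that
  proof (induction A)
    case empty
    have "h {} g = g" if "g \<in> space (gaussian ?I)" for g
      using that by (auto simp: h_def space_gaussian PiE_iff extensional_def fun_eq_iff)
    then show ?case by (simp cong: nn_integral_cong)
  next
    case (insert b A)
    define W :: "nat \<times> nat \<Rightarrow> real" where "W ij = (if snd ij = b then w (fst ij) else 0)" for ij
    have b: "b \<in> J" using insert.prems by simp
    have sum: "(\<Sum>ij\<in>?I. if snd ij = b then F (fst ij) else 0) = (\<Sum>c<n. F c)" for F :: "nat \<Rightarrow> real"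
    proof -
      have "(\<Sum>ij\<in>?I. if snd ij = b then F (fst ij) else 0) = (\<Sum>c<n. \<Sum>j\<in>J. if j = b then F c else 0)"
        by (simp add: sum.cartesian_product case_prod_beta')
      then show ?thesis using b J by simp
    qed
    have WW: "(\<Sum>ij\<in>?I. (W ij)\<^sup>2) = (\<Sum>c<n. (w c)\<^sup>2)"
      by (subst sum[symmetric]) (auto intro!: sum.cong simp: W_def)
    have Wg: "(\<Sum>ij\<in>?I. W ij * g ij) = (\<Sum>c<n. w c * g (c, b))" for g :: "nat \<times> nat \<Rightarrow> real"
      by (subst sum[symmetric]) (auto intro!: sum.cong simp: W_def)
    have "h (insert b A) g = h A (reflect ?I W g)" for g
    proof
      fix ij
      show "h (insert b A) g ij = h A (reflect ?I W g) ij"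
      proof (cases "ij \<in> ?I")
        case True
        then obtain i j where ij: "ij = (i, j)" "i < n" "j \<in> J" by auto
        have refl: "reflect ?I W g (c, j) = (if j = b then \<Sum>e<n. householder n w $$ (c, e) * g (e, b) else g (c, j))" if "c < n" for c
          using that ij householder_sum[OF that] unfolding reflect_def WW Wg by (simp add: W_def)
        show ?thesis
          using ij refl insert.hyps(2) by (simp add: h_def)
      next
        case False
        then show ?thesis unfolding h_def by (simp only: restrict_apply if_False)
      qed
    qed
    then have "(\<integral>\<^sup>+g. f (h (insert b A) g) \<partial>gaussian ?I) = (\<integral>\<^sup>+g. f (h A (reflect ?I W g)) \<partial>gaussian ?I)" by simp
    also have "\<dots> = (\<integral>\<^sup>+g. f (h A g) \<partial>gaussian ?I)"
      using J by (intro nn_integral_gaussian_reflect measurable_compose[OF h_meas f]) auto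
    finally show ?case using insert by simp
  qed
  note this[OF order.refl]
  moreover have "h J g = left_mult n J (householder n w) g" for g
    by (auto simp: h_def left_mult_def fun_eq_iff)
  ultimately show ?thesis by simp
qed

lemma nn_integral_gaussian_left_mult:
  fixes f :: "(nat \<times> nat \<Rightarrow> real) \<Rightarrow> ennreal"
  assumes J: "finite J" and f: "f \<in> borel_measurable (gaussian ({..<n} \<times> J))" and Q: "Q \<in> orthogonal_group n"
  shows "(\<integral>\<^sup>+g. f (left_mult n J Q g) \<partial>gaussian ({..<n} \<times> J)) = (\<integral>\<^sup>+g. f g \<partial>gaussian ({..<n} \<times> J))"
  using Q[unfolded orthogonal_group_eq_reflection_products] f
proof (induction arbitrary: f)
  case one
  have "left_mult n J (1\<^sub>m n) g = g" if "g \<in> space (gaussian ({..<n} \<times> J))" for g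
  proof
    fix ij
    have "(\<Sum>c<n. 1\<^sub>m n $$ (i, c) * g (c, j)) = g (i, j)" if "i < n" for i j
      using that by (subst sum_lessThan_single[of n i]) auto
    then show "left_mult n J (1\<^sub>m n) g ij = g ij"
      using that by (cases ij) (auto simp: left_mult_def space_gaussian PiE_iff extensional_def)
  qed
  then show ?case by (simp cong: nn_integral_cong)
next
  case (reflect Q w)
  have Q: "Q \<in> carrier_mat n n" using reflect.hyps reflection_products_orthogonal orthogonal_groupD(1) by blast
  have "left_mult n J (householder n w * Q) g = left_mult n J (householder n w) (left_mult n J Q g)" for g
  proof
    fix ij
    show "left_mult n J (householder n w * Q) g ij = left_mult n J (householder n w) (left_mult n J Q g) ij"
    proof (cases "ij \<in> {..<n} \<times> J")
      case True
      then obtain i j where ij: "ij = (i, j)" "i < n" "j \<in> J" by auto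
      have "(\<Sum>c<n. (householder n w * Q) $$ (i, c) * g (c, j)) =
          (\<Sum>c<n. \<Sum>e<n. householder n w $$ (i, e) * Q $$ (e, c) * g (c, j))"
        using Q ij by (intro sum.cong refl) (simp add: scalar_prod_def atLeast0LessThan sum_distrib_right)
      also have "\<dots> = (\<Sum>e<n. \<Sum>c<n. householder n w $$ (i, e) * Q $$ (e, c) * g (c, j))" by (rule sum.swap)
      finally show ?thesis using ij by (simp add: left_mult_def sum_distrib_left mult.assoc)
    next
      case False
      then show ?thesis unfolding left_mult_def by (simp only: restrict_apply if_False)
    qed
  qed
  then have "(\<integral>\<^sup>+g. f (left_mult n J (householder n w * Q) g) \<partial>gaussian ({..<n} \<times> J)) =
      (\<integral>\<^sup>+g. f (left_mult n J (householder n w) (left_mult n J Q g)) \<partial>gaussian ({..<n} \<times> J))" by simp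
  also have "\<dots> = (\<integral>\<^sup>+g. f (left_mult n J (householder n w) g) \<partial>gaussian ({..<n} \<times> J))"
    by (rule reflect.IH[OF measurable_compose[OF measurable_left_mult reflect.prems]])
  also have "\<dots> = (\<integral>\<^sup>+g. f g \<partial>gaussian ({..<n} \<times> J))"
    by (rule nn_integral_gaussian_householder[OF J reflect.prems])
  finally show ?case .
qed

section \<open>Moments of normal variables and of squared norms\<close>

lemma nn_integral_normal_even_moment:
  "(\<integral>\<^sup>+x. ennreal (x ^ (2 * k)) \<partial>std_normal_distribution) = ennreal (2 ^ k * pochhammer (1/2) k)"
proof -
  have "(\<integral>\<^sup>+x. ennreal (x ^ (2 * k)) \<partial>std_normal_distribution) =
      (\<integral>\<^sup>+x. ennreal (std_normal_density x * x ^ (2 * k)) \<partial>lborel)"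
    by (subst nn_integral_density) (auto simp: ennreal_mult')
  also have "\<dots> = ennreal (\<integral>x. std_normal_density x * x ^ (2 * k) \<partial>lborel)"
    using std_normal_moment_even[of k]
    by (intro nn_integral_eq_integral) (simp_all add: has_bochner_integral_iff)
  also have "(\<integral>x. std_normal_density x * x ^ (2 * k) \<partial>lborel) = fact (2 * k) / (2 ^ k * fact k)"
    by (rule integral_std_normal_moment_even)
  also have "fact (2 * k) / (2 ^ k * fact k) = (2 ^ k * pochhammer (1/2) k :: real)"
  proof -
    have "(2::real) ^ (2 * k) = 2 ^ k * 2 ^ k" by (simp flip: power_add mult_2)
    then show ?thesis unfolding fact_double by simp
  qed
  finally show ?thesis .
qed

lemma pochhammer_ge_0: "0 \<le> x \<Longrightarrow> 0 \<le> pochhammer (x :: real) n"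
  unfolding pochhammer_prod by (rule prod_nonneg) auto

text \<open>Chi-square moments with \<open>card K\<close> degrees of freedom. Splitting off one
  coordinate and expanding the power turns the induction step into the Vandermonde identity for
  rising factorials.\<close>

lemma nn_integral_gaussian_norm_moment:
  assumes "finite K"
  shows "(\<integral>\<^sup>+x. ennreal ((\<Sum>k\<in>K. (x k)\<^sup>2) ^ m) \<partial>gaussian K) = ennreal (2 ^ m * pochhammer (real (card K) / 2) m)"
  using assms
proof (induction K arbitrary: m)
  case empty
  show ?case by (cases m) (auto simp: prob_space.emeasure_space_1[OF prob_space_gaussian] pochhammer_0_left)
next
  case (insert c K)
  let ?s = "\<lambda>x. \<Sum>k\<in>K. (x k)\<^sup>2"
  have meas_s: "?s \<in> borel_measurable (gaussian K)" by (intro borel_measurable_sum borel_measurable_power) auto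
  have "(\<integral>\<^sup>+x. ennreal ((\<Sum>k\<in>insert c K. (x k)\<^sup>2) ^ m) \<partial>gaussian (insert c K)) =
      (\<integral>\<^sup>+x. (\<integral>\<^sup>+y. ennreal ((\<Sum>k\<in>insert c K. ((x(c := y)) k)\<^sup>2) ^ m) \<partial>std_normal_distribution) \<partial>gaussian K)"
    using insert.hyps
    by (intro nn_integral_gaussian_insert measurable_compose[OF _ measurable_ennreal] borel_measurable_power borel_measurable_sum) auto
  also have "\<dots> = (\<integral>\<^sup>+x. (\<Sum>i\<le>m. ennreal (real (m choose i) * ?s x ^ i) * ennreal (2 ^ (m - i) * pochhammer (1/2) (m - i))) \<partial>gaussian K)"
  proof (rule nn_integral_cong)
    fix x :: "'a \<Rightarrow> real"
    have s: "0 \<le> ?s x" by (rule sum_nonneg) simp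
    have "(\<integral>\<^sup>+y. ennreal ((\<Sum>k\<in>insert c K. ((x(c := y)) k)\<^sup>2) ^ m) \<partial>std_normal_distribution) =
        (\<integral>\<^sup>+y. (\<Sum>i\<le>m. ennreal (real (m choose i) * ?s x ^ i) * ennreal (y ^ (2 * (m - i)))) \<partial>std_normal_distribution)"
    proof (rule nn_integral_cong)
      fix y
      have "(\<Sum>k\<in>K. ((x(c := y)) k)\<^sup>2) = ?s x"
        using insert.hyps by (intro sum.cong) auto
      then have "(\<Sum>k\<in>insert c K. ((x(c := y)) k)\<^sup>2) ^ m = (?s x + y\<^sup>2) ^ m"
        using insert.hyps by (simp add: add.commute)
      also have "\<dots> = (\<Sum>i\<le>m. real (m choose i) * ?s x ^ i * y ^ (2 * (m - i)))"
        unfolding binomial_ring by (simp add: power_mult)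
      finally have "ennreal ((\<Sum>k\<in>insert c K. ((x(c := y)) k)\<^sup>2) ^ m) =
          ennreal (\<Sum>i\<le>m. real (m choose i) * ?s x ^ i * y ^ (2 * (m - i)))" by simp
      also have "\<dots> = (\<Sum>i\<le>m. ennreal (real (m choose i) * ?s x ^ i * y ^ (2 * (m - i))))"
        using s by (intro sum_ennreal[symmetric] mult_nonneg_nonneg) auto
      also have "\<dots> = (\<Sum>i\<le>m. ennreal (real (m choose i) * ?s x ^ i) * ennreal (y ^ (2 * (m - i))))"
        using s by (intro sum.cong refl ennreal_mult mult_nonneg_nonneg) auto
      finally show "ennreal ((\<Sum>k\<in>insert c K. ((x(c := y)) k)\<^sup>2) ^ m) = \<dots>" .
    qed
    also have "\<dots> = (\<Sum>i\<le>m. ennreal (real (m choose i) * ?s x ^ i) * ennreal (2 ^ (m - i) * pochhammer (1/2) (m - i)))"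
      by (subst nn_integral_sum) (auto simp: nn_integral_cmult nn_integral_normal_even_moment)
    finally show "(\<integral>\<^sup>+y. ennreal ((\<Sum>k\<in>insert c K. ((x(c := y)) k)\<^sup>2) ^ m) \<partial>std_normal_distribution) = \<dots>" .
  qed
  also have "\<dots> = (\<Sum>i\<le>m. ennreal (real (m choose i)) * (\<integral>\<^sup>+x. ennreal (?s x ^ i) \<partial>gaussian K) * ennreal (2 ^ (m - i) * pochhammer (1/2) (m - i)))"
  proof (subst nn_integral_sum)
    have m: "(\<lambda>x. ennreal (?s x ^ i)) \<in> borel_measurable (gaussian K)" for i
      using meas_s by (intro measurable_compose[OF _ measurable_ennreal] borel_measurable_power)
    show "(\<lambda>x. ennreal (real (m choose i) * ?s x ^ i) * ennreal (2 ^ (m - i) * pochhammer (1/2) (m - i))) \<in> borel_measurable (gaussian K)" for i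
      using meas_s by (intro borel_measurable_times_ennreal measurable_compose[OF _ measurable_ennreal] borel_measurable_times borel_measurable_power) auto
    have "ennreal (real (m choose i) * ?s x ^ i) = ennreal (real (m choose i)) * ennreal (?s x ^ i)" for i and x :: "'a \<Rightarrow> real"
      by (intro ennreal_mult zero_le_power sum_nonneg zero_le_power2) auto
    then show "(\<Sum>i\<le>m. \<integral>\<^sup>+x. ennreal (real (m choose i) * ?s x ^ i) * ennreal (2 ^ (m - i) * pochhammer (1/2) (m - i)) \<partial>gaussian K) =
        (\<Sum>i\<le>m. ennreal (real (m choose i)) * (\<integral>\<^sup>+x. ennreal (?s x ^ i) \<partial>gaussian K) * ennreal (2 ^ (m - i) * pochhammer (1/2) (m - i)))"
      using m by (simp add: nn_integral_cmult nn_integral_multc)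
  qed
  also have "\<dots> = (\<Sum>i\<le>m. ennreal (real (m choose i) * (2 ^ i * pochhammer (real (card K) / 2) i) * (2 ^ (m - i) * pochhammer (1/2) (m - i))))"
    unfolding insert.IH by (intro sum.cong refl) (simp add: ennreal_mult[symmetric] pochhammer_ge_0)
  also have "\<dots> = ennreal (\<Sum>i\<le>m. real (m choose i) * (2 ^ i * pochhammer (real (card K) / 2) i) * (2 ^ (m - i) * pochhammer (1/2) (m - i)))"
    by (intro sum_ennreal) (auto intro!: mult_nonneg_nonneg pochhammer_ge_0)
  also have "(\<Sum>i\<le>m. real (m choose i) * (2 ^ i * pochhammer (real (card K) / 2) i) * (2 ^ (m - i) * pochhammer (1/2) (m - i))) =
      2 ^ m * (\<Sum>i\<le>m. of_nat (m choose i) * pochhammer (real (card K) / 2) i * pochhammer (1/2) (m - i))"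
    unfolding sum_distrib_left
  proof (intro sum.cong refl)
    fix i assume "i \<in> {..m}"
    then have "(2::real) ^ m = 2 ^ i * 2 ^ (m - i)" by (simp flip: power_add)
    then show "real (m choose i) * (2 ^ i * pochhammer (real (card K) / 2) i) * (2 ^ (m - i) * pochhammer (1/2) (m - i)) =
        2 ^ m * (of_nat (m choose i) * pochhammer (real (card K) / 2) i * pochhammer (1/2) (m - i))"
      by simp
  qed
  also have "(\<Sum>i\<le>m. of_nat (m choose i) * pochhammer (real (card K) / 2) i * pochhammer (1/2) (m - i)) = pochhammer (real (card (insert c K)) / 2) m"
    using insert.hyps by (simp add: pochhammer_binomial_sum[symmetric] add_divide_distrib add.commute)
  finally show ?case .
qed

section \<open>Moments of products of Gaussian minors\<close>

text \<open>The Leibniz formula makes the determinant a polynomial in the entries.\<close>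

lemma measurable_det_mat:
  assumes "\<And>a b. a < j \<Longrightarrow> b < j \<Longrightarrow> (\<lambda>x. F x (a, b)) \<in> borel_measurable M"
  shows "(\<lambda>x. mdet j (F x) :: real) \<in> borel_measurable M"
proof -
  have "(\<lambda>x. mdet j (F x)) =
      (\<lambda>x. \<Sum>p\<in>{p. p permutes {0..<j}}. signof p * (\<Prod>i = 0..<j. F x (i, p i)))"
  proof
    fix x
    have "Matrix.mat j j (F x) $$ (i, p i) = F x (i, p i)" if "p permutes {0..<j}" "i < j" for p i
      using that permutes_in_image[of p "{0..<j}" i] by simp
    then show "mdet j (F x) =
        (\<Sum>p\<in>{p. p permutes {0..<j}}. signof p * (\<Prod>i = 0..<j. F x (i, p i)))"
      by (subst det_def'[of _ j]) auto
  qed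
  moreover have "(\<lambda>x. \<Prod>i = 0..<j. F x (i, p i)) \<in> borel_measurable M" if "p permutes {0..<j}" for p
    using assms permutes_in_image[OF that] by (intro borel_measurable_prod) auto
  ultimately show ?thesis by (auto intro!: borel_measurable_sum borel_measurable_times)
qed

lemma sum_orthogonal:
  assumes Q: "Q \<in> orthogonal_group n"
  shows "(\<Sum>c<n. (\<Sum>e<n. Q $$ (c, e) * u e) * (\<Sum>e<n. Q $$ (c, e) * v e)) = (\<Sum>e<n. u e * v e)"
proof -
  note QD = orthogonal_groupD[OF Q]
  have "(\<Sum>c<n. (\<Sum>e<n. Q $$ (c, e) * u e) * (\<Sum>e<n. Q $$ (c, e) * v e)) =
      (\<Sum>c<n. \<Sum>e<n. \<Sum>f<n. u e * v f * (Q $$ (c, e) * Q $$ (c, f)))"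
    by (simp add: sum_product mult_ac)
  also have "\<dots> = (\<Sum>e<n. \<Sum>c<n. \<Sum>f<n. u e * v f * (Q $$ (c, e) * Q $$ (c, f)))" by (rule sum.swap)
  also have "\<dots> = (\<Sum>e<n. \<Sum>f<n. \<Sum>c<n. u e * v f * (Q $$ (c, e) * Q $$ (c, f)))"
    by (intro sum.cong refl sum.swap)
  also have "\<dots> = (\<Sum>e<n. \<Sum>f<n. if f = e then u e * v e else 0)"
  proof (intro sum.cong refl)
    fix e f assume "e \<in> {..<n}" "f \<in> {..<n}"
    then have "(\<Sum>c<n. Q $$ (c, e) * Q $$ (c, f)) = (if f = e then 1 else 0)"
      using index_gram[OF QD(1), of e f] QD(2) by auto
    then show "(\<Sum>c<n. u e * v f * (Q $$ (c, e) * Q $$ (c, f))) = (if f = e then u e * v e else 0)"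
      by (simp flip: sum_distrib_left)
  qed
  also have "\<dots> = (\<Sum>e<n. u e * v e)" by (intro sum.cong refl) simp
  finally show ?thesis .
qed

section \<open>Gram matrices of Gaussian matrices: the exact moment\<close>

definition gram :: "nat \<Rightarrow> (nat \<times> nat \<Rightarrow> real) \<Rightarrow> nat \<Rightarrow> nat \<Rightarrow> real" where
  "gram n g a b = (\<Sum>c<n. g (c, a) * g (c, b))"

text \<open>This is f(G'G) for the product f of the overview. The natural number subtraction is
  exact for decreasing \<kappa>.\<close>

definition gram_power :: "nat \<Rightarrow> (nat \<Rightarrow> nat) \<Rightarrow> (nat \<times> nat \<Rightarrow> real) \<Rightarrow> real" where
  "gram_power n \<kappa> g =
    (\<Prod>j<n. mdet (Suc j) (case_prod (gram n g)) ^ (\<kappa> j - \<kappa> (Suc j)))"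

lemma gram_left_mult:
  assumes "Q \<in> orthogonal_group n" "a \<in> J" "b \<in> J"
  shows "gram n (left_mult n J Q g) a b = gram n g a b"
  using sum_orthogonal[OF assms(1), of "\<lambda>e. g (e, a)" "\<lambda>e. g (e, b)"] assms(2,3)
  by (simp add: gram_def left_mult_def)

lemma gram_power_cong:
  assumes "\<And>a b. a < n \<Longrightarrow> b < n \<Longrightarrow> gram n g a b = gram n h a b"
  shows "gram_power n \<kappa> g = gram_power n \<kappa> h"
proof -
  have "Matrix.mat (Suc j) (Suc j) (case_prod (gram n g)) = Matrix.mat (Suc j) (Suc j) (case_prod (gram n h))" if "j < n" for j
    using assms that by (intro eq_matI) auto
  then show ?thesis unfolding gram_power_def by simp
qed

lemma det_gram_nonneg: "0 \<le> mdet j (case_prod (gram n g))"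
proof -
  have "gram n g = (\<lambda>a b. \<Sum>r<n. 1 * (\<lambda>c a. g (c, a)) r a * (\<lambda>c a. g (c, a)) r b)"
    by (simp add: gram_def fun_eq_iff)
  then show ?thesis
    using det_weighted_gram_mono[of n "\<lambda>_. 1" "\<lambda>_. 1" j "\<lambda>c a. g (c, a)"] by simp
qed

lemma gram_power_nonneg: "0 \<le> gram_power n \<kappa> g"
  unfolding gram_power_def by (intro prod_nonneg ballI zero_le_power det_gram_nonneg)

lemma measurable_gram_power:
  assumes "{..<n} \<times> {..<n} \<subseteq> I"
  shows "gram_power n \<kappa> \<in> borel_measurable (gaussian I)"
proof -
  have "(\<lambda>g. mdet (Suc j) (case_prod (gram n g))) \<in> borel_measurable (gaussian I)" if "j < n" for j
    using assms that by (intro measurable_det_mat) (auto simp: gram_def intro!: borel_measurable_sum borel_measurable_times measurable_gaussian_component)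
  then show ?thesis
    unfolding gram_power_def[abs_def] by (intro borel_measurable_prod borel_measurable_power) auto
qed

lemma sum_part_differences:
  fixes \<kappa> :: "nat \<Rightarrow> nat"
  assumes "antimono \<kappa>"
  shows "(\<Sum>j<n. \<kappa> j - \<kappa> (Suc j)) = \<kappa> 0 - \<kappa> n"
proof (induction n)
  case (Suc n)
  then show ?case using antimonoD[OF assms, of 0 n] antimonoD[OF assms, of n "Suc n"] by simp
qed simp

text \<open>If the first column of \<open>g\<close> is a multiple of the first unit vector, the
  Schur complement of its Gram matrix is the Gram matrix of \<open>g\<close> without first row and
  column. Each minor yields one factor \<open>(g (0, 0))\<^sup>2\<close>, and the exponents
  telescope to \<open>\<kappa> 0\<close>.\<close>

lemma gram_power_corner:
  assumes \<kappa>: "antimono \<kappa>" "\<kappa> (Suc n) = 0" and g: "\<And>c. 0 < c \<Longrightarrow> c \<le> n \<Longrightarrow> g (c, 0) = 0"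
  shows "gram_power (Suc n) \<kappa> g = ((g (0, 0))\<^sup>2) ^ \<kappa> 0 * gram_power n (\<lambda>i. \<kappa> (Suc i)) (\<lambda>(i, k). g (Suc i, Suc k))"
proof -
  define h where "h = (\<lambda>(i, k). g (Suc i, Suc k))"
  define D where "D j = mdet j (case_prod (gram n h))" for j
  have row: "gram (Suc n) g 0 b = g (0, 0) * g (0, b)" and col: "gram (Suc n) g b 0 = g (0, b) * g (0, 0)" for b
    unfolding gram_def sum.lessThan_Suc_shift using g by simp_all
  have D: "mdet (Suc j) (case_prod (gram (Suc n) g)) = (g (0, 0))\<^sup>2 * D j" for j
  \<comment> \<open>With a zero corner the whole first row of the Gram matrix vanishes, and so do
    both sides.\<close>
  proof (cases "g (0, 0) = 0")
    case True
    then show ?thesis by (subst det_zero_row) (auto simp: row)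
  next
    case False
    have "Schur_complement (gram (Suc n) g) = gram n h"
    proof (intro ext)
      fix a b
      show "Schur_complement (gram (Suc n) g) a b = gram n h a b"
        using False unfolding Schur_complement_def row col
        by (simp add: gram_def sum.lessThan_Suc_shift h_def field_simps power2_eq_square del: sum.lessThan_Suc)
    qed
    then show ?thesis using False by (subst det_Schur_complement) (auto simp: row D_def power2_eq_square)
  qed
  have "gram_power (Suc n) \<kappa> g = (\<Prod>j<Suc n. ((g (0, 0))\<^sup>2) ^ (\<kappa> j - \<kappa> (Suc j))) * (\<Prod>j<Suc n. D j ^ (\<kappa> j - \<kappa> (Suc j)))"
    unfolding gram_power_def D power_mult_distrib prod.distrib ..
  also have "(\<Prod>j<Suc n. ((g (0, 0))\<^sup>2) ^ (\<kappa> j - \<kappa> (Suc j))) = ((g (0, 0))\<^sup>2) ^ \<kappa> 0"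
    unfolding power_sum[symmetric] sum_part_differences[OF \<kappa>(1)] \<kappa>(2) by simp
  also have "(\<Prod>j<Suc n. D j ^ (\<kappa> j - \<kappa> (Suc j))) = gram_power n (\<lambda>i. \<kappa> (Suc i)) h"
    unfolding gram_power_def prod.lessThan_Suc_shift by (simp add: D_def)
  finally show ?thesis by (simp add: h_def)
qed

text \<open>Bartlett's argument. An orthogonal matrix depending on the first column alone rotates
  that column onto the first axis; the other columns are independent of it and stay Gaussian. The
  corner contributes a chi-square moment, the remaining block is the case \<open>n\<close>.\<close>

theorem nn_integral_gram_power:
  assumes "antimono \<kappa>" "\<kappa> n = 0"
  shows "(\<integral>\<^sup>+g. ennreal (gram_power n \<kappa> g) \<partial>gaussian ({..<n} \<times> {..<n})) =
    ennreal (\<Prod>i<n. 2 ^ \<kappa> i * pochhammer (real (n - i) / 2) (\<kappa> i))"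
  using assms
proof (induction n arbitrary: \<kappa>)
  case 0
  show ?case by (simp add: gram_power_def prob_space.emeasure_space_1[OF prob_space_gaussian])
next
  case (Suc n)
  define K0 where "K0 = {..<Suc n} \<times> {0::nat}"
  define J where "J = {1..<Suc n}"
  define K1 where "K1 = {..<Suc n} \<times> J"
  have K: "{..<Suc n} \<times> {..<Suc n} = K0 \<union> K1" by (auto simp: K0_def K1_def J_def)
  have fin: "K0 \<inter> K1 = {}" "finite K0" "finite K1" "finite J" by (auto simp: K0_def K1_def J_def)
  define \<kappa>' where "\<kappa>' i = \<kappa> (Suc i)" for i
  have \<kappa>': "antimono \<kappa>'" "\<kappa>' n = 0"
    using Suc.prems by (auto simp: \<kappa>'_def antimono_def)
  let ?F = "\<lambda>g. ennreal (gram_power (Suc n) \<kappa> g)"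
  have F: "?F \<in> borel_measurable (gaussian (K0 \<union> K1))"
    unfolding K[symmetric] by (intro measurable_compose[OF measurable_gram_power measurable_ennreal]) auto
  let ?c = "\<Prod>i<n. 2 ^ \<kappa>' i * pochhammer (real (n - i) / 2) (\<kappa>' i)"
  have c: "0 \<le> ?c" by (intro prod_nonneg ballI mult_nonneg_nonneg pochhammer_ge_0) auto
  have inner: "(\<integral>\<^sup>+y. ?F (merge K0 K1 (x, y)) \<partial>gaussian K1) = ennreal ((\<Sum>k\<in>K0. (x k)\<^sup>2) ^ \<kappa> 0) * ennreal ?c"
    if x: "x \<in> space (gaussian K0)" for x
  proof -
    \<comment> \<open>All columns of \<open>M\<close> equal the given vector, so its
      triangularisation serves only to rotate this vector onto the first axis.\<close>
    define M where "M = Matrix.mat (Suc n) (Suc n) (\<lambda>(c, _). x (c, 0))"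
    have M: "M \<in> carrier_mat (Suc n) (Suc n)" by (simp add: M_def)
    obtain Q where Q: "Q \<in> reflection_products (Suc n)"
      and Q0: "\<And>i j. i < Suc n \<Longrightarrow> j < i \<Longrightarrow> (Q * M) $$ (i, j) = 0"
      using QR_decomposition[OF M] by metis
    have QO: "Q \<in> orthogonal_group (Suc n)" by (rule reflection_products_orthogonal[OF Q])
    define x' where "x' = left_mult (Suc n) {0} Q x"
    have x'0: "x' (i, 0) = 0" if "0 < i" "i \<le> n" for i
      using Q0[of i 0] that orthogonal_groupD[OF QO]
      by (simp add: M_def x'_def left_mult_def scalar_prod_def atLeast0LessThan)
    have sq: "(x' (0, 0))\<^sup>2 = (\<Sum>k\<in>K0. (x k)\<^sup>2)"
    proof -
      have "(x' (0, 0))\<^sup>2 = gram (Suc n) x' 0 0"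
        unfolding gram_def sum.lessThan_Suc_shift using x'0 by (simp add: power2_eq_square)
      also have "\<dots> = gram (Suc n) x 0 0" unfolding x'_def by (rule gram_left_mult[OF QO]) auto
      also have "\<dots> = (\<Sum>k\<in>K0. (x k)\<^sup>2)"
        unfolding gram_def K0_def
        by (rule sum.reindex_bij_witness[of _ fst "\<lambda>c. (c, 0)"]) (auto simp: power2_eq_square)
      finally show ?thesis .
    qed
    have x'_space: "x' \<in> space (gaussian K0)" by (auto simp: x'_def left_mult_def K0_def space_gaussian)
    define H where "H y = ennreal (gram_power (Suc n) \<kappa> (merge K0 K1 (x', y)))" for y
    have H: "H \<in> borel_measurable (gaussian K1)"
    proof -
      have "(\<lambda>y. merge K0 K1 (x', y)) \<in> measurable (gaussian K1) (gaussian (K0 \<union> K1))"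
      proof (rule measurable_gaussian_I)
        show "(\<lambda>y. merge K0 K1 (x', y) i) \<in> borel_measurable (gaussian K1)" if "i \<in> K0 \<union> K1" for i
          using that by (cases "i \<in> K0") (auto simp: merge_def)
      qed (auto simp: merge_def)
      from measurable_compose[OF this F] show ?thesis unfolding H_def .
    qed
    have rot: "?F (merge K0 K1 (x, y)) = H (left_mult (Suc n) J Q y)" for y
    proof -
      have "gram_power (Suc n) \<kappa> (merge K0 K1 (x, y)) = gram_power (Suc n) \<kappa> (left_mult (Suc n) {..<Suc n} Q (merge K0 K1 (x, y)))"
        by (rule gram_power_cong, rule gram_left_mult[OF QO, symmetric]) auto
      also have "left_mult (Suc n) {..<Suc n} Q (merge K0 K1 (x, y)) = merge K0 K1 (x', left_mult (Suc n) J Q y)"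
        by (auto simp: fun_eq_iff left_mult_def merge_def x'_def K0_def K1_def J_def)
      finally show ?thesis by (simp add: H_def)
    qed
    have "(\<integral>\<^sup>+y. ?F (merge K0 K1 (x, y)) \<partial>gaussian K1) = (\<integral>\<^sup>+y. H y \<partial>gaussian K1)"
      unfolding rot using nn_integral_gaussian_left_mult[OF fin(4) H[unfolded K1_def] QO] unfolding K1_def .
    also have "\<dots> = (\<integral>\<^sup>+y. ennreal ((\<Sum>k\<in>K0. (x k)\<^sup>2) ^ \<kappa> 0) *
        ennreal (gram_power n \<kappa>' (\<lambda>ij\<in>{..<n} \<times> {..<n}. y ((\<lambda>(i, k). (Suc i, Suc k)) ij))) \<partial>gaussian K1)"
    proof (rule nn_integral_cong)
      fix y
      have "gram_power (Suc n) \<kappa> (merge K0 K1 (x', y)) =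
          ((merge K0 K1 (x', y) (0, 0))\<^sup>2) ^ \<kappa> 0 * gram_power n \<kappa>' (\<lambda>(i, k). merge K0 K1 (x', y) (Suc i, Suc k))"
        unfolding \<kappa>'_def using Suc.prems x'0 by (intro gram_power_corner) (auto simp: merge_def K0_def)
      also have "merge K0 K1 (x', y) (0, 0) = x' (0, 0)" by (simp add: merge_def K0_def)
      also have "gram_power n \<kappa>' (\<lambda>(i, k). merge K0 K1 (x', y) (Suc i, Suc k)) =
          gram_power n \<kappa>' (\<lambda>ij\<in>{..<n} \<times> {..<n}. y ((\<lambda>(i, k). (Suc i, Suc k)) ij))"
        by (rule gram_power_cong) (auto simp: gram_def merge_def K0_def K1_def J_def)
      finally show "H y = ennreal ((\<Sum>k\<in>K0. (x k)\<^sup>2) ^ \<kappa> 0) *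
          ennreal (gram_power n \<kappa>' (\<lambda>ij\<in>{..<n} \<times> {..<n}. y ((\<lambda>(i, k). (Suc i, Suc k)) ij)))"
        unfolding H_def sq by (simp add: ennreal_mult gram_power_nonneg sum_nonneg)
    qed
    also have "\<dots> = ennreal ((\<Sum>k\<in>K0. (x k)\<^sup>2) ^ \<kappa> 0) *
        (\<integral>\<^sup>+y. ennreal (gram_power n \<kappa>' (\<lambda>ij\<in>{..<n} \<times> {..<n}. y ((\<lambda>(i, k). (Suc i, Suc k)) ij))) \<partial>gaussian K1)"
    proof (rule nn_integral_cmult)
      have "(\<lambda>y. \<lambda>ij\<in>{..<n} \<times> {..<n}. y ((\<lambda>(i, k). (Suc i, Suc k)) ij)) \<in> measurable (gaussian K1) (gaussian ({..<n} \<times> {..<n}))"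
        by (rule measurable_gaussian_I) (auto simp: K1_def J_def intro!: measurable_gaussian_component)
      from measurable_compose[OF this measurable_compose[OF measurable_gram_power measurable_ennreal], of n]
      show "(\<lambda>y. ennreal (gram_power n \<kappa>' (\<lambda>ij\<in>{..<n} \<times> {..<n}. y ((\<lambda>(i, k). (Suc i, Suc k)) ij)))) \<in> borel_measurable (gaussian K1)"
        by simp
    qed
    also have "(\<integral>\<^sup>+y. ennreal (gram_power n \<kappa>' (\<lambda>ij\<in>{..<n} \<times> {..<n}. y ((\<lambda>(i, k). (Suc i, Suc k)) ij))) \<partial>gaussian K1) =
        (\<integral>\<^sup>+y. ennreal (gram_power n \<kappa>' y) \<partial>gaussian ({..<n} \<times> {..<n}))"
      by (rule nn_integral_gaussian_reindex[where f="\<lambda>g. ennreal (gram_power n \<kappa>' g)"])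
         (auto simp: inj_on_def K1_def J_def intro!: measurable_compose[OF measurable_gram_power measurable_ennreal])
    also have "\<dots> = ennreal ?c" by (rule Suc.IH[OF \<kappa>'])
    finally show ?thesis .
  qed
  have meas: "(\<lambda>x. ennreal ((\<Sum>k\<in>K0. (x k)\<^sup>2) ^ \<kappa> 0)) \<in> borel_measurable (gaussian K0)"
    by (intro measurable_compose[OF _ measurable_ennreal] borel_measurable_power borel_measurable_sum measurable_gaussian_component)
  have "(\<integral>\<^sup>+g. ?F g \<partial>gaussian ({..<Suc n} \<times> {..<Suc n})) =
      (\<integral>\<^sup>+x. (\<integral>\<^sup>+y. ?F (merge K0 K1 (x, y)) \<partial>gaussian K1) \<partial>gaussian K0)"
    unfolding K by (rule nn_integral_gaussian_fold[OF fin(1,2,3) F])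
  also have "\<dots> = (\<integral>\<^sup>+x. ennreal ((\<Sum>k\<in>K0. (x k)\<^sup>2) ^ \<kappa> 0) * ennreal ?c \<partial>gaussian K0)"
    by (rule nn_integral_cong) (rule inner)
  also have "\<dots> = (\<integral>\<^sup>+x. ennreal ((\<Sum>k\<in>K0. (x k)\<^sup>2) ^ \<kappa> 0) \<partial>gaussian K0) * ennreal ?c"
    by (rule nn_integral_multc[OF meas])
  also have "\<dots> = ennreal (2 ^ \<kappa> 0 * pochhammer (real (Suc n) / 2) (\<kappa> 0)) * ennreal ?c"
  proof -
    have "card K0 = Suc n" by (simp add: K0_def)
    then show ?thesis using nn_integral_gaussian_norm_moment[OF fin(2), of "\<kappa> 0"] by (simp only:)
  qed
  also have "\<dots> = ennreal ((2 ^ \<kappa> 0 * pochhammer (real (Suc n) / 2) (\<kappa> 0)) * ?c)"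
    using c by (intro ennreal_mult[symmetric] mult_nonneg_nonneg pochhammer_ge_0) auto
  also have "(2 ^ \<kappa> 0 * pochhammer (real (Suc n) / 2) (\<kappa> 0)) * ?c = (\<Prod>i<Suc n. 2 ^ \<kappa> i * pochhammer (real (Suc n - i) / 2) (\<kappa> i))"
    unfolding prod.lessThan_Suc_shift by (simp add: \<kappa>'_def)
  finally show ?case .
qed

section \<open>Squared minors of Gaussian matrices: a lower bound for the moment\<close>

lemma nn_integral_normal_minus:
  assumes f: "f \<in> borel_measurable borel"
  shows "(\<integral>\<^sup>+y. f (- y) \<partial>std_normal_distribution) = (\<integral>\<^sup>+y. f y \<partial>std_normal_distribution)"
proof -
  have f': "(\<lambda>y. f (- y)) \<in> borel_measurable borel"
    using f by (rule measurable_compose[rotated]) simp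
  have "(\<integral>\<^sup>+y. f y \<partial>std_normal_distribution) = (\<integral>\<^sup>+y. ennreal (std_normal_density y) * f y \<partial>lborel)"
    using f by (subst nn_integral_density) auto
  also have "\<dots> = ennreal \<bar>-1\<bar> * (\<integral>\<^sup>+y. ennreal (std_normal_density (0 + - 1 * y)) * f (0 + - 1 * y) \<partial>lborel)"
    using f by (intro nn_integral_real_affine) auto
  also have "\<dots> = (\<integral>\<^sup>+y. ennreal (std_normal_density y) * f (- y) \<partial>lborel)"
    by (simp add: normal_density_def)
  also have "\<dots> = (\<integral>\<^sup>+y. f (- y) \<partial>std_normal_distribution)"
    using f' by (subst nn_integral_density) auto
  finally show ?thesis by simp
qed

lemma even_power_midpoint: "2 * a ^ (2 * k) \<le> (w + a) ^ (2 * k) + (w - a :: real) ^ (2 * k)"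
proof -
  have "convex_on UNIV (\<lambda>x::real. x ^ (2 * k))" by (rule convex_power_even) simp
  then have "((1 - 1/2) *\<^sub>R (a + w) + (1/2) *\<^sub>R (a - w)) ^ (2 * k) \<le> (1 - 1/2) * (a + w) ^ (2 * k) + (1/2) * (a - w) ^ (2 * k)"
    by (intro convex_onD) auto
  moreover have "(1 - 1/2) *\<^sub>R (a + w) + (1/2) *\<^sub>R (a - w) = a" by (simp add: algebra_simps add_divide_distrib[symmetric])
  moreover have "(a - w) ^ (2 * k) = (w - a) ^ (2 * k)"
    by (metis minus_diff_eq power_mult power2_minus)
  ultimately show ?thesis by (simp add: add.commute)
qed

text \<open>A shift by \<open>w\<close> cannot lower an even moment: average over y and -y and use
  convexity.\<close>

lemma nn_integral_normal_affine_moment: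
  "ennreal (d ^ (2 * k) * (2 ^ k * pochhammer (1/2) k)) \<le> (\<integral>\<^sup>+y. ennreal ((y * d + w) ^ (2 * k)) \<partial>std_normal_distribution)"
proof -
  let ?f = "\<lambda>y. ennreal ((y * d + w) ^ (2 * k))"
  have f: "?f \<in> borel_measurable borel" "(\<lambda>y. ?f (- y)) \<in> borel_measurable borel" by measurable
  have "ennreal (1/2) + ennreal (1/2) = 1" by (subst ennreal_plus[symmetric]) auto
  then have half: "ennreal (1/2) * x + ennreal (1/2) * x = x" for x
    unfolding distrib_right[symmetric] by simp
  have "ennreal (d ^ (2 * k) * (2 ^ k * pochhammer (1/2) k)) = ennreal (d ^ (2 * k)) * (\<integral>\<^sup>+y. ennreal (y ^ (2 * k)) \<partial>std_normal_distribution)"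
    unfolding nn_integral_normal_even_moment by (intro ennreal_mult mult_nonneg_nonneg pochhammer_ge_0) (auto simp: zero_le_even_power)
  also have "\<dots> = (\<integral>\<^sup>+y. ennreal (d ^ (2 * k)) * ennreal (y ^ (2 * k)) \<partial>std_normal_distribution)"
    by (intro nn_integral_cmult[symmetric]) simp
  also have "\<dots> \<le> (\<integral>\<^sup>+y. ennreal (1/2) * ?f y + ennreal (1/2) * ?f (- y) \<partial>std_normal_distribution)"
  proof (rule nn_integral_mono)
    fix y
    have "d ^ (2 * k) * y ^ (2 * k) \<le> 1/2 * (y * d + w) ^ (2 * k) + 1/2 * (- y * d + w) ^ (2 * k)"
      using even_power_midpoint[of "y * d" k w] by (simp add: power_mult_distrib algebra_simps)
    then have "ennreal (d ^ (2 * k) * y ^ (2 * k)) \<le> ennreal (1/2 * (y * d + w) ^ (2 * k) + 1/2 * (- y * d + w) ^ (2 * k))"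
      by (rule ennreal_leI)
    also have "\<dots> = ennreal (1/2 * (y * d + w) ^ (2 * k)) + ennreal (1/2 * (- y * d + w) ^ (2 * k))"
      by (intro ennreal_plus) (auto intro!: mult_nonneg_nonneg zero_le_even_power)
    finally show "ennreal (d ^ (2 * k)) * ennreal (y ^ (2 * k)) \<le> ennreal (1/2) * ?f y + ennreal (1/2) * ?f (- y)"
      by (subst (asm) (1 2 3) ennreal_mult) (auto intro!: zero_le_even_power)
  qed
  also have "\<dots> = ennreal (1/2) * (\<integral>\<^sup>+y. ?f y \<partial>std_normal_distribution) + ennreal (1/2) * (\<integral>\<^sup>+y. ?f (- y) \<partial>std_normal_distribution)"
    using f by (subst nn_integral_add) (auto simp: nn_integral_cmult)
  also have "\<dots> = (\<integral>\<^sup>+y. ?f y \<partial>std_normal_distribution)"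
    unfolding nn_integral_normal_minus[OF f(1)] half ..
  finally show ?thesis .
qed

text \<open>The product f with the squared minors of G in place of the minors of G'G. Up to
  eigenvalues it is what remains of f(G'AG) when the j-th minor keeps only the first j rows of
  G.\<close>

definition det_power :: "nat \<Rightarrow> (nat \<Rightarrow> nat) \<Rightarrow> (nat \<times> nat \<Rightarrow> real) \<Rightarrow> real" where
  "det_power n \<kappa> g = (\<Prod>j<n. mdet (Suc j) g ^ (2 * (\<kappa> j - \<kappa> (Suc j))))"

lemma det_power_nonneg: "0 \<le> det_power n \<kappa> g"
  unfolding det_power_def by (intro prod_nonneg ballI zero_le_even_power) simp

lemma measurable_det_power:
  assumes "{..<n} \<times> {..<n} \<subseteq> I"
  shows "det_power n \<kappa> \<in> borel_measurable (gaussian I)"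
proof -
  have "(\<lambda>g. mdet (Suc j) g) \<in> borel_measurable (gaussian I)" if "j < n" for j
    using assms that by (intro measurable_det_mat) (auto intro!: measurable_gaussian_component)
  then show ?thesis
    unfolding det_power_def[abs_def] by (intro borel_measurable_prod borel_measurable_power) auto
qed

lemma det_mat_cong:
  assumes "\<And>a b. a < j \<Longrightarrow> b < j \<Longrightarrow> F (a, b) = G (a, b)"
  shows "mdet j F = mdet j G"
proof -
  have "Matrix.mat j j F = Matrix.mat j j G" using assms by (intro eq_matI) auto
  then show ?thesis by simp
qed

text \<open>Laplace expansion along the last row: its cofactors do not involve the corner entry, and
  the cofactor of the corner is the preceding minor.\<close>

lemma det_corner_entry_affine:
  fixes g :: "nat \<times> nat \<Rightarrow> real"
  shows "\<exists>w. \<forall>y. mdet (Suc m) (g((m, m) := y)) = y * mdet m g + w"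
proof (intro exI allI)
  fix y
  let ?A = "\<lambda>y. Matrix.mat (Suc m) (Suc m) (g((m, m) := y))"
  have "Determinant.det (?A y) = (\<Sum>b<Suc m. ?A y $$ (m, b) * cofactor (?A y) m b)"
    by (rule laplace_expansion_row) auto
  also have "\<dots> = (\<Sum>b<m. ?A y $$ (m, b) * cofactor (?A y) m b) + y * cofactor (?A y) m m" by simp
  also have "(\<Sum>b<m. ?A y $$ (m, b) * cofactor (?A y) m b) = (\<Sum>b<m. g (m, b) * cofactor (?A 0) m b)"
  proof (intro sum.cong refl)
    fix b assume b: "b \<in> {..<m}"
    have "mat_delete (?A y) m b = mat_delete (?A 0) m b"
      by (rule eq_matI) (auto simp: mat_delete_def)
    then show "?A y $$ (m, b) * cofactor (?A y) m b = g (m, b) * cofactor (?A 0) m b"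
      using b by (simp add: cofactor_def)
  qed
  also have "cofactor (?A y) m m = mdet m g"
  proof -
    have "mat_delete (?A y) m m = Matrix.mat m m g"
      by (rule eq_matI) (auto simp: mat_delete_def)
    then show ?thesis by (simp add: cofactor_def)
  qed
  finally show "Determinant.det (?A y) = y * mdet m g + (\<Sum>b<m. g (m, b) * cofactor (?A 0) m b)"
    by (simp only: add.commute)
qed

text \<open>Only the diagonal entries are integrated out, the last one first.\<close>

theorem nn_integral_det_power:
  assumes "finite I" "{..<m} \<times> {..<m} \<subseteq> I" "antimono \<kappa>" "\<kappa> m = 0"
  shows "ennreal (\<Prod>i<m. 2 ^ \<kappa> i * pochhammer (1/2) (\<kappa> i)) \<le> (\<integral>\<^sup>+g. ennreal (det_power m \<kappa> g) \<partial>gaussian I)"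
  using assms
proof (induction m arbitrary: \<kappa> I)
  case 0
  then show ?case by (simp add: det_power_def prob_space.emeasure_space_1[OF prob_space_gaussian])
next
  case (Suc m)
  define J where "J = I - {(m, m)}"
  have J: "I = insert (m, m) J" "(m, m) \<notin> J" "finite J" "{..<m} \<times> {..<m} \<subseteq> J"
    using Suc.prems(1,2) by (auto simp: J_def subset_eq)
  \<comment> \<open>\<open>\<kappa>'\<close> keeps the first m parts. Once the corner is integrated
    out, the power \<open>2 * \<kappa> m\<close> of the m-th minor joins its old exponent and
    cancels the subtrahend there.\<close>
  define \<kappa>' where "\<kappa>' i = (if i < m then \<kappa> i else 0)" for i
  have \<kappa>': "antimono \<kappa>'" "\<kappa>' m = 0"
    using antimonoD[OF Suc.prems(3)] by (auto simp: \<kappa>'_def antimono_def)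
  have peel: "(\<Prod>j<m. mdet (Suc j) g ^ (2 * (\<kappa> j - \<kappa> (Suc j)))) * mdet m g ^ (2 * \<kappa> m) = det_power m \<kappa>' g"
    for g :: "nat \<times> nat \<Rightarrow> real"
  proof (cases m)
    case 0
    then show ?thesis by (simp add: det_power_def)
  next
    case (Suc l)
    have "\<kappa> (Suc l) \<le> \<kappa> l" using antimonoD[OF Suc.prems(3)] Suc by simp
    then have "2 * (\<kappa> l - \<kappa> (Suc l)) + 2 * \<kappa> (Suc l) = 2 * \<kappa> l" by simp
    moreover have "(\<Prod>j<l. mdet (Suc j) g ^ (2 * (\<kappa> j - \<kappa> (Suc j)))) =
        (\<Prod>j<l. mdet (Suc j) g ^ (2 * (\<kappa>' j - \<kappa>' (Suc j))))"
      by (intro prod.cong refl) (auto simp: \<kappa>'_def Suc)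
    ultimately show ?thesis
      by (simp add: Suc det_power_def mult.assoc power_add[symmetric]) (simp add: \<kappa>'_def Suc)
  qed
  let ?c = "2 ^ \<kappa> m * pochhammer (1/2) (\<kappa> m) :: real"
  have c: "0 \<le> ?c" by (intro mult_nonneg_nonneg pochhammer_ge_0) auto
  have inner: "ennreal (det_power m \<kappa>' x) * ennreal ?c \<le>
      (\<integral>\<^sup>+y. ennreal (det_power (Suc m) \<kappa> (x((m, m) := y))) \<partial>std_normal_distribution)" for x
  proof -
    obtain w where w: "\<And>y. mdet (Suc m) (x((m, m) := y)) = y * mdet m x + w"
      using det_corner_entry_affine[of m x] by blast
    let ?d = "mdet m x"
    let ?P = "\<Prod>j<m. mdet (Suc j) x ^ (2 * (\<kappa> j - \<kappa> (Suc j)))"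
    have P: "0 \<le> ?P" by (intro prod_nonneg ballI zero_le_even_power) simp
    have step: "ennreal (det_power (Suc m) \<kappa> (x((m, m) := y))) = ennreal ?P * ennreal ((y * ?d + w) ^ (2 * \<kappa> m))" for y
    proof -
      have "mdet (Suc j) (x((m, m) := y)) = mdet (Suc j) x" if "j < m" for j
        using that by (intro det_mat_cong) auto
      then have "det_power (Suc m) \<kappa> (x((m, m) := y)) = ?P * (y * ?d + w) ^ (2 * \<kappa> m)"
        unfolding det_power_def using Suc.prems(4) by (simp add: w)
      then show ?thesis using P by (simp add: ennreal_mult zero_le_even_power)
    qed
    have "ennreal (det_power m \<kappa>' x) * ennreal ?c = ennreal ?P * ennreal (?d ^ (2 * \<kappa> m) * ?c)"
      using c P unfolding peel[symmetric] by (simp add: ennreal_mult'[symmetric] zero_le_even_power mult.assoc)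
    also have "\<dots> \<le> ennreal ?P * (\<integral>\<^sup>+y. ennreal ((y * ?d + w) ^ (2 * \<kappa> m)) \<partial>std_normal_distribution)"
      by (intro mult_left_mono nn_integral_normal_affine_moment) simp
    also have "\<dots> = (\<integral>\<^sup>+y. ennreal (det_power (Suc m) \<kappa> (x((m, m) := y))) \<partial>std_normal_distribution)"
      unfolding step by (intro nn_integral_cmult[symmetric]) simp
    finally show ?thesis .
  qed
  have "ennreal (\<Prod>i<Suc m. 2 ^ \<kappa> i * pochhammer (1/2) (\<kappa> i)) = ennreal (\<Prod>i<m. 2 ^ \<kappa>' i * pochhammer (1/2) (\<kappa>' i)) * ennreal ?c"
    using c by (subst ennreal_mult[symmetric]) (auto simp: \<kappa>'_def intro!: prod_nonneg mult_nonneg_nonneg pochhammer_ge_0)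
  also have "\<dots> \<le> (\<integral>\<^sup>+x. ennreal (det_power m \<kappa>' x) \<partial>gaussian J) * ennreal ?c"
    by (intro mult_right_mono Suc.IH \<kappa>' J(3,4)) simp
  also have "\<dots> = (\<integral>\<^sup>+x. ennreal (det_power m \<kappa>' x) * ennreal ?c \<partial>gaussian J)"
    by (intro nn_integral_multc[symmetric] measurable_compose[OF measurable_det_power[OF J(4)] measurable_ennreal])
  also have "\<dots> \<le> (\<integral>\<^sup>+x. (\<integral>\<^sup>+y. ennreal (det_power (Suc m) \<kappa> (x((m, m) := y))) \<partial>std_normal_distribution) \<partial>gaussian J)"
    by (intro nn_integral_mono inner)
  also have "\<dots> = (\<integral>\<^sup>+g. ennreal (det_power (Suc m) \<kappa> g) \<partial>gaussian I)"
    unfolding J(1) using J(2,3) Suc.prems(2)[unfolded J(1)]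
    by (intro nn_integral_gaussian_insert[symmetric] measurable_compose[OF measurable_det_power measurable_ennreal]) auto
  finally show ?case .
qed

section \<open>Haar measure on the orthogonal group\<close>

text \<open>An explicit recursion, because a QR factor that is merely known to exist carries no
  measurability. A vanishing residual yields a zero column;
  \<open>gram_schmidt_residual_nonzero\<close> excludes this for invertible matrices.\<close>

fun gram_schmidt_col :: "nat \<Rightarrow> (nat \<times> nat \<Rightarrow> real) \<Rightarrow> nat \<Rightarrow> nat \<Rightarrow> real" where
  "gram_schmidt_col n g j = (let r = (\<lambda>i. g (i, j) - (\<Sum>k<j. (\<Sum>c<n. gram_schmidt_col n g k c * g (c, j)) * gram_schmidt_col n g k i))
    in (\<lambda>i. r i / sqrt (\<Sum>c<n. (r c)\<^sup>2)))"

declare gram_schmidt_col.simps [simp del]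

definition gram_schmidt_residual :: "nat \<Rightarrow> (nat \<times> nat \<Rightarrow> real) \<Rightarrow> nat \<Rightarrow> nat \<Rightarrow> real" where
  "gram_schmidt_residual n g j i = g (i, j) - (\<Sum>k<j. (\<Sum>c<n. gram_schmidt_col n g k c * g (c, j)) * gram_schmidt_col n g k i)"

lemma gram_schmidt_eq: "gram_schmidt_col n g j i = gram_schmidt_residual n g j i / sqrt (\<Sum>c<n. (gram_schmidt_residual n g j c)\<^sup>2)"
  by (subst gram_schmidt_col.simps) (simp add: gram_schmidt_residual_def)

lemma measurable_gram_schmidt_col:
  assumes "{..<n} \<times> {..<n} \<subseteq> I"
  shows "j < n \<Longrightarrow> i < n \<Longrightarrow> (\<lambda>g. gram_schmidt_col n g j i) \<in> borel_measurable (gaussian I)"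
proof (induction j arbitrary: i rule: less_induct)
  case (less j)
  have r: "(\<lambda>g. gram_schmidt_residual n g j i) \<in> borel_measurable (gaussian I)" if "i < n" for i
    unfolding gram_schmidt_residual_def using assms that less
    by (intro borel_measurable_diff borel_measurable_sum borel_measurable_times measurable_gaussian_component) auto
  have "(\<lambda>g. sqrt (\<Sum>c<n. (gram_schmidt_residual n g j c)\<^sup>2)) \<in> borel_measurable (gaussian I)"
    using r by (intro measurable_compose[OF _ borel_measurable_sqrt] borel_measurable_sum borel_measurable_power) auto
  then show ?case unfolding gram_schmidt_eq using r less.prems by (intro borel_measurable_divide) auto
qed

text \<open>\<open>Q\<close> preserves inner products, so the projection coefficients agree and
  \<open>Q\<close> maps the residuals and their normalisations to each other.\<close>

lemma gram_schmidt_left_mult: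
  assumes Q: "Q \<in> orthogonal_group n"
  shows "j < n \<Longrightarrow> i < n \<Longrightarrow> gram_schmidt_col n (left_mult n {..<n} Q g) j i = (\<Sum>c<n. Q $$ (i, c) * gram_schmidt_col n g j c)"
proof (induction j arbitrary: i rule: less_induct)
  case (less j)
  let ?h = "left_mult n {..<n} Q g"
  have h: "?h (i, j) = (\<Sum>c<n. Q $$ (i, c) * g (c, j))" if "i < n" for i
    using that less.prems by (simp add: left_mult_def)
  have res: "gram_schmidt_residual n ?h j i = (\<Sum>c<n. Q $$ (i, c) * gram_schmidt_residual n g j c)" if i: "i < n" for i
  proof -
    have ip: "(\<Sum>c<n. gram_schmidt_col n ?h k c * ?h (c, j)) = (\<Sum>c<n. gram_schmidt_col n g k c * g (c, j))" if "k < j" for k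
      using less.IH[OF that] that less.prems h
      by (simp add: sum_orthogonal[OF Q, of "gram_schmidt_col n g k" "\<lambda>c. g (c, j)"])
    have "(\<Sum>k<j. (\<Sum>c<n. gram_schmidt_col n ?h k c * ?h (c, j)) * gram_schmidt_col n ?h k i) =
        (\<Sum>k<j. \<Sum>e<n. Q $$ (i, e) * ((\<Sum>c<n. gram_schmidt_col n g k c * g (c, j)) * gram_schmidt_col n g k e))"
    proof (intro sum.cong refl)
      fix k assume "k \<in> {..<j}"
      then have k: "k < j" by simp
      then have "gram_schmidt_col n ?h k i = (\<Sum>e<n. Q $$ (i, e) * gram_schmidt_col n g k e)" using less.IH[OF k] less.prems i by simp
      then show "(\<Sum>c<n. gram_schmidt_col n ?h k c * ?h (c, j)) * gram_schmidt_col n ?h k i =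
          (\<Sum>e<n. Q $$ (i, e) * ((\<Sum>c<n. gram_schmidt_col n g k c * g (c, j)) * gram_schmidt_col n g k e))"
        unfolding ip[OF k] by (simp only: sum_distrib_left[of "sum _ _"]) (intro sum.cong refl mult.left_commute)
    qed
    also have "\<dots> = (\<Sum>e<n. \<Sum>k<j. Q $$ (i, e) * ((\<Sum>c<n. gram_schmidt_col n g k c * g (c, j)) * gram_schmidt_col n g k e))"
      by (rule sum.swap)
    finally have "(\<Sum>k<j. (\<Sum>c<n. gram_schmidt_col n ?h k c * ?h (c, j)) * gram_schmidt_col n ?h k i) =
        (\<Sum>e<n. Q $$ (i, e) * (\<Sum>k<j. (\<Sum>c<n. gram_schmidt_col n g k c * g (c, j)) * gram_schmidt_col n g k e))"
      by (simp add: sum_distrib_left)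
    then show ?thesis
      unfolding gram_schmidt_residual_def h[OF i] by (simp add: sum_subtractf right_diff_distrib)
  qed
  have "(\<Sum>c<n. (gram_schmidt_residual n ?h j c)\<^sup>2) = (\<Sum>c<n. (gram_schmidt_residual n g j c)\<^sup>2)"
    using sum_orthogonal[OF Q, of "gram_schmidt_residual n g j" "gram_schmidt_residual n g j"]
    by (simp add: res power2_eq_square)
  then show ?case unfolding gram_schmidt_eq res[OF less.prems(2)] by (simp add: sum_divide_distrib)
qed

lemma gram_schmidt_orthonormal:
  assumes good: "\<And>j. j < n \<Longrightarrow> (\<Sum>c<n. (gram_schmidt_residual n g j c)\<^sup>2) \<noteq> 0"
  shows "j < n \<Longrightarrow> k \<le> j \<Longrightarrow> (\<Sum>c<n. gram_schmidt_col n g k c * gram_schmidt_col n g j c) = (if k = j then 1 else 0)"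
proof (induction j arbitrary: k rule: less_induct)
  case (less j)
  let ?s = "\<Sum>c<n. (gram_schmidt_residual n g j c)\<^sup>2"
  have s: "?s > 0" using good[OF less.prems(1)] by (simp add: less_le sum_nonneg)
  show ?case
  proof (cases "k = j")
    case True
    have "(\<Sum>c<n. gram_schmidt_col n g j c * gram_schmidt_col n g j c) = ?s / (sqrt ?s)\<^sup>2"
      unfolding gram_schmidt_eq[of n g j] by (simp add: sum_divide_distrib power2_eq_square)
    then show ?thesis using True s by simp
  next
    case False
    then have k: "k < j" using less.prems by simp
    have orth: "(\<Sum>c<n. gram_schmidt_col n g k c * gram_schmidt_col n g l c) = (if l = k then 1 else 0)" if "l < j" for l
      using less.IH[of k l] less.IH[of l k] that k less.prems
      by (cases "l \<le> k") (auto simp: mult.commute)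
    have "(\<Sum>c<n. gram_schmidt_col n g k c * gram_schmidt_residual n g j c) =
        (\<Sum>c<n. gram_schmidt_col n g k c * g (c, j)) - (\<Sum>c<n. \<Sum>l<j. (\<Sum>c<n. gram_schmidt_col n g l c * g (c, j)) * (gram_schmidt_col n g k c * gram_schmidt_col n g l c))"
      unfolding gram_schmidt_residual_def by (simp add: right_diff_distrib sum_subtractf sum_distrib_left mult_ac)
    also have "(\<Sum>c<n. \<Sum>l<j. (\<Sum>c<n. gram_schmidt_col n g l c * g (c, j)) * (gram_schmidt_col n g k c * gram_schmidt_col n g l c)) =
        (\<Sum>l<j. \<Sum>c<n. (\<Sum>c<n. gram_schmidt_col n g l c * g (c, j)) * (gram_schmidt_col n g k c * gram_schmidt_col n g l c))" by (rule sum.swap)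
    also have "\<dots> = (\<Sum>l<j. if l = k then (\<Sum>c<n. gram_schmidt_col n g k c * g (c, j)) else 0)"
      by (intro sum.cong refl) (auto simp: sum_distrib_left[symmetric] orth)
    also have "\<dots> = (\<Sum>c<n. gram_schmidt_col n g k c * g (c, j))" using k by simp
    finally have "(\<Sum>c<n. gram_schmidt_col n g k c * gram_schmidt_residual n g j c) = 0" by simp
    then have "(\<Sum>c<n. gram_schmidt_col n g k c * gram_schmidt_col n g j c) = 0"
      unfolding gram_schmidt_eq[of n g j] by (simp add: sum_divide_distrib[symmetric])
    then show ?thesis using False by simp
  qed
qed

text \<open>The factorisation into \<open>?U\<close> and the triangular \<open>?T\<close> holds even
  for vanishing residuals, and the determinant of \<open>?T\<close> is the product of the residual
  norms.\<close>

lemma gram_schmidt_residual_nonzero: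
  assumes det: "mdet n g \<noteq> 0" and j: "j < n"
  shows "(\<Sum>c<n. (gram_schmidt_residual n g j c)\<^sup>2) \<noteq> 0"
proof
  assume zero: "(\<Sum>c<n. (gram_schmidt_residual n g j c)\<^sup>2) = 0"
  let ?U = "Matrix.mat n n (\<lambda>(i, k). gram_schmidt_col n g k i)"
  let ?T = "Matrix.mat n n (\<lambda>(k, j). if k < j then \<Sum>c<n. gram_schmidt_col n g k c * g (c, j)
    else if k = j then sqrt (\<Sum>c<n. (gram_schmidt_residual n g j c)\<^sup>2) else 0)"
  have "Matrix.mat n n g = ?U * ?T"
  proof (rule eq_matI)
    fix i j assume "i < dim_row (?U * ?T)" "j < dim_col (?U * ?T)"
    then have ij: "i < n" "j < n" by auto
    let ?s = "\<Sum>c<n. (gram_schmidt_residual n g j c)\<^sup>2"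
    have res: "gram_schmidt_col n g j i * sqrt ?s = gram_schmidt_residual n g j i"
    proof (cases "?s = 0")
      case True
      then have "gram_schmidt_residual n g j i = 0" using ij by (simp add: sum_nonneg_eq_0_iff)
      with True show ?thesis by simp
    qed (simp add: gram_schmidt_eq[of n g j])
    have "(?U * ?T) $$ (i, j) = (\<Sum>k<n. gram_schmidt_col n g k i * (if k < j then \<Sum>c<n. gram_schmidt_col n g k c * g (c, j)
        else if k = j then sqrt ?s else 0))"
      using ij by (simp add: scalar_prod_def atLeast0LessThan)
    also have "\<dots> = (\<Sum>k<Suc j. gram_schmidt_col n g k i * (if k < j then \<Sum>c<n. gram_schmidt_col n g k c * g (c, j)
        else if k = j then sqrt ?s else 0))"
      using ij by (intro sum.mono_neutral_right) auto
    also have "\<dots> = (\<Sum>k<j. (\<Sum>c<n. gram_schmidt_col n g k c * g (c, j)) * gram_schmidt_col n g k i) + gram_schmidt_residual n g j i"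
      by (simp add: res mult.commute)
    also have "\<dots> = g (i, j)" by (simp add: gram_schmidt_residual_def)
    finally show "Matrix.mat n n g $$ (i, j) = (?U * ?T) $$ (i, j)" using ij by simp
  qed auto
  then have "mdet n g = Determinant.det ?U * Determinant.det ?T"
    by (simp add: det_mult[of ?U n ?T])
  also have "Determinant.det ?T = (\<Prod>i = 0..<n. ?T $$ (i, i))"
    by (subst det_upper_triangular[of _ n]) (auto simp: prod_list_diag_prod)
  also have "\<dots> = 0" using j zero by (intro prod_zero) auto
  finally show False using det by simp
qed

section \<open>Existence of normalized Haar measure\<close>

lemma space_orthogonal_borel: "space (orthogonal_borel n) = orthogonal_group n"
  by (simp add: orthogonal_borel_def)

lemma measurable_orthogonal_entry:
  assumes "i < n" "j < n"
  shows "(\<lambda>H. H $$ (i, j)) \<in> borel_measurable (orthogonal_borel n)"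
proof -
  have "(\<lambda>H. \<lambda>ij \<in> {..<n} \<times> {..<n}. H $$ ij) \<in> measurable (orthogonal_borel n) (\<Pi>\<^sub>M ij \<in> {..<n} \<times> {..<n}. (borel :: real measure))"
    unfolding orthogonal_borel_def by (rule measurable_vimage_algebra1) (auto simp: space_PiM)
  from measurable_compose[OF this measurable_component_singleton, of "(i, j)"] show ?thesis using assms by simp
qed

lemma measurable_orthogonalI:
  assumes "\<And>i j. i < n \<Longrightarrow> j < n \<Longrightarrow> (\<lambda>x. h x $$ (i, j)) \<in> borel_measurable M"
    and "\<And>x. x \<in> space M \<Longrightarrow> h x \<in> orthogonal_group n"
  shows "h \<in> measurable M (orthogonal_borel n)"
  unfolding orthogonal_borel_def
proof (rule measurable_vimage_algebra2)
  show "(\<lambda>x. \<lambda>ij \<in> {..<n} \<times> {..<n}. h x $$ ij) \<in> measurable M (\<Pi>\<^sub>M ij \<in> {..<n} \<times> {..<n}. borel)"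
    using assms(1) by (intro measurable_restrict) auto
qed (use assms(2) in auto)

definition det_nonzero :: "nat \<Rightarrow> (nat \<times> nat \<Rightarrow> real) set" where
  "det_nonzero n = {g \<in> space (gaussian ({..<n} \<times> {..<n})). mdet n g \<noteq> 0}"

lemma measurable_det_gaussian:
  "(\<lambda>g. mdet n g) \<in> borel_measurable (gaussian ({..<n} \<times> {..<n}))"
  by (intro measurable_det_mat measurable_gaussian_component) auto

lemma sets_det_nonzero: "det_nonzero n \<in> sets (gaussian ({..<n} \<times> {..<n}))"
proof -
  have "det_nonzero n = (\<lambda>g. mdet n g) -` (- {0}) \<inter> space (gaussian ({..<n} \<times> {..<n}))"
    by (auto simp: det_nonzero_def)
  also have "\<dots> \<in> sets (gaussian ({..<n} \<times> {..<n}))"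
    by (rule measurable_sets[OF measurable_det_gaussian]) auto
  finally show ?thesis .
qed

text \<open>Positive measure is what conditioning requires. If the determinant vanished almost
  everywhere, the mean of its square would be 0, against the lower bound of
  \<open>nn_integral_det_power\<close>.\<close>

lemma emeasure_det_nonzero: "emeasure (gaussian ({..<n} \<times> {..<n})) (det_nonzero n) \<noteq> 0"
proof
  let ?M = "gaussian ({..<n} \<times> {..<n})"
  assume zero: "emeasure ?M (det_nonzero n) = 0"
  \<comment> \<open>With all parts equal to 1 every exponent but the last is 0, so
    \<open>det_power\<close> is the squared determinant; for \<open>n = 0\<close> it is the empty
    product 1.\<close>
  define \<kappa> where "\<kappa> i = (if i < n then 1 else 0::nat)" for i
  have \<kappa>: "antimono \<kappa>" "\<kappa> n = 0" by (auto simp: \<kappa>_def antimono_def)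
  have "AE g in ?M. g \<notin> det_nonzero n"
    using AE_iff_measurable[OF sets_det_nonzero, of n "\<lambda>g. g \<notin> det_nonzero n"] zero
    by (auto simp: det_nonzero_def)
  then have "AE g in ?M. ennreal (det_power n \<kappa> g) = ennreal (if n = 0 then 1 else 0)"
  proof (rule AE_mp, intro AE_I2 impI)
    fix g assume "g \<in> space ?M" "g \<notin> det_nonzero n"
    then have "mdet n g = 0" by (simp add: det_nonzero_def)
    then show "ennreal (det_power n \<kappa> g) = ennreal (if n = 0 then 1 else 0)"
      by (cases n) (auto simp: det_power_def \<kappa>_def)
  qed
  then have "(\<integral>\<^sup>+g. ennreal (det_power n \<kappa> g) \<partial>?M) = (\<integral>\<^sup>+g. ennreal (if n = 0 then 1 else 0) \<partial>?M)"
    by (rule nn_integral_cong_AE)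
  also have "\<dots> = ennreal (if n = 0 then 1 else 0)" by (rule nn_integral_gaussian_const)
  finally have int: "(\<integral>\<^sup>+g. ennreal (det_power n \<kappa> g) \<partial>?M) = ennreal (if n = 0 then 1 else 0)" .
  have "n \<noteq> 0"
  proof
    assume "n = 0"
    then have "det_nonzero n = space ?M" by (auto simp: det_nonzero_def)
    then show False
      using zero prob_space.emeasure_space_1[OF prob_space_gaussian[of "{..<n} \<times> {..<n}"]] by simp
  qed
  moreover have "0 < (\<Prod>i<n. 2 ^ \<kappa> i * pochhammer (1/2) (\<kappa> i) :: real)"
    by (intro prod_pos ballI mult_pos_pos pochhammer_pos) auto
  ultimately show False
    using nn_integral_det_power[OF _ order.refl \<kappa>, of ] int by (auto simp: ennreal_eq_0_iff)
qed

lemma mat_left_mult: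
  assumes "Q \<in> carrier_mat n n"
  shows "Matrix.mat n n (left_mult n {..<n} Q g) = Q * Matrix.mat n n g"
  using assms by (intro eq_matI) (auto simp: left_mult_def scalar_prod_def atLeast0LessThan)

lemma left_mult_det_nonzero:
  assumes Q: "Q \<in> orthogonal_group n" and g: "g \<in> space (gaussian ({..<n} \<times> {..<n}))"
  shows "left_mult n {..<n} Q g \<in> det_nonzero n \<longleftrightarrow> g \<in> det_nonzero n"
proof -
  note QD = orthogonal_groupD[OF Q]
  have "Determinant.det (transpose_mat Q) * Determinant.det Q = 1"
    using QD det_mult[of "transpose_mat Q" n Q] by simp
  then have "Determinant.det Q \<noteq> 0" by auto
  moreover have "left_mult n {..<n} Q g \<in> space (gaussian ({..<n} \<times> {..<n}))"
    by (simp add: left_mult_def space_gaussian)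
  moreover have "mdet n (left_mult n {..<n} Q g) = Determinant.det Q * mdet n g"
    unfolding mat_left_mult[OF QD(1)] using QD by (intro det_mult) auto
  ultimately show ?thesis using g by (simp add: det_nonzero_def)
qed

lemma measurable_orthogonal_mult:
  assumes Q: "Q \<in> orthogonal_group n"
  shows "(\<lambda>H. Q * H) \<in> measurable (orthogonal_borel n) (orthogonal_borel n)"
proof (rule measurable_orthogonalI)
  note QD = orthogonal_groupD[OF Q]
  fix i j assume ij: "i < n" "j < n"
  have "(\<lambda>H. \<Sum>c<n. Q $$ (i, c) * H $$ (c, j)) \<in> borel_measurable (orthogonal_borel n)"
    using ij by (intro borel_measurable_sum borel_measurable_times measurable_orthogonal_entry) auto
  also have "?this \<longleftrightarrow> (\<lambda>H. (Q * H) $$ (i, j)) \<in> borel_measurable (orthogonal_borel n)"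
  proof (rule measurable_cong)
    fix H assume "H \<in> space (orthogonal_borel n)"
    then have "H \<in> carrier_mat n n" using orthogonal_groupD(1) by (auto simp: space_orthogonal_borel)
    then show "(\<Sum>c<n. Q $$ (i, c) * H $$ (c, j)) = (Q * H) $$ (i, j)"
      using QD ij by (simp add: scalar_prod_def atLeast0LessThan)
  qed
  finally show "(\<lambda>H. (Q * H) $$ (i, j)) \<in> borel_measurable (orthogonal_borel n)" .
qed (use Q orthogonal_group_mult in \<open>auto simp: space_orthogonal_borel\<close>)

text \<open>The orthogonal factor of a Gaussian matrix, conditioned on being invertible, is Haar distributed.\<close>

theorem haar_is_normalized_haar: "is_normalized_haar n (haar n)"
proof -
  let ?M = "gaussian ({..<n} \<times> {..<n})"
  define U where "U = uniform_measure ?M (det_nonzero n)"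
  \<comment> \<open>The identity as default keeps \<open>h\<close> inside the group on the null set
    of \<open>U\<close> as well.\<close>
  define h where "h g = (if g \<in> det_nonzero n then Matrix.mat n n (\<lambda>(i, j). gram_schmidt_col n g j i) else 1\<^sub>m n)" for g
  have U_sets: "sets U = sets ?M" "space U = space ?M" by (auto simp: U_def)
  have "finite_measure ?M" using prob_space_gaussian prob_space.finite_measure by blast
  then have "prob_space U"
    unfolding U_def using emeasure_det_nonzero finite_measure.emeasure_finite
    by (intro prob_space_uniform_measure) auto
  have h_mem: "h g \<in> orthogonal_group n" for g
  proof (cases "g \<in> det_nonzero n")
    case True
    then have "mdet n g \<noteq> 0" by (simp add: det_nonzero_def)
    from gram_schmidt_residual_nonzero[OF this]
    have res: "(\<Sum>c<n. (gram_schmidt_residual n g j c)\<^sup>2) \<noteq> 0" if "j < n" for j using that .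
    have on: "(\<Sum>c<n. gram_schmidt_col n g i c * gram_schmidt_col n g j c) = (if i = j then 1 else 0)" if "i < n" "j < n" for i j
      using gram_schmidt_orthonormal[of n g j i] gram_schmidt_orthonormal[of n g i j] res that
      by (cases "i \<le> j") (auto simp: mult.commute)
    show ?thesis
    proof (rule orthogonal_groupI)
      show "transpose_mat (h g) * h g = 1\<^sub>m n"
      proof (rule eq_matI)
        fix i j assume "i < dim_row (1\<^sub>m n :: real mat)" "j < dim_col (1\<^sub>m n :: real mat)"
        then show "(transpose_mat (h g) * h g) $$ (i, j) = 1\<^sub>m n $$ (i, j)"
          using True on by (subst index_gram[of _ n n]) (auto simp: h_def)
      qed (use True in \<open>auto simp: h_def\<close>)
    qed (use True in \<open>auto simp: h_def\<close>)
  qed (simp add: h_def)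
  have h_meas: "h \<in> measurable ?M (orthogonal_borel n)"
  proof (rule measurable_orthogonalI)
    fix i j assume ij: "i < n" "j < n"
    have "(\<lambda>g. if g \<in> det_nonzero n then gram_schmidt_col n g j i else 1\<^sub>m n $$ (i, j)) \<in> borel_measurable ?M"
      using ij by (intro measurable_If_set measurable_gram_schmidt_col) (auto intro: sets_det_nonzero)
    also have "(\<lambda>g. if g \<in> det_nonzero n then gram_schmidt_col n g j i else 1\<^sub>m n $$ (i, j)) = (\<lambda>g. h g $$ (i, j))"
      using ij by (auto simp: h_def)
    finally show "(\<lambda>g. h g $$ (i, j)) \<in> borel_measurable ?M" .
  qed (rule h_mem)
  have h_meas_U: "h \<in> measurable U (orthogonal_borel n)"
    using h_meas unfolding measurable_cong_sets[OF U_sets(1) refl] .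
  define \<mu> where "\<mu> = distr U (orthogonal_borel n) h"
  have "is_normalized_haar n \<mu>"
    unfolding is_normalized_haar_def
  proof (intro conjI ballI)
    show "prob_space \<mu>" unfolding \<mu>_def by (rule prob_space.prob_space_distr[OF \<open>prob_space U\<close> h_meas_U])
    show "space \<mu> = orthogonal_group n" by (simp add: \<mu>_def space_orthogonal_borel)
    show sets: "sets \<mu> = sets (orthogonal_borel n)" by (simp add: \<mu>_def)
    fix Q assume Q: "Q \<in> orthogonal_group n"
    note Qm = measurable_orthogonal_mult[OF Q]
    show "distr \<mu> \<mu> (\<lambda>H. Q * H) = \<mu>"
    proof (rule measure_eqI)
      fix A assume "A \<in> sets (distr \<mu> \<mu> (\<lambda>H. Q * H))"
      then have A: "A \<in> sets (orthogonal_borel n)" by (simp add: \<mu>_def)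
      have \<mu>_eq: "emeasure \<mu> B = (\<integral>\<^sup>+g. indicator B (h g) * indicator (det_nonzero n) g \<partial>?M) / emeasure ?M (det_nonzero n)"
        if B: "B \<in> sets (orthogonal_borel n)" for B
      proof -
        have ind: "(\<lambda>g. indicator B (h g) :: ennreal) \<in> borel_measurable ?M"
          by (rule measurable_compose[OF h_meas borel_measurable_indicator[OF B]])
        have "emeasure \<mu> B = (\<integral>\<^sup>+H. indicator B H \<partial>\<mu>)"
          using B by (intro nn_integral_indicator[symmetric]) (simp add: \<mu>_def)
        also have "\<dots> = (\<integral>\<^sup>+g. indicator B (h g) \<partial>U)"
          unfolding \<mu>_def using B by (intro nn_integral_distr[OF h_meas_U]) simp
        also have "\<dots> = (\<integral>\<^sup>+g. indicator B (h g) * indicator (det_nonzero n) g \<partial>?M) / emeasure ?M (det_nonzero n)"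
          unfolding U_def by (rule nn_integral_uniform_measure[OF ind sets_det_nonzero])
        finally show ?thesis .
      qed
      have Qm': "(\<lambda>H. Q * H) \<in> measurable \<mu> \<mu>"
        using Qm unfolding measurable_cong_sets[OF sets sets] .
      let ?B = "(\<lambda>H. Q * H) -` A \<inter> space (orthogonal_borel n)"
      let ?F = "\<lambda>g. indicator A (h g) * indicator (det_nonzero n) g :: ennreal"
      have F: "?F \<in> borel_measurable ?M"
        by (intro borel_measurable_times_ennreal measurable_compose[OF h_meas borel_measurable_indicator[OF A]]
            borel_measurable_indicator sets_det_nonzero)
      have "emeasure (distr \<mu> \<mu> (\<lambda>H. Q * H)) A = emeasure \<mu> ?B"
        using A by (subst emeasure_distr[OF Qm']) (auto simp: \<mu>_def)
      also have "\<dots> = (\<integral>\<^sup>+g. indicator ?B (h g) * indicator (det_nonzero n) g \<partial>?M) / emeasure ?M (det_nonzero n)"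
        using Qm A by (intro \<mu>_eq) auto
      also have "(\<integral>\<^sup>+g. indicator ?B (h g) * indicator (det_nonzero n) g \<partial>?M) = (\<integral>\<^sup>+g. ?F (left_mult n {..<n} Q g) \<partial>?M)"
      proof (rule nn_integral_cong)
        fix g assume g: "g \<in> space ?M"
        show "indicator ?B (h g) * indicator (det_nonzero n) g = ?F (left_mult n {..<n} Q g)"
        proof (cases "g \<in> det_nonzero n")
          case True
          \<comment> \<open>Equivariance of Gram-Schmidt turns translation by \<open>Q\<close> on
            the group into left multiplication of the Gaussian matrix, whose law is
            invariant.\<close>
          have "Q * h g = h (left_mult n {..<n} Q g)"
            using True left_mult_det_nonzero[OF Q g] orthogonal_groupD[OF Q]
            by (intro eq_matI) (auto simp: h_def gram_schmidt_left_mult[OF Q] scalar_prod_def atLeast0LessThan)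
          then show ?thesis
            using True left_mult_det_nonzero[OF Q g] h_mem[of g] by (simp add: indicator_def space_orthogonal_borel)
        next
          case False
          then show ?thesis using left_mult_det_nonzero[OF Q g] by simp
        qed
      qed
      also have "\<dots> = (\<integral>\<^sup>+g. ?F g \<partial>?M)"
        by (rule nn_integral_gaussian_left_mult[OF _ F Q]) simp
      finally show "emeasure (distr \<mu> \<mu> (\<lambda>H. Q * H)) A = emeasure \<mu> A"
        unfolding \<mu>_eq[OF A] .
    qed simp
  qed
  then show ?thesis unfolding haar_def by (rule someI)
qed

text \<open>The integrand of \<open>zonal\<close> with the product extended from the length of
  \<kappa> to the dimension; the added factors have exponent 0.\<close>

definition minor_power :: "nat \<Rightarrow> (nat \<Rightarrow> nat) \<Rightarrow> real mat \<Rightarrow> real" where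
  "minor_power n \<kappa> M = (\<Prod>j<n. leading_minor (Suc j) M ^ (\<kappa> j - \<kappa> (Suc j)))"

abbreviation diagm :: "nat \<Rightarrow> (nat \<Rightarrow> real) \<Rightarrow> real mat" where
  "diagm n e \<equiv> Matrix.mat n n (\<lambda>(i, j). if i = j then e i else 0)"

section \<open>Translation invariance of Haar measure\<close>

lemma space_haar: "space (haar n) = orthogonal_group n"
  and sets_haar: "sets (haar n) = sets (orthogonal_borel n)"
  and prob_space_haar: "prob_space (haar n)"
  and distr_haar: "Q \<in> orthogonal_group n \<Longrightarrow> distr (haar n) (haar n) (\<lambda>H. Q * H) = haar n"
  using haar_is_normalized_haar[of n] by (auto simp: is_normalized_haar_def)

lemma measurable_from_haar: "measurable (haar n) N = measurable (orthogonal_borel n) N"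
  by (rule measurable_cong_sets[OF sets_haar refl])

lemma measurable_to_haar: "measurable N (haar n) = measurable N (orthogonal_borel n)"
  by (rule measurable_cong_sets[OF refl sets_haar])

lemma measurable_haar_mult:
  assumes "Q \<in> orthogonal_group n"
  shows "(\<lambda>H. Q * H) \<in> measurable (haar n) (haar n)"
  using measurable_orthogonal_mult[OF assms] unfolding measurable_from_haar measurable_to_haar .

lemma measurable_haar_entry:
  assumes "i < n" "j < n" shows "(\<lambda>H. H $$ (i, j)) \<in> borel_measurable (haar n)"
  unfolding measurable_from_haar by (rule measurable_orthogonal_entry[OF assms])

lemma measurable_haarI:
  assumes "\<And>i j. i < n \<Longrightarrow> j < n \<Longrightarrow> (\<lambda>x. h x $$ (i, j)) \<in> borel_measurable M"
    and "\<And>x. x \<in> space M \<Longrightarrow> h x \<in> orthogonal_group n"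
  shows "h \<in> measurable M (haar n)"
  unfolding measurable_to_haar by (rule measurable_orthogonalI[OF assms])

lemma nn_integral_haar_left:
  assumes "f \<in> borel_measurable (haar n)" "Q \<in> orthogonal_group n"
  shows "(\<integral>\<^sup>+H. f (Q * H) \<partial>haar n) = (\<integral>\<^sup>+H. f H \<partial>haar n)"
  using nn_integral_distr[OF measurable_haar_mult[OF assms(2)], of f] assms(1)
  unfolding distr_haar[OF assms(2)] by simp

lemma integral_haar_left:
  fixes f :: "real mat \<Rightarrow> real"
  assumes "f \<in> borel_measurable (haar n)" "Q \<in> orthogonal_group n"
  shows "(\<integral>H. f (Q * H) \<partial>haar n) = (\<integral>H. f H \<partial>haar n)"
  using integral_distr[OF measurable_haar_mult[OF assms(2)], of f] assms(1)
  unfolding distr_haar[OF assms(2)] by simp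

lemma nn_integral_haar_const: "(\<integral>\<^sup>+H. c \<partial>haar n) = c"
  using prob_space.emeasure_space_1[OF prob_space_haar[of n]] by simp

lemma measurable_haar_transpose: "transpose_mat \<in> measurable (haar n) (haar n)"
proof (rule measurable_haarI)
  fix i j assume ij: "i < n" "j < n"
  have "(\<lambda>H. H $$ (j, i)) \<in> borel_measurable (haar n)" using ij by (intro measurable_haar_entry)
  also have "?this \<longleftrightarrow> (\<lambda>H. transpose_mat H $$ (i, j)) \<in> borel_measurable (haar n)"
    using ij orthogonal_groupD(4,5) by (intro measurable_cong) (auto simp: space_haar)
  finally show "(\<lambda>H. transpose_mat H $$ (i, j)) \<in> borel_measurable (haar n)" .
qed (auto simp: space_haar orthogonal_group_transpose)

text \<open>Left invariance and Fubini give invariance under inversion, hence under right translation.\<close>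

lemma nn_integral_haar_transpose:
  assumes f: "f \<in> borel_measurable (haar n)"
  shows "(\<integral>\<^sup>+H. f (transpose_mat H) \<partial>haar n) = (\<integral>\<^sup>+H. f H \<partial>haar n)"
proof -
  interpret pair_prob_space "haar n" "haar n"
    by (intro pair_prob_space.intro pair_sigma_finite.intro prob_space_haar
        prob_space_imp_sigma_finite)
  have m: "(\<lambda>(K, H). transpose_mat K * H) \<in> measurable (haar n \<Otimes>\<^sub>M haar n) (haar n)"
  proof (rule measurable_haarI)
    fix i j assume ij: "i < n" "j < n"
    have "(\<lambda>KH. \<Sum>c<n. fst KH $$ (c, i) * snd KH $$ (c, j)) \<in> borel_measurable (haar n \<Otimes>\<^sub>M haar n)"
      using ij by (intro borel_measurable_sum borel_measurable_times
        measurable_compose[OF measurable_fst measurable_haar_entry] measurable_compose[OF measurable_snd measurable_haar_entry]) auto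
    also have "?this \<longleftrightarrow> (\<lambda>KH. (case KH of (K, H) \<Rightarrow> transpose_mat K * H) $$ (i, j)) \<in> borel_measurable (haar n \<Otimes>\<^sub>M haar n)"
    proof (rule measurable_cong)
      fix KH assume "KH \<in> space (haar n \<Otimes>\<^sub>M haar n)"
      then have "fst KH \<in> orthogonal_group n" "snd KH \<in> orthogonal_group n" by (auto simp: space_pair_measure space_haar)
      then show "(\<Sum>c<n. fst KH $$ (c, i) * snd KH $$ (c, j)) = (case KH of (K, H) \<Rightarrow> transpose_mat K * H) $$ (i, j)"
        using ij orthogonal_groupD(4,5) by (cases KH) (auto simp: scalar_prod_def atLeast0LessThan)
    qed
    finally show "(\<lambda>KH. (case KH of (K, H) \<Rightarrow> transpose_mat K * H) $$ (i, j)) \<in> borel_measurable (haar n \<Otimes>\<^sub>M haar n)" .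
  qed (auto simp: space_pair_measure space_haar intro: orthogonal_group_mult orthogonal_group_transpose)
  have f2: "(\<lambda>(K, H). f (transpose_mat K * H)) \<in> borel_measurable (haar n \<Otimes>\<^sub>M haar n)"
    using measurable_compose[OF m f] by (simp add: case_prod_beta')
  have ft: "(\<lambda>H. f (transpose_mat H)) \<in> borel_measurable (haar n)"
    by (rule measurable_compose[OF measurable_haar_transpose f])
  have "(\<integral>\<^sup>+H. f H \<partial>haar n) = (\<integral>\<^sup>+K. (\<integral>\<^sup>+H. f H \<partial>haar n) \<partial>haar n)"
    by (simp only: nn_integral_haar_const)
  also have "\<dots> = (\<integral>\<^sup>+K. (\<integral>\<^sup>+H. f (transpose_mat K * H) \<partial>haar n) \<partial>haar n)"
    by (rule nn_integral_cong, rule nn_integral_haar_left[symmetric, OF f])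
       (simp add: space_haar orthogonal_group_transpose)
  also have "\<dots> = (\<integral>\<^sup>+H. (\<integral>\<^sup>+K. f (transpose_mat K * H) \<partial>haar n) \<partial>haar n)"
    using Fubini'[OF f2] by simp
  \<comment> \<open>K'H is the transpose of H'K, so the inner integral over K is again that of a
    left translate.\<close>
  also have "\<dots> = (\<integral>\<^sup>+H. (\<integral>\<^sup>+K. f (transpose_mat (transpose_mat H * K)) \<partial>haar n) \<partial>haar n)"
  proof (intro nn_integral_cong)
    fix H K assume "H \<in> space (haar n)" "K \<in> space (haar n)"
    then have "H \<in> carrier_mat n n" "K \<in> carrier_mat n n" using orthogonal_groupD(1) by (auto simp: space_haar)
    then show "f (transpose_mat K * H) = f (transpose_mat (transpose_mat H * K))"
      by (simp add: transpose_mult[of "transpose_mat H" n n K n])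
  qed
  also have "\<dots> = (\<integral>\<^sup>+H. (\<integral>\<^sup>+K. f (transpose_mat K) \<partial>haar n) \<partial>haar n)"
    by (rule nn_integral_cong, rule nn_integral_haar_left[OF ft])
       (simp add: space_haar orthogonal_group_transpose)
  finally show ?thesis by (simp only: nn_integral_haar_const)
qed

text \<open>Right translation is left translation conjugated by transposition.\<close>

lemma nn_integral_haar_right:
  assumes f: "f \<in> borel_measurable (haar n)" and Q: "Q \<in> orthogonal_group n"
  shows "(\<integral>\<^sup>+H. f (H * Q) \<partial>haar n) = (\<integral>\<^sup>+H. f H \<partial>haar n)"
proof -
  let ?Q = "transpose_mat Q"
  have Q': "?Q \<in> orthogonal_group n" by (rule orthogonal_group_transpose[OF Q])
  have ft: "(\<lambda>H. f (transpose_mat H)) \<in> borel_measurable (haar n)"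
    by (rule measurable_compose[OF measurable_haar_transpose f])
  have eq: "transpose_mat (?Q * transpose_mat H) = H * Q" if "H \<in> space (haar n)" for H
  proof -
    have "H \<in> carrier_mat n n" using that orthogonal_groupD(1) by (simp add: space_haar)
    then show ?thesis using orthogonal_groupD(1)[OF Q] by (simp add: transpose_mult[of ?Q n n _ n])
  qed
  have "(\<integral>\<^sup>+H. f (H * Q) \<partial>haar n) = (\<integral>\<^sup>+H. f (transpose_mat (?Q * transpose_mat H)) \<partial>haar n)"
    by (rule nn_integral_cong) (simp add: eq)
  also have "\<dots> = (\<integral>\<^sup>+H. f (transpose_mat (?Q * H)) \<partial>haar n)"
    by (rule nn_integral_haar_transpose[where f="\<lambda>H. f (transpose_mat (?Q * H))"])
       (rule measurable_compose[OF measurable_haar_mult[OF Q'] ft])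
  also have "\<dots> = (\<integral>\<^sup>+H. f (transpose_mat H) \<partial>haar n)"
    by (rule nn_integral_haar_left[OF ft Q'])
  also have "\<dots> = (\<integral>\<^sup>+H. f H \<partial>haar n)" by (rule nn_integral_haar_transpose[OF f])
  finally show ?thesis .
qed

section \<open>Weighted Gram matrices: from Gaussian to Haar averages\<close>

definition wgram :: "nat \<Rightarrow> (nat \<Rightarrow> real) \<Rightarrow> (nat \<times> nat \<Rightarrow> real) \<Rightarrow> nat \<Rightarrow> nat \<Rightarrow> real" where
  "wgram n e g a b = (\<Sum>r<n. e r * g (r, a) * g (r, b))"

text \<open>f(G' diag(e) G) as a function of the entries, so that both Gaussian arrays and
  orthogonal matrices can be inserted for G.\<close>

definition wgram_power :: "nat \<Rightarrow> (nat \<Rightarrow> nat) \<Rightarrow> (nat \<Rightarrow> real) \<Rightarrow> (nat \<times> nat \<Rightarrow> real) \<Rightarrow> real" where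
  "wgram_power n \<kappa> e g =
    (\<Prod>j<n. mdet (Suc j) (case_prod (wgram n e g)) ^ (\<kappa> j - \<kappa> (Suc j)))"

lemma det_wgram_mono:
  assumes "\<And>r. r < n \<Longrightarrow> 0 \<le> e r" "\<And>r. r < n \<Longrightarrow> e r \<le> f r"
  shows "0 \<le> mdet j (case_prod (wgram n e g))"
    "mdet j (case_prod (wgram n e g)) \<le> mdet j (case_prod (wgram n f g))"
  using det_weighted_gram_mono[of n e f j "\<lambda>r a. g (r, a)", OF assms]
  by (simp_all add: wgram_def[abs_def])

lemma wgram_power_nonneg: "(\<And>r. r < n \<Longrightarrow> 0 \<le> e r) \<Longrightarrow> 0 \<le> wgram_power n \<kappa> e g"
  unfolding wgram_power_def by (intro prod_nonneg ballI zero_le_power det_wgram_mono(1)[of n e e]) auto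

lemma measurable_wgram_power:
  assumes "\<And>i j. i < n \<Longrightarrow> j < n \<Longrightarrow> (\<lambda>x. h x (i, j)) \<in> borel_measurable M"
  shows "(\<lambda>x. wgram_power n \<kappa> e (h x)) \<in> borel_measurable M"
proof -
  have "(\<lambda>x. mdet (Suc j) (case_prod (wgram n e (h x)))) \<in> borel_measurable M" if "j < n" for j
  proof (rule measurable_det_mat)
    fix a b assume ab: "a < Suc j" "b < Suc j"
    have "(\<lambda>x. \<Sum>r<n. e r * h x (r, a) * h x (r, b)) \<in> borel_measurable M"
      using ab that by (intro borel_measurable_sum borel_measurable_times assms) auto
    then show "(\<lambda>x. case_prod (wgram n e (h x)) (a, b)) \<in> borel_measurable M" by (simp add: wgram_def)
  qed
  then show ?thesis unfolding wgram_power_def by (intro borel_measurable_prod borel_measurable_power) auto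
qed

lemma index_diag_congruence:
  assumes "G \<in> carrier_mat n n" "a < n" "b < n"
  shows "(transpose_mat G * diagm n e * G) $$ (a, b) = wgram n e (\<lambda>ij. G $$ ij) a b"
proof -
  have "(transpose_mat G * diagm n e * G) $$ (a, b) = (\<Sum>c<n. \<Sum>f<n. G $$ (c, a) * diagm n e $$ (c, f) * G $$ (f, b))"
    using assms by (intro index_congruence) auto
  also have "\<dots> = (\<Sum>c<n. G $$ (c, a) * diagm n e $$ (c, c) * G $$ (c, b))"
    by (intro sum.cong refl sum_lessThan_single) auto
  also have "\<dots> = wgram n e (\<lambda>ij. G $$ ij) a b"
    unfolding wgram_def by (intro sum.cong refl) auto
  finally show ?thesis .
qed

lemma minor_power_diag:
  assumes "G \<in> carrier_mat n n"
  shows "minor_power n \<kappa> (transpose_mat G * diagm n e * G) = wgram_power n \<kappa> e (\<lambda>ij. G $$ ij)"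
proof -
  have "leading_minor (Suc j) (transpose_mat G * diagm n e * G) =
      mdet (Suc j) (case_prod (wgram n e (\<lambda>ij. G $$ ij)))" if "j < n" for j
    unfolding leading_minor_def using that
    by (intro det_mat_cong) (auto simp: index_diag_congruence[OF assms])
  then show ?thesis unfolding minor_power_def wgram_power_def by simp
qed

lemma wgram_power_cong:
  assumes "\<And>i j. i < n \<Longrightarrow> j < n \<Longrightarrow> g (i, j) = h (i, j)"
  shows "wgram_power n \<kappa> e g = wgram_power n \<kappa> e h"
proof -
  have "mdet (Suc j) (case_prod (wgram n e g)) =
      mdet (Suc j) (case_prod (wgram n e h))" if "j < n" for j
    using assms that by (intro det_mat_cong) (auto simp: wgram_def intro!: sum.cong)
  then show ?thesis unfolding wgram_power_def by simp
qed

lemma gram_power_eq_wgram_power: "gram_power n \<kappa> g = wgram_power n \<kappa> (\<lambda>_. 1) g"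
  by (simp add: gram_power_def wgram_power_def gram_def[abs_def] wgram_def[abs_def])

lemma minor_power_gram:
  assumes "G \<in> carrier_mat n n"
  shows "minor_power n \<kappa> (transpose_mat G * G) = gram_power n \<kappa> (\<lambda>ij. G $$ ij)"
proof -
  have "diagm n (\<lambda>_. 1) = 1\<^sub>m n" by (rule eq_matI) auto
  then show ?thesis
    using minor_power_diag[OF assms, of \<kappa> "\<lambda>_. 1"] assms by (simp add: gram_power_eq_wgram_power)
qed

text \<open>A triangular congruence multiplies each minor by the square of a diagonal product, which
  is the corresponding minor of T'T. So f is multiplicative and the factor depends on the Gram
  matrix alone.\<close>

lemma minor_power_upper_congruence:
  assumes T: "T \<in> carrier_mat n n" and M: "M \<in> carrier_mat n n"
    and up: "\<And>a c. c < n \<Longrightarrow> a < c \<Longrightarrow> T $$ (c, a) = 0"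
  shows "minor_power n \<kappa> (transpose_mat T * M * T) = minor_power n \<kappa> (transpose_mat T * T) * minor_power n \<kappa> M"
proof -
  have "leading_minor (Suc j) (transpose_mat T * M * T) = leading_minor (Suc j) (transpose_mat T * T) * leading_minor (Suc j) M"
    if j: "j < n" for j
  proof -
    have "leading_minor (Suc j) (1\<^sub>m n) = (1 :: real)"
    proof -
      have "Matrix.mat (Suc j) (Suc j) (\<lambda>ij. 1\<^sub>m n $$ ij) = (1\<^sub>m (Suc j) :: real mat)"
        using j by (intro eq_matI) auto
      then show ?thesis by (simp only: leading_minor_def det_one)
    qed
    then have "leading_minor (Suc j) (transpose_mat T * T) = (\<Prod>i<Suc j. T $$ (i, i))\<^sup>2"
      using leading_minor_upper_congruence[OF T one_carrier_mat up, of "Suc j"] T j by simp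
    then show ?thesis
      using leading_minor_upper_congruence[OF T M up, of "Suc j"] j by simp
  qed
  then show ?thesis unfolding minor_power_def by (simp add: power_mult_distrib prod.distrib)
qed

text \<open>Write G = R'T with T upper triangular. Then H G = (H R') T, the triangular factor comes
  out as f(T'T) = f(G'G), and right invariance absorbs R'.\<close>

lemma nn_integral_haar_congruence:
  assumes e: "\<And>r. r < n \<Longrightarrow> 0 \<le> e r" and G: "G \<in> carrier_mat n n"
  shows "(\<integral>\<^sup>+H. ennreal (wgram_power n \<kappa> e (\<lambda>ij. (H * G) $$ ij)) \<partial>haar n) =
    ennreal (gram_power n \<kappa> (\<lambda>ij. G $$ ij)) * (\<integral>\<^sup>+H. ennreal (wgram_power n \<kappa> e (\<lambda>ij. H $$ ij)) \<partial>haar n)"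
proof -
  obtain R where R: "R \<in> reflection_products n"
    and T_up: "\<And>i j. i < n \<Longrightarrow> j < i \<Longrightarrow> (R * G) $$ (i, j) = 0"
    using QR_decomposition[OF G] by metis
  have RO: "R \<in> orthogonal_group n" by (rule reflection_products_orthogonal[OF R])
  note RC = orthogonal_groupD[OF RO]
  define T where "T = R * G"
  have T: "T \<in> carrier_mat n n" using RC G by (simp add: T_def)
  note assoc = assoc_mult_mat[of _ n n _ n _ n]
  have G_eq: "G = transpose_mat R * T"
  proof -
    have "transpose_mat R * T = (transpose_mat R * R) * G" using RC(1) G by (simp add: T_def assoc)
    then show ?thesis using RC G by simp
  qed
  have gram: "minor_power n \<kappa> (transpose_mat T * T) = gram_power n \<kappa> (\<lambda>ij. G $$ ij)"
  proof -
    have "transpose_mat T * T = transpose_mat G * (transpose_mat R * (R * G))"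
      using RC G by (simp add: T_def transpose_mult[of R n n G n] assoc)
    also have "transpose_mat R * (R * G) = G" using RC(1,2) G by (simp flip: assoc)
    finally show ?thesis using minor_power_gram[OF G] by simp
  qed
  have meas: "(\<lambda>H. ennreal (wgram_power n \<kappa> e (\<lambda>ij. H $$ ij))) \<in> borel_measurable (haar n)"
    by (intro measurable_compose[OF _ measurable_ennreal] measurable_wgram_power measurable_haar_entry)
  have pt: "ennreal (wgram_power n \<kappa> e (\<lambda>ij. (H * G) $$ ij)) =
      ennreal (gram_power n \<kappa> (\<lambda>ij. G $$ ij)) * ennreal (wgram_power n \<kappa> e (\<lambda>ij. (H * transpose_mat R) $$ ij))"
    if "H \<in> space (haar n)" for H
  proof -
    have H: "H \<in> carrier_mat n n" using that orthogonal_groupD(1) by (simp add: space_haar)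
    define K where "K = H * transpose_mat R"
    have K: "K \<in> carrier_mat n n" using H RC by (simp add: K_def)
    have HG: "H * G = K * T" using H RC T by (simp add: G_eq K_def assoc)
    have "wgram_power n \<kappa> e (\<lambda>ij. (H * G) $$ ij) = minor_power n \<kappa> (transpose_mat (K * T) * diagm n e * (K * T))"
      unfolding HG using K T by (subst minor_power_diag) auto
    also have "transpose_mat (K * T) * diagm n e * (K * T) = transpose_mat T * (transpose_mat K * diagm n e * K) * T"
    proof -
      define D where "D = diagm n e"
      define X where "X = transpose_mat K * D * K"
      have D: "D \<in> carrier_mat n n" by (simp add: D_def)
      then have X: "X \<in> carrier_mat n n" using K by (simp add: X_def)
      have "transpose_mat (K * T) * D * (K * T) = transpose_mat T * (X * T)"
        using K T D by (simp add: X_def transpose_mult[of K n n T n] assoc)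
      also have "\<dots> = transpose_mat T * X * T" using X T by (simp add: assoc)
      finally show ?thesis by (simp only: X_def D_def)
    qed
    also have "minor_power n \<kappa> \<dots> = minor_power n \<kappa> (transpose_mat T * T) * minor_power n \<kappa> (transpose_mat K * diagm n e * K)"
      using K T T_up by (intro minor_power_upper_congruence) (auto simp: T_def)
    also have "\<dots> = gram_power n \<kappa> (\<lambda>ij. G $$ ij) * wgram_power n \<kappa> e (\<lambda>ij. K $$ ij)"
      unfolding gram minor_power_diag[OF K] ..
    finally show ?thesis
      by (simp add: K_def ennreal_mult gram_power_nonneg wgram_power_nonneg[OF e])
  qed
  have "(\<integral>\<^sup>+H. ennreal (wgram_power n \<kappa> e (\<lambda>ij. (H * G) $$ ij)) \<partial>haar n) =
      (\<integral>\<^sup>+H. ennreal (gram_power n \<kappa> (\<lambda>ij. G $$ ij)) * ennreal (wgram_power n \<kappa> e (\<lambda>ij. (H * transpose_mat R) $$ ij)) \<partial>haar n)"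
    by (rule nn_integral_cong) (rule pt)
  also have "\<dots> = (\<integral>\<^sup>+H. ennreal (gram_power n \<kappa> (\<lambda>ij. G $$ ij)) * ennreal (wgram_power n \<kappa> e (\<lambda>ij. H $$ ij)) \<partial>haar n)"
    by (rule nn_integral_haar_right[where f="\<lambda>H. ennreal (gram_power n \<kappa> (\<lambda>ij. G $$ ij)) * ennreal (wgram_power n \<kappa> e (\<lambda>ij. H $$ ij))"])
       (intro borel_measurable_times_ennreal borel_measurable_const meas, rule orthogonal_group_transpose[OF RO])
  also have "\<dots> = ennreal (gram_power n \<kappa> (\<lambda>ij. G $$ ij)) * (\<integral>\<^sup>+H. ennreal (wgram_power n \<kappa> e (\<lambda>ij. H $$ ij)) \<partial>haar n)"
    by (rule nn_integral_cmult[OF meas])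
  finally show ?thesis .
qed

text \<open>Replacing \<open>G\<close> by \<open>H G\<close> does not change the Gaussian average; then integrate over \<open>H\<close> first.\<close>

theorem nn_integral_gaussian_wgram_power:
  assumes e: "\<And>r. r < n \<Longrightarrow> 0 \<le> e r"
  shows "(\<integral>\<^sup>+g. ennreal (wgram_power n \<kappa> e g) \<partial>gaussian ({..<n} \<times> {..<n})) =
    (\<integral>\<^sup>+g. ennreal (gram_power n \<kappa> g) \<partial>gaussian ({..<n} \<times> {..<n})) *
    (\<integral>\<^sup>+H. ennreal (wgram_power n \<kappa> e (\<lambda>ij. H $$ ij)) \<partial>haar n)"
proof -
  let ?M = "gaussian ({..<n} \<times> {..<n})"
  interpret pair_prob_space "haar n" ?M
    by (intro pair_prob_space.intro pair_sigma_finite.intro prob_space_haar prob_space_gaussian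
        prob_space_imp_sigma_finite)
  let ?w = "\<lambda>g. ennreal (wgram_power n \<kappa> e g)"
  have w: "?w \<in> borel_measurable ?M"
    by (intro measurable_compose[OF _ measurable_ennreal] measurable_wgram_power measurable_gaussian_component) auto
  have joint: "(\<lambda>(H, g). ?w (left_mult n {..<n} H g)) \<in> borel_measurable (haar n \<Otimes>\<^sub>M ?M)"
    unfolding case_prod_beta'
  proof (intro measurable_compose[OF _ measurable_ennreal] measurable_wgram_power)
    fix i j assume ij: "i < n" "j < n"
    have "(\<lambda>x. \<Sum>c<n. fst x $$ (i, c) * snd x (c, j)) \<in> borel_measurable (haar n \<Otimes>\<^sub>M ?M)"
      using ij by (intro borel_measurable_sum borel_measurable_times
        measurable_compose[OF measurable_fst measurable_haar_entry] measurable_compose[OF measurable_snd measurable_gaussian_component]) auto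
    then show "(\<lambda>x. left_mult n {..<n} (fst x) (snd x) (i, j)) \<in> borel_measurable (haar n \<Otimes>\<^sub>M ?M)"
      using ij by (simp add: left_mult_def)
  qed
  have "(\<integral>\<^sup>+g. ?w g \<partial>?M) = (\<integral>\<^sup>+H. (\<integral>\<^sup>+g. ?w g \<partial>?M) \<partial>haar n)"
    by (simp only: nn_integral_haar_const)
  also have "\<dots> = (\<integral>\<^sup>+H. (\<integral>\<^sup>+g. ?w (left_mult n {..<n} H g) \<partial>?M) \<partial>haar n)"
    by (rule nn_integral_cong, rule nn_integral_gaussian_left_mult[symmetric, OF _ w]) (auto simp: space_haar)
  also have "\<dots> = (\<integral>\<^sup>+g. (\<integral>\<^sup>+H. ?w (left_mult n {..<n} H g) \<partial>haar n) \<partial>?M)"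
    using Fubini'[OF joint] by simp
  also have "\<dots> = (\<integral>\<^sup>+g. ennreal (gram_power n \<kappa> g) * (\<integral>\<^sup>+H. ?w (\<lambda>ij. H $$ ij) \<partial>haar n) \<partial>?M)"
  proof (rule nn_integral_cong)
    fix g :: "nat \<times> nat \<Rightarrow> real"
    let ?G = "Matrix.mat n n g"
    have "(\<integral>\<^sup>+H. ?w (left_mult n {..<n} H g) \<partial>haar n) = (\<integral>\<^sup>+H. ?w (\<lambda>ij. (H * ?G) $$ ij) \<partial>haar n)"
    proof (intro nn_integral_cong arg_cong[where f=ennreal] wgram_power_cong)
      fix H i j assume H: "H \<in> space (haar n)" and ij: "i < n" "j < n"
      have "H \<in> carrier_mat n n" using H orthogonal_groupD(1) by (simp add: space_haar)
      from mat_left_mult[OF this, of g, symmetric]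
      show "left_mult n {..<n} H g (i, j) = (H * ?G) $$ (i, j)" using ij by simp
    qed
    also have "\<dots> = ennreal (gram_power n \<kappa> (\<lambda>ij. ?G $$ ij)) * (\<integral>\<^sup>+H. ?w (\<lambda>ij. H $$ ij) \<partial>haar n)"
      by (rule nn_integral_haar_congruence[OF e]) auto
    also have "gram_power n \<kappa> (\<lambda>ij. ?G $$ ij) = gram_power n \<kappa> g"
      unfolding gram_power_eq_wgram_power by (rule wgram_power_cong) simp
    finally show "(\<integral>\<^sup>+H. ?w (left_mult n {..<n} H g) \<partial>haar n) =
        ennreal (gram_power n \<kappa> g) * (\<integral>\<^sup>+H. ?w (\<lambda>ij. H $$ ij) \<partial>haar n)" .
  qed
  also have "\<dots> = (\<integral>\<^sup>+g. ennreal (gram_power n \<kappa> g) \<partial>?M) * (\<integral>\<^sup>+H. ?w (\<lambda>ij. H $$ ij) \<partial>haar n)"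
    by (rule nn_integral_multc[OF measurable_compose[OF measurable_gram_power measurable_ennreal]]) auto
  finally show ?thesis .
qed

section \<open>Spherical means of products of minors\<close>

text \<open>Abel summation in multiplicative form; the last factor on the left is the boundary term
  and becomes 1 when \<open>\<kappa> n = 0\<close>.\<close>

lemma prod_part_differences:
  fixes \<kappa> :: "nat \<Rightarrow> nat" and e :: "nat \<Rightarrow> real"
  assumes "antimono \<kappa>"
  shows "(\<Prod>j<n. (\<Prod>r<Suc j. e r) ^ (\<kappa> j - \<kappa> (Suc j))) * (\<Prod>r<n. e r) ^ \<kappa> n = (\<Prod>r<n. e r ^ \<kappa> r)"
proof (induction n)
  case (Suc n)
  have "\<kappa> (Suc n) \<le> \<kappa> n" using antimonoD[OF assms] by simp
  then have "(\<Prod>r<Suc n. e r) ^ (\<kappa> n - \<kappa> (Suc n)) * (\<Prod>r<Suc n. e r) ^ \<kappa> (Suc n) = (\<Prod>r<Suc n. e r) ^ \<kappa> n"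
    by (simp only: power_add[symmetric]) simp
  then have "(\<Prod>j<Suc n. (\<Prod>r<Suc j. e r) ^ (\<kappa> j - \<kappa> (Suc j))) * (\<Prod>r<Suc n. e r) ^ \<kappa> (Suc n) =
      (\<Prod>j<n. (\<Prod>r<Suc j. e r) ^ (\<kappa> j - \<kappa> (Suc j))) * (\<Prod>r<Suc n. e r) ^ \<kappa> n"
    by (simp only: prod.lessThan_Suc[of "\<lambda>j. (\<Prod>r<Suc j. e r) ^ (\<kappa> j - \<kappa> (Suc j))"] mult.assoc)
  also have "\<dots> = ((\<Prod>j<n. (\<Prod>r<Suc j. e r) ^ (\<kappa> j - \<kappa> (Suc j))) * (\<Prod>r<n. e r) ^ \<kappa> n) * e n ^ \<kappa> n"
    by (simp only: prod.lessThan_Suc[of e] power_mult_distrib mult.assoc)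
  finally show ?case unfolding Suc.IH by simp
qed simp

text \<open>The common frame of both lower bounds: \<open>D j\<close> is a minor free of the
  weights, \<open>f\<close> consists of the weights taken out of it, and the products of the
  \<open>f r\<close> telescope.\<close>

lemma wgram_power_ge:
  assumes e: "\<And>r. r < n \<Longrightarrow> 0 \<le> e r"
    and \<kappa>: "antimono \<kappa>" "\<kappa> q = 0" and q: "q \<le> n"
    and le: "\<And>j. j < q \<Longrightarrow> 0 \<le> D j"
      "\<And>j. j < q \<Longrightarrow> (\<Prod>r<Suc j. f r) * D j \<le> mdet (Suc j) (case_prod (wgram n e g))"
    and f: "\<And>r. r < q \<Longrightarrow> 0 \<le> f r"
  shows "(\<Prod>r<q. f r ^ \<kappa> r) * (\<Prod>j<q. D j ^ (\<kappa> j - \<kappa> (Suc j))) \<le> wgram_power n \<kappa> e g"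
proof -
  have zero: "\<kappa> j = 0" if "q \<le> j" for j using antimonoD[OF \<kappa>(1) that] \<kappa>(2) by simp
  have "(\<Prod>r<q. f r ^ \<kappa> r) * (\<Prod>j<q. D j ^ (\<kappa> j - \<kappa> (Suc j))) =
      (\<Prod>j<q. ((\<Prod>r<Suc j. f r) * D j) ^ (\<kappa> j - \<kappa> (Suc j)))"
    unfolding prod_part_differences[OF \<kappa>(1), symmetric] \<kappa>(2) by (simp only: power_0 mult_1_right power_mult_distrib prod.distrib)
  also have "\<dots> \<le> (\<Prod>j<q. mdet (Suc j) (case_prod (wgram n e g)) ^ (\<kappa> j - \<kappa> (Suc j)))"
  proof (intro prod_mono conjI zero_le_power power_mono)
    fix j assume j: "j \<in> {..<q}"
    show "0 \<le> (\<Prod>r<Suc j. f r) * D j" using j f le(1) by (intro mult_nonneg_nonneg prod_nonneg) auto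
    show "(\<Prod>r<Suc j. f r) * D j \<le> mdet (Suc j) (case_prod (wgram n e g))"
      using j le(2) by simp
    show "0 \<le> (\<Prod>r<Suc j. f r) * D j" using j f le(1) by (intro mult_nonneg_nonneg prod_nonneg) auto
  qed
  also have "\<dots> = wgram_power n \<kappa> e g"
    unfolding wgram_power_def using q by (intro prod.mono_neutral_left) (auto simp: zero)
  finally show ?thesis .
qed

lemma wgram_power_ge_det_power:
  assumes e: "\<And>r. r < n \<Longrightarrow> 0 \<le> e r" and \<kappa>: "antimono \<kappa>" "\<kappa> n = 0"
  shows "(\<Prod>r<n. e r ^ \<kappa> r) * det_power n \<kappa> g \<le> wgram_power n \<kappa> e g"
proof -
  have "(\<Prod>r<n. e r ^ \<kappa> r) * (\<Prod>j<n. ((mdet (Suc j) g)\<^sup>2) ^ (\<kappa> j - \<kappa> (Suc j))) \<le> wgram_power n \<kappa> e g"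
  proof (rule wgram_power_ge[OF e \<kappa> order.refl])
    fix j assume j: "j < n"
    let ?G = "Matrix.mat (Suc j) (Suc j) g"
    \<comment> \<open>Zero weights from row \<open>Suc j\<close> on leave a square block, whose
      determinant factors; monotonicity in the weights compares it with the full minor.\<close>
    define f where "f r = (if r < Suc j then e r else 0)" for r
    have "Matrix.mat (Suc j) (Suc j) (case_prod (wgram n f g)) = transpose_mat ?G * diagm (Suc j) e * ?G"
    proof (rule eq_matI)
      fix a b assume "a < dim_row (transpose_mat ?G * diagm (Suc j) e * ?G)" "b < dim_col (transpose_mat ?G * diagm (Suc j) e * ?G)"
      then have ab: "a < Suc j" "b < Suc j" by auto
      have "wgram n f g a b = (\<Sum>r<Suc j. f r * g (r, a) * g (r, b))"
        unfolding wgram_def using j by (intro sum.mono_neutral_right) (auto simp: f_def)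
      also have "\<dots> = wgram (Suc j) e (\<lambda>ij. ?G $$ ij) a b"
        unfolding wgram_def using ab by (intro sum.cong refl) (auto simp: f_def)
      also have "\<dots> = (transpose_mat ?G * diagm (Suc j) e * ?G) $$ (a, b)"
        using ab by (subst index_diag_congruence) auto
      finally show "Matrix.mat (Suc j) (Suc j) (case_prod (wgram n f g)) $$ (a, b) = (transpose_mat ?G * diagm (Suc j) e * ?G) $$ (a, b)"
        using ab by simp
    qed auto
    then have "mdet (Suc j) (case_prod (wgram n f g)) = (Determinant.det ?G)\<^sup>2 * Determinant.det (diagm (Suc j) e)"
      by (simp only:) (rule det_congruence, auto)
    also have "Determinant.det (diagm (Suc j) e) = (\<Prod>r<Suc j. e r)"
      by (subst det_upper_triangular[of _ "Suc j"]) (auto simp: prod_list_diag_prod atLeast0LessThan intro!: prod.cong)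
    finally have "(\<Prod>r<Suc j. e r) * (Determinant.det ?G)\<^sup>2 = mdet (Suc j) (case_prod (wgram n f g))"
      by (simp only: mult.commute)
    also have "\<dots> \<le> mdet (Suc j) (case_prod (wgram n e g))"
      using e by (intro det_wgram_mono) (auto simp: f_def)
    finally show "(\<Prod>r<Suc j. e r) * (Determinant.det ?G)\<^sup>2 \<le> mdet (Suc j) (case_prod (wgram n e g))" .
  qed (use e in auto)
  then show ?thesis by (simp only: det_power_def power_mult)
qed

lemma wgram_power_ge_gram_power:
  assumes s: "0 \<le> s" "\<And>r. r < q \<Longrightarrow> s \<le> e r" and e: "\<And>r. r < n \<Longrightarrow> 0 \<le> e r"
    and \<kappa>: "antimono \<kappa>" "\<kappa> q = 0" and q: "q \<le> n"
  shows "s ^ (\<Sum>r<q. \<kappa> r) * gram_power q \<kappa> g \<le> wgram_power n \<kappa> e g"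
proof -
  have "(\<Prod>r<q. s ^ \<kappa> r) * (\<Prod>j<q. mdet (Suc j) (case_prod (gram q g)) ^ (\<kappa> j - \<kappa> (Suc j))) \<le> wgram_power n \<kappa> e g"
  proof (rule wgram_power_ge[OF e \<kappa> q])
    fix j assume j: "j < q"
    show "0 \<le> mdet (Suc j) (case_prod (gram q g))" by (rule det_gram_nonneg)
    \<comment> \<open>Only the first q rows are kept, all with weight s, so every minor becomes a
      power of s times a Gram minor of the q by q block.\<close>
    define f where "f r = (if r < q then s else 0)" for r
    have "wgram n f g a b = s * gram q g a b" for a b
    proof -
      have "wgram n f g a b = (\<Sum>r<q. f r * g (r, a) * g (r, b))"
        unfolding wgram_def using q by (intro sum.mono_neutral_right) (auto simp: f_def)
      then show ?thesis by (simp add: f_def gram_def sum_distrib_left mult.assoc)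
    qed
    then have "Matrix.mat (Suc j) (Suc j) (case_prod (wgram n f g)) = s \<cdot>\<^sub>m Matrix.mat (Suc j) (Suc j) (case_prod (gram q g))"
      by (intro eq_matI) auto
    then have "(\<Prod>r<Suc j. s) * mdet (Suc j) (case_prod (gram q g)) =
        mdet (Suc j) (case_prod (wgram n f g))"
      by simp
    also have "\<dots> \<le> mdet (Suc j) (case_prod (wgram n e g))"
      using e s by (intro det_wgram_mono) (auto simp: f_def)
    finally show "(\<Prod>r<Suc j. s) * mdet (Suc j) (case_prod (gram q g)) \<le>
        mdet (Suc j) (case_prod (wgram n e g))" .
  qed (use s in auto)
  then show ?thesis by (simp add: power_sum gram_power_def)
qed

text \<open>Raising all weights to c gives c times the identity, as the columns of \<open>H\<close>
  are orthonormal.\<close>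

lemma wgram_power_orthogonal_le:
  assumes H: "H \<in> orthogonal_group n" and \<kappa>: "antimono \<kappa>" "\<kappa> n = 0"
    and e: "\<And>r. r < n \<Longrightarrow> 0 \<le> e r" "\<And>r. r < n \<Longrightarrow> e r \<le> c"
  shows "wgram_power n \<kappa> e (\<lambda>ij. H $$ ij) \<le> c ^ (\<Sum>r<n. \<kappa> r)"
proof -
  note HD = orthogonal_groupD[OF H]
  have "wgram_power n \<kappa> e (\<lambda>ij. H $$ ij) \<le> (\<Prod>j<n. (\<Prod>r<Suc j. c) ^ (\<kappa> j - \<kappa> (Suc j)))"
    unfolding wgram_power_def
  proof (intro prod_mono conjI zero_le_power power_mono)
    fix j assume j: "j \<in> {..<n}"
    have "wgram n (\<lambda>_. c) (\<lambda>ij. H $$ ij) a b = (if a = b then c else 0)" if "a < n" "b < n" for a b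
      using index_gram[OF HD(1) that] HD(2) that
      by (simp add: wgram_def sum_distrib_left[symmetric] mult.assoc split: if_splits)
    then have "Matrix.mat (Suc j) (Suc j) (case_prod (wgram n (\<lambda>_. c) (\<lambda>ij. H $$ ij))) = c \<cdot>\<^sub>m 1\<^sub>m (Suc j)"
      using j by (intro eq_matI) auto
    then have "mdet (Suc j) (case_prod (wgram n (\<lambda>_. c) (\<lambda>ij. H $$ ij))) = (\<Prod>r<Suc j. c)"
      by simp
    then show "mdet (Suc j) (case_prod (wgram n e (\<lambda>ij. H $$ ij))) \<le> (\<Prod>r<Suc j. c)"
      using det_wgram_mono(2)[of n e "\<lambda>_. c" "Suc j" "\<lambda>ij. H $$ ij"] e by simp
  qed (use e det_wgram_mono(1)[of n e e] in auto)
  also have "\<dots> = c ^ (\<Sum>r<n. \<kappa> r)"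
    using prod_part_differences[OF \<kappa>(1), of "\<lambda>_. c" n] \<kappa>(2) by (simp add: power_sum)
  finally show ?thesis .
qed

section \<open>Lower and upper bounds for Haar averages\<close>

definition spherical_mean :: "nat \<Rightarrow> (nat \<Rightarrow> nat) \<Rightarrow> (nat \<Rightarrow> real) \<Rightarrow> real" where
  "spherical_mean n \<kappa> e = (\<integral>H. wgram_power n \<kappa> e (\<lambda>ij. H $$ ij) \<partial>haar n)"

text \<open>The mean of \<open>gram_power\<close> from \<open>nn_integral_gram_power\<close>. For
  \<kappa> of weight k and length at most n it is 2^k times the shifted factorial of n/2.\<close>

definition gram_moment :: "nat \<Rightarrow> (nat \<Rightarrow> nat) \<Rightarrow> real" where
  "gram_moment n \<kappa> = (\<Prod>i<n. 2 ^ \<kappa> i * pochhammer (real (n - i) / 2) (\<kappa> i))"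

lemma gram_moment_pos: "0 < gram_moment n \<kappa>"
  unfolding gram_moment_def by (intro prod_pos ballI mult_pos_pos pochhammer_pos) auto

lemma measurable_haar_wgram_power:
  "(\<lambda>H. wgram_power n \<kappa> e (\<lambda>ij. H $$ ij)) \<in> borel_measurable (haar n)"
  by (intro measurable_wgram_power measurable_haar_entry)

context
  fixes n :: nat and \<kappa> :: "nat \<Rightarrow> nat" and e :: "nat \<Rightarrow> real"
  assumes \<kappa>: "antimono \<kappa>" "\<kappa> n = 0" and e: "\<And>r. r < n \<Longrightarrow> 0 \<le> e r"
begin

lemma wgram_power_integrable: "integrable (haar n) (\<lambda>H. wgram_power n \<kappa> e (\<lambda>ij. H $$ ij))"
proof (rule finite_measure.integrable_const_bound)
  show "finite_measure (haar n)" using prob_space_haar prob_space.finite_measure by blast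
  define c where "c = (\<Sum>r<n. e r)"
  have "e r \<le> c" if "r < n" for r unfolding c_def using that e by (intro member_le_sum) auto
  then show "AE H in haar n. norm (wgram_power n \<kappa> e (\<lambda>ij. H $$ ij)) \<le> c ^ (\<Sum>r<n. \<kappa> r)"
    using wgram_power_orthogonal_le[OF _ \<kappa> e] wgram_power_nonneg[OF e] by (intro AE_I2) (auto simp: space_haar)
qed (rule measurable_haar_wgram_power)

lemma spherical_mean_nonneg: "0 \<le> spherical_mean n \<kappa> e"
  unfolding spherical_mean_def by (intro integral_nonneg_AE AE_I2 wgram_power_nonneg e)

lemma spherical_mean_le:
  assumes "\<And>r. r < n \<Longrightarrow> e r \<le> c"
  shows "spherical_mean n \<kappa> e \<le> c ^ (\<Sum>r<n. \<kappa> r)"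
proof -
  interpret prob_space "haar n" by (rule prob_space_haar)
  have "spherical_mean n \<kappa> e \<le> (\<integral>H. c ^ (\<Sum>r<n. \<kappa> r) \<partial>haar n)"
    unfolding spherical_mean_def using wgram_power_integrable wgram_power_orthogonal_le[OF _ \<kappa> e assms]
    by (intro integral_mono) (auto simp: space_haar)
  then show ?thesis by (simp add: prob_space)
qed

text \<open>Gaussian means are kept in \<open>ennreal\<close> up to this point, where boundedness of
  the Haar integrand and the known Gram moment make both factors finite.\<close>

lemma gaussian_moment_eq_sph:
  "(\<integral>\<^sup>+g. ennreal (wgram_power n \<kappa> e g) \<partial>gaussian ({..<n} \<times> {..<n})) = ennreal (gram_moment n \<kappa> * spherical_mean n \<kappa> e)"
proof -
  have "(\<integral>\<^sup>+H. ennreal (wgram_power n \<kappa> e (\<lambda>ij. H $$ ij)) \<partial>haar n) = ennreal (spherical_mean n \<kappa> e)"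
    unfolding spherical_mean_def by (intro nn_integral_eq_integral wgram_power_integrable AE_I2 wgram_power_nonneg e)
  moreover have "(\<integral>\<^sup>+g. ennreal (gram_power n \<kappa> g) \<partial>gaussian ({..<n} \<times> {..<n})) = ennreal (gram_moment n \<kappa>)"
    unfolding gram_moment_def by (rule nn_integral_gram_power[OF \<kappa>])
  ultimately show ?thesis
    using nn_integral_gaussian_wgram_power[of n e \<kappa>, OF e]
    by (simp add: ennreal_mult spherical_mean_nonneg gram_moment_pos less_imp_le)
qed

lemma spherical_mean_ge_monomial:
  "(\<Prod>r<n. e r ^ \<kappa> r) * (\<Prod>i<n. 2 ^ \<kappa> i * pochhammer (1/2) (\<kappa> i)) \<le> gram_moment n \<kappa> * spherical_mean n \<kappa> e"
proof -
  have P: "0 \<le> (\<Prod>r<n. e r ^ \<kappa> r)" by (intro prod_nonneg ballI zero_le_power e) auto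
  have C: "0 \<le> (\<Prod>i<n. 2 ^ \<kappa> i * pochhammer (1/2) (\<kappa> i) :: real)"
    by (intro prod_nonneg ballI mult_nonneg_nonneg pochhammer_ge_0) auto
  have "ennreal ((\<Prod>r<n. e r ^ \<kappa> r) * (\<Prod>i<n. 2 ^ \<kappa> i * pochhammer (1/2) (\<kappa> i))) \<le>
      ennreal (\<Prod>r<n. e r ^ \<kappa> r) * (\<integral>\<^sup>+g. ennreal (det_power n \<kappa> g) \<partial>gaussian ({..<n} \<times> {..<n}))"
    unfolding ennreal_mult[OF P C] by (intro mult_left_mono nn_integral_det_power \<kappa>) auto
  also have "\<dots> = (\<integral>\<^sup>+g. ennreal ((\<Prod>r<n. e r ^ \<kappa> r) * det_power n \<kappa> g) \<partial>gaussian ({..<n} \<times> {..<n}))"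
    unfolding ennreal_mult[OF P det_power_nonneg]
    by (intro nn_integral_cmult[symmetric] measurable_compose[OF measurable_det_power measurable_ennreal]) auto
  also have "\<dots> \<le> (\<integral>\<^sup>+g. ennreal (wgram_power n \<kappa> e g) \<partial>gaussian ({..<n} \<times> {..<n}))"
    by (intro nn_integral_mono ennreal_leI wgram_power_ge_det_power \<kappa> e)
  finally show ?thesis
    unfolding gaussian_moment_eq_sph using gram_moment_pos[of n \<kappa>] spherical_mean_nonneg by (simp add: ennreal_le_iff)
qed

text \<open>Meant for q = p and n = d. The leading q by q block of the Gaussian matrix is itself
  Gaussian, so its Gram moment is that of dimension q.\<close>

lemma spherical_mean_ge_truncated:
  assumes s: "0 \<le> s" "\<And>r. r < q \<Longrightarrow> s \<le> e r" and q: "q \<le> n" "\<kappa> q = 0"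
  shows "s ^ (\<Sum>r<q. \<kappa> r) * gram_moment q \<kappa> \<le> gram_moment n \<kappa> * spherical_mean n \<kappa> e"
proof -
  let ?I = "{..<q} \<times> {..<q}" and ?K = "{..<n} \<times> {..<n}"
  have S: "0 \<le> s ^ (\<Sum>r<q. \<kappa> r)" using s by simp
  have gm: "gram_power q \<kappa> \<in> borel_measurable (gaussian ?K)" "gram_power q \<kappa> \<in> borel_measurable (gaussian ?I)"
    using q by (auto intro!: measurable_gram_power)
  have "(\<integral>\<^sup>+g. ennreal (gram_power q \<kappa> g) \<partial>gaussian ?K) = (\<integral>\<^sup>+g. ennreal (gram_power q \<kappa> (\<lambda>i\<in>?I. g (id i))) \<partial>gaussian ?K)"
    by (intro nn_integral_cong arg_cong[where f=ennreal] gram_power_cong) (auto simp: gram_def)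
  also have "\<dots> = (\<integral>\<^sup>+g. ennreal (gram_power q \<kappa> g) \<partial>gaussian ?I)"
    using q by (intro nn_integral_gaussian_reindex[where f="\<lambda>g. ennreal (gram_power q \<kappa> g)"]
      measurable_compose[OF gm(2) measurable_ennreal]) auto
  also have "\<dots> = ennreal (gram_moment q \<kappa>)"
    unfolding gram_moment_def by (rule nn_integral_gram_power[OF \<kappa>(1) q(2)])
  finally have "ennreal (s ^ (\<Sum>r<q. \<kappa> r) * gram_moment q \<kappa>) =
      ennreal (s ^ (\<Sum>r<q. \<kappa> r)) * (\<integral>\<^sup>+g. ennreal (gram_power q \<kappa> g) \<partial>gaussian ?K)"
    using S gram_moment_pos[of q \<kappa>] by (simp add: ennreal_mult)
  also have "\<dots> = (\<integral>\<^sup>+g. ennreal (s ^ (\<Sum>r<q. \<kappa> r) * gram_power q \<kappa> g) \<partial>gaussian ?K)"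
    unfolding ennreal_mult[OF S gram_power_nonneg]
    by (intro nn_integral_cmult[symmetric] measurable_compose[OF gm(1) measurable_ennreal])
  also have "\<dots> \<le> (\<integral>\<^sup>+g. ennreal (wgram_power n \<kappa> e g) \<partial>gaussian ?K)"
    by (intro nn_integral_mono ennreal_leI wgram_power_ge_gram_power s e \<kappa>(1) q)
  finally show ?thesis
    unfolding gaussian_moment_eq_sph using gram_moment_pos[of n \<kappa>] spherical_mean_nonneg by (simp add: ennreal_le_iff)
qed

end

section \<open>Partitions, and zonal polynomials in terms of eigenvalues\<close>

lemma is_partitionD:
  assumes "is_partition \<kappa>"
  shows "antimono \<kappa>" "\<kappa> i \<noteq> 0 \<longleftrightarrow> i < plength \<kappa>" "pweight \<kappa> = (\<Sum>i<plength \<kappa>. \<kappa> i)"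
proof -
  let ?A = "{i. \<kappa> i \<noteq> 0}"
  have anti: "antimono \<kappa>" and fin: "finite ?A" using assms by (auto simp: is_partition_def)
  have down: "j \<in> ?A" if "i \<in> ?A" "j \<le> i" for i j
    using antimonoD[OF anti that(2)] that(1) by auto
  have "\<exists>m. ?A = {..<m}"
  proof (cases "?A = {}")
    case False
    have "?A = {..<Suc (Max ?A)}"
    proof (rule subset_antisym; rule subsetI)
      show "i \<in> {..<Suc (Max ?A)}" if "i \<in> ?A" for i
        using Max_ge[OF fin that] by (simp add: less_Suc_eq_le)
      show "i \<in> ?A" if "i \<in> {..<Suc (Max ?A)}" for i
        using down[OF Max_in[OF fin False], of i] that by (simp add: less_Suc_eq_le)
    qed
    then show ?thesis by (rule exI)
  next
    case True
    show ?thesis unfolding True by (rule exI[of _ 0]) simp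
  qed
  then obtain m where m: "?A = {..<m}" by (rule exE)
  have "plength \<kappa> = m" unfolding plength_def m by simp
  with m have A: "?A = {..<plength \<kappa>}" by (simp only:)
  show "\<kappa> i \<noteq> 0 \<longleftrightarrow> i < plength \<kappa>"
    unfolding mem_Collect_eq[of i "\<lambda>i. \<kappa> i \<noteq> 0", symmetric] A lessThan_iff ..
  show "antimono \<kappa>" by (rule anti)
  show "pweight \<kappa> = (\<Sum>i<plength \<kappa>. \<kappa> i)" unfolding pweight_def A ..
qed

lemma is_partition_eq_0: "is_partition \<kappa> \<Longrightarrow> plength \<kappa> \<le> i \<Longrightarrow> \<kappa> i = 0"
  by (meson is_partitionD(2) not_le)

lemma pweight_eq_sum:
  assumes "is_partition \<kappa>" "plength \<kappa> \<le> n"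
  shows "pweight \<kappa> = (\<Sum>i<n. \<kappa> i)"
proof -
  have "(\<Sum>i<plength \<kappa>. \<kappa> i) = (\<Sum>i<n. \<kappa> i)"
    using assms by (intro sum.mono_neutral_left) (auto intro: is_partition_eq_0)
  then show ?thesis using is_partitionD(3)[OF assms(1)] by simp
qed

lemma zonal_eq_minor_power:
  assumes \<kappa>: "is_partition \<kappa>" "plength \<kappa> \<le> n" and S: "S \<in> carrier_mat n n"
  shows "zonal \<kappa> S = zonal_const n \<kappa> * (\<integral>H. minor_power n \<kappa> (transpose_mat H * S * H) \<partial>haar n)"
proof -
  have "(\<Prod>j<plength \<kappa>. leading_minor (Suc j) M ^ (\<kappa> j - \<kappa> (Suc j))) = minor_power n \<kappa> M" for M
    unfolding minor_power_def using \<kappa> by (intro prod.mono_neutral_left) (auto simp: is_partition_eq_0)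
  then show ?thesis using S by (simp add: zonal_def)
qed

lemma zonal_one:
  assumes \<kappa>: "is_partition \<kappa>" "plength \<kappa> \<le> n"
  shows "zonal \<kappa> (1\<^sub>m n) = zonal_const n \<kappa>"
proof -
  interpret prob_space "haar n" by (rule prob_space_haar)
  have "minor_power n \<kappa> (transpose_mat H * 1\<^sub>m n * H) = 1" if "H \<in> space (haar n)" for H
  proof -
    have H: "transpose_mat H * 1\<^sub>m n * H = 1\<^sub>m n"
      using that orthogonal_groupD(1,2)[of H n] by (simp add: space_haar)
    have "leading_minor (Suc j) (1\<^sub>m n) = (1 :: real)" if "j < n" for j
    proof -
      have "Matrix.mat (Suc j) (Suc j) (\<lambda>ij. 1\<^sub>m n $$ ij) = (1\<^sub>m (Suc j) :: real mat)"
        using that by (intro eq_matI) auto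
      then show ?thesis by (simp only: leading_minor_def det_one)
    qed
    then show ?thesis unfolding H minor_power_def by simp
  qed
  then have "(\<integral>H. minor_power n \<kappa> (transpose_mat H * 1\<^sub>m n * H) \<partial>haar n) = (\<integral>H. 1 \<partial>haar n)"
    by (rule Bochner_Integration.integral_cong[OF refl])
  then show ?thesis using zonal_eq_minor_power[OF \<kappa> one_carrier_mat] by (simp add: prob_space)
qed

text \<open>Diagonalising by \<open>Q\<close> replaces H by Q'H, which left invariance
  absorbs.\<close>

lemma zonal_diagonalized:
  assumes \<kappa>: "is_partition \<kappa>" "plength \<kappa> \<le> n" and S: "S \<in> carrier_mat n n"
    and Q: "Q \<in> orthogonal_group n" "transpose_mat Q * S * Q = diagm n e"
  shows "zonal \<kappa> S = zonal_const n \<kappa> * spherical_mean n \<kappa> e"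
proof -
  note QD = orthogonal_groupD[OF Q(1)]
  let ?Q = "transpose_mat Q"
  note assoc = assoc_mult_mat[of _ n n _ n _ n]
  define D where "D = diagm n e"
  have D: "D \<in> carrier_mat n n" by (simp add: D_def)
  have D_eq: "D = ?Q * S * Q" unfolding D_def by (rule Q(2)[symmetric])
  have S_eq: "S = Q * (D * ?Q)"
  proof -
    have "Q * (D * ?Q) = (Q * ?Q) * S * (Q * ?Q)"
      unfolding D_eq using QD(1) S by (simp add: assoc)
    then show ?thesis using QD S by simp
  qed
  have eq: "minor_power n \<kappa> (transpose_mat H * S * H) = wgram_power n \<kappa> e (\<lambda>ij. (?Q * H) $$ ij)"
    if "H \<in> space (haar n)" for H
  proof -
    have H: "H \<in> carrier_mat n n" using that orthogonal_groupD(1) by (simp add: space_haar)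
    have reassoc: "K * (P * (D * R)) * H = K * P * D * (R * H)"
      if "K \<in> carrier_mat n n" "P \<in> carrier_mat n n" "R \<in> carrier_mat n n" for K P R
      using that D H by (simp add: assoc)
    have "transpose_mat (?Q * H) = transpose_mat H * Q"
      using transpose_mult[of ?Q n n H n] QD(1) H by simp
    then have "transpose_mat H * S * H = transpose_mat (?Q * H) * D * (?Q * H)"
      unfolding S_eq using reassoc[of "transpose_mat H" Q ?Q] QD(1) H by simp
    then show ?thesis unfolding D_def by (simp only:) (rule minor_power_diag, use QD(1) H in auto)
  qed
  have "(\<integral>H. minor_power n \<kappa> (transpose_mat H * S * H) \<partial>haar n) = (\<integral>H. wgram_power n \<kappa> e (\<lambda>ij. (?Q * H) $$ ij) \<partial>haar n)"
    using eq by (simp cong: Bochner_Integration.integral_cong)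
  also have "\<dots> = spherical_mean n \<kappa> e"
    unfolding spherical_mean_def
    by (rule integral_haar_left[where f="\<lambda>H. wgram_power n \<kappa> e (\<lambda>ij. H $$ ij)",
          OF measurable_haar_wgram_power orthogonal_group_transpose[OF Q(1)]])
  finally have int: "(\<integral>H. minor_power n \<kappa> (transpose_mat H * S * H) \<partial>haar n) = spherical_mean n \<kappa> e" .
  show ?thesis unfolding zonal_eq_minor_power[OF \<kappa> S] int ..
qed

section \<open>Multinomial and factorial estimates\<close>

lemma power_div_fact_binomial:
  fixes s b :: real
  shows "(s + b) ^ k / fact k = (\<Sum>i\<le>k. s ^ i / fact i * (b ^ (k - i) / fact (k - i)))"
proof -
  have "(s + b) ^ k / fact k = (\<Sum>i\<le>k. real (k choose i) * s ^ i * b ^ (k - i) / fact k)"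
    unfolding binomial_ring sum_divide_distrib by simp
  also have "\<dots> = (\<Sum>i\<le>k. s ^ i / fact i * (b ^ (k - i) / fact (k - i)))"
    by (intro sum.cong refl) (simp add: binomial_fact)
  finally show ?thesis .
qed

text \<open>One of the at most \<open>(1 + k)\<^sup>q\<close> terms of the multinomial expansion is at least the average.\<close>

lemma power_le_max_multinomial_term:
  fixes a :: "nat \<Rightarrow> real"
  assumes "\<And>i. 0 \<le> a i"
  shows "\<exists>\<mu>. (\<forall>i>q. \<mu> i = 0) \<and> (\<Sum>i\<le>q. \<mu> i) = k \<and>
    (\<Sum>i\<le>q. a i) ^ k / fact k \<le> real (Suc k) ^ q * (\<Prod>i\<le>q. a i ^ \<mu> i / fact (\<mu> i))"
proof (induction q arbitrary: k)
  case 0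
  show ?case by (rule exI[of _ "\<lambda>i. if i = 0 then k else 0"]) simp
next
  case (Suc q)
  let ?s = "\<Sum>i\<le>q. a i" and ?b = "a (Suc q)"
  let ?t = "\<lambda>i. ?s ^ i / fact i * (?b ^ (k - i) / fact (k - i))"
  have s: "0 \<le> ?s" using assms by (simp add: sum_nonneg)
  \<comment> \<open>The largest of the k + 1 binomial terms is at least their mean; this costs one
    factor \<open>Suc k\<close> for each added variable.\<close>
  obtain i where i: "i \<le> k" "\<And>j. j \<le> k \<Longrightarrow> ?t j \<le> ?t i"
  proof -
    have fin: "finite (?t ` {..k})" "?t ` {..k} \<noteq> {}" by auto
    then obtain i where "i \<in> {..k}" "?t i = Max (?t ` {..k})" using Max_in[OF fin] by fastforce
    then show thesis using that[of i] Max_ge[OF fin(1)] by simp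
  qed
  obtain \<mu> where \<mu>: "\<forall>i>q. \<mu> i = 0" "(\<Sum>i\<le>q. \<mu> i) = i"
    "?s ^ i / fact i \<le> real (Suc i) ^ q * (\<Prod>i\<le>q. a i ^ \<mu> i / fact (\<mu> i))"
    using Suc.IH[of i] by blast
  let ?\<mu> = "\<mu>(Suc q := k - i)"
  let ?P = "\<Prod>i\<le>q. a i ^ \<mu> i / fact (\<mu> i)"
  have P: "0 \<le> ?P" using assms by (intro prod_nonneg) auto
  have sum: "(\<Sum>i\<le>Suc q. ?\<mu> i) = k" using \<mu>(2) i(1) by simp
  have prod: "(\<Prod>i\<le>Suc q. a i ^ ?\<mu> i / fact (?\<mu> i)) = ?P * (?b ^ (k - i) / fact (k - i))" by simp
  have "(?s + ?b) ^ k / fact k \<le> (\<Sum>j\<le>k. ?t i)"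
    unfolding power_div_fact_binomial by (intro sum_mono i(2)) simp
  also have "\<dots> = real (Suc k) * ?t i" by simp
  also have "\<dots> \<le> real (Suc k) * ((real (Suc i) ^ q * ?P) * (?b ^ (k - i) / fact (k - i)))"
    using \<mu>(3) assms by (intro mult_left_mono mult_right_mono) auto
  also have "\<dots> \<le> real (Suc k) * ((real (Suc k) ^ q * ?P) * (?b ^ (k - i) / fact (k - i)))"
    using i(1) assms P by (intro mult_left_mono mult_right_mono power_mono) auto
  also have "\<dots> = real (Suc k) ^ Suc q * (\<Prod>i\<le>Suc q. a i ^ ?\<mu> i / fact (?\<mu> i))"
    unfolding prod by simp
  finally have "(\<Sum>i\<le>Suc q. a i) ^ k / fact k \<le> real (Suc k) ^ Suc q * (\<Prod>i\<le>Suc q. a i ^ ?\<mu> i / fact (?\<mu> i))"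
    by simp
  then show ?case using \<mu>(1) sum by (intro exI[of _ ?\<mu>] conjI) auto
qed

text \<open>Swapping an adjacent ascent moves the larger exponent to the larger base, which cannot
  lower the product, and permutes the factorials. Each swap decreases the sum of
  \<open>i * \<mu> i\<close>, so the process ends.\<close>

lemma exists_sorted_exponents:
  fixes a :: "nat \<Rightarrow> real" and \<mu> :: "nat \<Rightarrow> nat"
  assumes a: "\<And>i. 0 \<le> a i" "\<And>i. Suc i < p \<Longrightarrow> a (Suc i) \<le> a i" and "\<And>i. p \<le> i \<Longrightarrow> \<mu> i = 0"
  shows "\<exists>\<kappa>. antimono \<kappa> \<and> (\<forall>i\<ge>p. \<kappa> i = 0) \<and> (\<Sum>i<p. \<kappa> i) = (\<Sum>i<p. \<mu> i) \<and>
    (\<Prod>i<p. a i ^ \<mu> i / fact (\<mu> i)) \<le> (\<Prod>i<p. a i ^ \<kappa> i / fact (\<kappa> i))"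
  using assms(3)
proof (induction "\<Sum>i<p. i * \<mu> i" arbitrary: \<mu> rule: less_induct)
  case less
  show ?case
  proof (cases "antimono \<mu>")
    case True
    then show ?thesis using less.prems by blast
  next
    case False
    then obtain i where i: "\<mu> i < \<mu> (Suc i)" by (auto simp: antimono_iff_le_Suc not_le)
    then have ip: "Suc i < p" using less.prems[of "Suc i"] by (cases "Suc i < p") auto
    define \<nu> where "\<nu> = \<mu>(i := \<mu> (Suc i), Suc i := \<mu> i)"
    define B where "B = {..<p} - {i, Suc i}"
    have split: "{..<p} = insert i (insert (Suc i) B)" "i \<notin> insert (Suc i) B" "Suc i \<notin> B" "finite B"
      using ip by (auto simp: B_def)
    have \<nu>B: "\<nu> r = \<mu> r" if "r \<in> B" for r using that by (auto simp: \<nu>_def B_def)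
    have \<nu>i: "\<nu> i = \<mu> (Suc i)" "\<nu> (Suc i) = \<mu> i" by (auto simp: \<nu>_def)
    have "(\<Sum>r<p. r * \<nu> r) < (\<Sum>r<p. r * \<mu> r)"
      unfolding split(1) using split(2,3,4) \<nu>B \<nu>i i by simp
    moreover have "\<nu> r = 0" if "p \<le> r" for r using that less.prems ip by (auto simp: \<nu>_def)
    ultimately obtain \<kappa> where \<kappa>: "antimono \<kappa>" "\<forall>i\<ge>p. \<kappa> i = 0" "(\<Sum>i<p. \<kappa> i) = (\<Sum>i<p. \<nu> i)"
      "(\<Prod>i<p. a i ^ \<nu> i / fact (\<nu> i)) \<le> (\<Prod>i<p. a i ^ \<kappa> i / fact (\<kappa> i))"
      using less.hyps[of \<nu>] by blast
    have sum: "(\<Sum>r<p. \<nu> r) = (\<Sum>r<p. \<mu> r)"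
      unfolding split(1) using split(2,3,4) \<nu>B \<nu>i by simp
    have swap: "a i ^ \<mu> i * a (Suc i) ^ \<mu> (Suc i) \<le> a i ^ \<mu> (Suc i) * a (Suc i) ^ \<mu> i"
    proof -
      define d where "d = \<mu> (Suc i) - \<mu> i"
      have d: "\<mu> (Suc i) = \<mu> i + d" using i by (simp add: d_def)
      have "a (Suc i) ^ d \<le> a i ^ d" using a ip by (intro power_mono) auto
      then have "(a i ^ \<mu> i * a (Suc i) ^ \<mu> i) * a (Suc i) ^ d \<le> (a i ^ \<mu> i * a (Suc i) ^ \<mu> i) * a i ^ d"
        using a(1) by (intro mult_left_mono) auto
      then show ?thesis by (simp add: d power_add mult_ac)
    qed
    let ?R = "\<Prod>r\<in>B. a r ^ \<mu> r / fact (\<mu> r)"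
    have R: "0 \<le> ?R" using a(1) by (intro prod_nonneg) auto
    have "(\<Prod>r<p. a r ^ \<mu> r / fact (\<mu> r)) = (a i ^ \<mu> i * a (Suc i) ^ \<mu> (Suc i)) * (?R / (fact (\<mu> i) * fact (\<mu> (Suc i))))"
      unfolding split(1) using split(2,3,4) by simp
    also have "\<dots> \<le> (a i ^ \<mu> (Suc i) * a (Suc i) ^ \<mu> i) * (?R / (fact (\<mu> i) * fact (\<mu> (Suc i))))"
      using R by (intro mult_right_mono swap) auto
    also have "\<dots> = (\<Prod>r<p. a r ^ \<nu> r / fact (\<nu> r))"
      unfolding split(1) using split(2,3,4) \<nu>i \<nu>B by (simp add: mult_ac)
    finally show ?thesis using \<kappa> sum by (intro exI[of _ \<kappa>]) auto
  qed
qed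

text \<open>The factorials in the denominator of C_\<kappa>(I_n) are (2 \<kappa>_i)! times one
  further factor for each j with i < j < l, matching the numerator factors pair by pair.\<close>

lemma prod_fact_shift:
  fixes \<kappa> :: "nat \<Rightarrow> nat"
  shows "(\<Prod>i<l. fact (2 * \<kappa> i + l - Suc i) :: real) =
    (\<Prod>i<l. fact (2 * \<kappa> i)) * (\<Prod>j<l. \<Prod>i<j. 2 * real (\<kappa> i) + real j - real i)"
proof (induction l)
  case (Suc l)
  have "(\<Prod>i<l. fact (2 * \<kappa> i + Suc l - Suc i) :: real) =
      (\<Prod>i<l. (2 * real (\<kappa> i) + real l - real i) * fact (2 * \<kappa> i + l - Suc i))"
  proof (intro prod.cong refl)
    fix i assume "i \<in> {..<l}"
    then have i: "i < l" by simp
    then have "2 * \<kappa> i + Suc l - Suc i = Suc (2 * \<kappa> i + l - Suc i)" by simp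
    moreover have "real (Suc (2 * \<kappa> i + l - Suc i)) = 2 * real (\<kappa> i) + real l - real i"
      using i by (simp add: of_nat_diff)
    ultimately show "(fact (2 * \<kappa> i + Suc l - Suc i) :: real) = (2 * real (\<kappa> i) + real l - real i) * fact (2 * \<kappa> i + l - Suc i)"
      by (metis fact_Suc)
  qed
  then have "(\<Prod>i<Suc l. fact (2 * \<kappa> i + Suc l - Suc i) :: real) =
      (\<Prod>i<l. 2 * real (\<kappa> i) + real l - real i) * (\<Prod>i<l. fact (2 * \<kappa> i + l - Suc i)) * fact (2 * \<kappa> l)"
    by (simp only: prod.lessThan_Suc prod.distrib) simp
  also have "\<dots> = (\<Prod>i<Suc l. fact (2 * \<kappa> i)) * (\<Prod>j<Suc l. \<Prod>i<j. 2 * real (\<kappa> i) + real j - real i)"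
    unfolding Suc.IH prod.lessThan_Suc by (simp only: mult_ac)
  finally show ?case .
qed simp

text \<open>A multinomial coefficient in p variables is at most p^k. In the induction one term of
  the expansion of (p + 1)^k bounds the new binomial coefficient.\<close>

lemma fact_sum_le:
  fixes \<kappa> :: "nat \<Rightarrow> nat"
  shows "fact (\<Sum>i<p. \<kappa> i) \<le> real p ^ (\<Sum>i<p. \<kappa> i) * (\<Prod>i<p. fact (\<kappa> i))"
proof (induction p)
  case (Suc p)
  let ?s = "\<Sum>i<p. \<kappa> i" and ?k = "(\<Sum>i<p. \<kappa> i) + \<kappa> p"
  have "real p ^ ?s * real (?k choose ?s) \<le> (\<Sum>i\<le>?k. real (?k choose i) * real p ^ i * 1 ^ (?k - i))"
    by (rule order_trans[OF _ member_le_sum[of ?s]]) auto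
  also have "\<dots> = (real p + 1) ^ ?k" by (simp only: binomial_ring)
  finally have choose: "real p ^ ?s * real (?k choose ?s) \<le> real (Suc p) ^ ?k" by (simp add: add.commute)
  have "fact ?k = real (?k choose ?s) * fact (\<kappa> p) * (fact ?s :: real)"
  proof -
    have "real (?k choose ?s) = fact ?k / (fact ?s * fact (\<kappa> p))"
      using binomial_fact[of ?s ?k, where ?'a = real] by simp
    then show ?thesis by simp
  qed
  also have "\<dots> \<le> real (?k choose ?s) * fact (\<kappa> p) * (real p ^ ?s * (\<Prod>i<p. fact (\<kappa> i)))"
    by (intro mult_left_mono Suc.IH) auto
  also have "\<dots> = (real p ^ ?s * real (?k choose ?s)) * (\<Prod>i<Suc p. fact (\<kappa> i))" by (simp add: mult_ac)
  also have "\<dots> \<le> real (Suc p) ^ ?k * (\<Prod>i<Suc p. fact (\<kappa> i))"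
    using choose by (intro mult_right_mono prod_nonneg) auto
  finally show ?case by simp
qed simp

text \<open>One more degree of freedom costs a factor linear in m. The induction step comes down to
  x + (m - 1)/2 \<ge> 0, whence the bound on x.\<close>

lemma pochhammer_half_step:
  assumes "1/2 \<le> (x :: real)"
  shows "pochhammer (x + 1/2) m \<le> real (Suc m) * pochhammer x m"
proof (induction m)
  case (Suc m)
  have x: "0 \<le> pochhammer x m" using assms by (intro pochhammer_ge_0) auto
  have "pochhammer (x + 1/2) (Suc m) \<le> (real (Suc m) * pochhammer x m) * (x + 1/2 + real m)"
    unfolding pochhammer_Suc using assms by (intro mult_right_mono Suc.IH) auto
  also have "\<dots> = pochhammer x m * (real (Suc m) * (x + 1/2 + real m))" by simp
  also have "\<dots> \<le> pochhammer x m * (real (Suc (Suc m)) * (x + real m))"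
    using assms x by (intro mult_left_mono) (auto simp: algebra_simps)
  also have "\<dots> = real (Suc (Suc m)) * pochhammer x (Suc m)" by (simp add: pochhammer_Suc)
  finally show ?case .
qed simp

lemma pochhammer_le_fact:
  assumes "0 \<le> x" "x \<le> real n" "1 \<le> n"
  shows "pochhammer x m \<le> real n ^ m * fact m"
proof (induction m)
  case (Suc m)
  have "pochhammer x (Suc m) \<le> (real n ^ m * fact m) * (x + real m)"
    unfolding pochhammer_Suc using assms by (intro mult_right_mono Suc.IH) auto
  also have "\<dots> \<le> (real n ^ m * fact m) * (real n * real (Suc m))"
  proof (intro mult_left_mono)
    have "real m \<le> real n * real m" using assms(3) mult_right_mono[of 1 "real n" "real m"] by simp
    moreover have "real n * real (Suc m) = real n * real m + real n" by (simp add: distrib_left)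
    ultimately show "x + real m \<le> real n * real (Suc m)" using assms(2) by linarith
  qed simp
  also have "\<dots> = real n ^ Suc m * fact (Suc m)" by simp
  finally show ?case .
qed simp

section \<open>The terms of the series\<close>

text \<open>What remains of the double product in C_\<kappa>(I_n) once each numerator factor is
  divided by its partner from \<open>prod_fact_shift\<close>.\<close>

definition gap_ratio :: "(nat \<Rightarrow> nat) \<Rightarrow> real" where
  "gap_ratio \<kappa> = (\<Prod>j<plength \<kappa>. \<Prod>i<j.
     (2 * real (\<kappa> i) - 2 * real (\<kappa> j) - real i + real j) / (2 * real (\<kappa> i) + real j - real i))"

context
  fixes \<kappa> :: "nat \<Rightarrow> nat" and n :: nat
  assumes part: "is_partition \<kappa>" and len: "plength \<kappa> \<le> n"
begin

lemma partition_tail_eq_0: "n \<le> i \<Longrightarrow> \<kappa> i = 0"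
  using is_partition_eq_0[OF part] len by simp

lemma prod_partition_extend:
  fixes f :: "nat \<Rightarrow> nat \<Rightarrow> real"
  assumes "\<And>i. f i 0 = 1"
  shows "(\<Prod>i<plength \<kappa>. f i (\<kappa> i)) = (\<Prod>i<n. f i (\<kappa> i))"
  using len assms by (intro prod.mono_neutral_left) (auto simp: is_partition_eq_0[OF part])

text \<open>Of the power 2^(2k), one half completes the shifted factorial to
  \<open>gram_moment\<close>, the denominator of the Haar average; the other half goes with the
  factorials.\<close>

lemma zonal_const_eq:
  "zonal_const n \<kappa> = fact (pweight \<kappa>) * gram_moment n \<kappa> * (\<Prod>i<n. 2 ^ \<kappa> i / fact (2 * \<kappa> i)) * gap_ratio \<kappa>"
proof -
  let ?l = "plength \<kappa>"
  let ?G = "\<Prod>j<?l. \<Prod>i<j. 2 * real (\<kappa> i) - 2 * real (\<kappa> j) - real i + real j"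
  let ?D = "\<Prod>j<?l. \<Prod>i<j. 2 * real (\<kappa> i) + real j - real i"
  let ?F = "\<Prod>i<?l. fact (2 * \<kappa> i) :: real"
  let ?s = "shifted_factorial (real n / 2) \<kappa>"
  have two: "(2::real) ^ pweight \<kappa> = (\<Prod>i<?l. 2 ^ \<kappa> i)"
    unfolding is_partitionD(3)[OF part] by (rule power_sum)
  have "gram_moment n \<kappa> = (\<Prod>i<?l. 2 ^ \<kappa> i * pochhammer (real (n - i) / 2) (\<kappa> i))"
    unfolding gram_moment_def by (rule prod_partition_extend[symmetric]) simp
  also have "\<dots> = (\<Prod>i<?l. 2 ^ \<kappa> i * pochhammer (real n / 2 - real i / 2) (\<kappa> i))"
    using len by (intro prod.cong refl) (simp add: of_nat_diff diff_divide_distrib)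
  also have "\<dots> = 2 ^ pweight \<kappa> * ?s"
    unfolding prod.distrib two shifted_factorial_def ..
  finally have gm: "gram_moment n \<kappa> = 2 ^ pweight \<kappa> * ?s" .
  have X: "(\<Prod>i<n. 2 ^ \<kappa> i / fact (2 * \<kappa> i)) = 2 ^ pweight \<kappa> / ?F"
    unfolding two prod_dividef[symmetric] by (rule prod_partition_extend[symmetric]) simp
  have R: "gap_ratio \<kappa> = ?G / ?D"
    unfolding gap_ratio_def prod_dividef ..
  have "zonal_const n \<kappa> = 2 ^ (2 * pweight \<kappa>) * fact (pweight \<kappa>) * ?s * ?G / (?F * ?D)"
    unfolding zonal_const_def Let_def prod_fact_shift ..
  also have "(2::real) ^ (2 * pweight \<kappa>) = 2 ^ pweight \<kappa> * 2 ^ pweight \<kappa>"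
    by (simp flip: power_add mult_2)
  finally show ?thesis unfolding gm X R by (simp only: times_divide_eq_left times_divide_eq_right divide_divide_eq_left mult_ac)
qed

text \<open>With x the numerator, the quotient is x / (x + 2 \<kappa>_j), where x \<ge> 1 and 2
  \<kappa>_j \<le> \<kappa>_i + \<kappa>_j \<le> k.\<close>

lemma gap_factor:
  assumes ij: "i < j" "j < plength \<kappa>"
  shows "1 / real (Suc (pweight \<kappa>)) \<le> (2 * real (\<kappa> i) - 2 * real (\<kappa> j) - real i + real j) / (2 * real (\<kappa> i) + real j - real i)"
    and "(2 * real (\<kappa> i) - 2 * real (\<kappa> j) - real i + real j) / (2 * real (\<kappa> i) + real j - real i) \<le> 1"
proof -
  define k where "k = real (pweight \<kappa>)"
  define x where "x = 2 * real (\<kappa> i) - 2 * real (\<kappa> j) - real i + real j"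
  have anti: "\<kappa> j \<le> \<kappa> i" using antimonoD[OF is_partitionD(1)[OF part]] ij by simp
  have "(\<Sum>r\<in>{i, j}. \<kappa> r) \<le> (\<Sum>r<plength \<kappa>. \<kappa> r)" using ij by (intro sum_mono2) auto
  then have "\<kappa> i + \<kappa> j \<le> pweight \<kappa>" using ij unfolding is_partitionD(3)[OF part] by simp
  then have k: "2 * real (\<kappa> j) \<le> k" using anti unfolding k_def by linarith
  have x: "1 \<le> x" using anti ij unfolding x_def by linarith
  have den: "2 * real (\<kappa> i) + real j - real i = x + 2 * real (\<kappa> j)" by (simp add: x_def)
  have "k \<le> x * k" using x mult_right_mono[of 1 x k] by (simp add: k_def)
  then have "1 * (x + 2 * real (\<kappa> j)) \<le> x * (1 + k)" using k by (simp add: distrib_left)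
  then have "1 / (1 + k) \<le> x / (x + 2 * real (\<kappa> j))"
    using x k by (intro frac_le_eq[THEN iffD2] | simp add: divide_simps k_def)+
  then show "1 / real (Suc (pweight \<kappa>)) \<le> (2 * real (\<kappa> i) - 2 * real (\<kappa> j) - real i + real j) / (2 * real (\<kappa> i) + real j - real i)"
    unfolding den x_def[symmetric] by (simp add: k_def)
  show "(2 * real (\<kappa> i) - 2 * real (\<kappa> j) - real i + real j) / (2 * real (\<kappa> i) + real j - real i) \<le> 1"
    unfolding den x_def[symmetric] using x by (simp add: divide_le_eq)
qed

text \<open>There are at most n(n-1)/2 pairs, each costing a factor 1 + k.\<close>

lemma gap_ratio_bounds:
  "(1 / real (Suc (pweight \<kappa>))) ^ (\<Sum>j<n. j) \<le> gap_ratio \<kappa>" "0 < gap_ratio \<kappa>" "gap_ratio \<kappa> \<le> 1"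
proof -
  let ?q = "1 / real (Suc (pweight \<kappa>))"
  let ?r = "\<lambda>i j. (2 * real (\<kappa> i) - 2 * real (\<kappa> j) - real i + real j) / (2 * real (\<kappa> i) + real j - real i)"
  have q: "0 < ?q" "?q \<le> 1" by auto
  have "?q ^ (\<Sum>j<n. j) \<le> ?q ^ (\<Sum>j<plength \<kappa>. j)"
    using q len by (intro power_decreasing sum_mono2) auto
  also have "\<dots> = (\<Prod>j<plength \<kappa>. \<Prod>i<j. ?q)" by (simp add: power_sum)
  also have "\<dots> \<le> gap_ratio \<kappa>"
    unfolding gap_ratio_def
  proof (rule prod_mono)
    fix j assume j: "j \<in> {..<plength \<kappa>}"
    have "(\<Prod>i<j. ?q) \<le> (\<Prod>i<j. ?r i j)"
      using j gap_factor(1) by (intro prod_mono) auto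
    then show "0 \<le> (\<Prod>i<j. ?q) \<and> (\<Prod>i<j. ?q) \<le> (\<Prod>i<j. ?r i j)" by simp
  qed
  finally show ge: "?q ^ (\<Sum>j<n. j) \<le> gap_ratio \<kappa>" .
  show "0 < gap_ratio \<kappa>" using ge zero_less_power[OF q(1)] by (rule less_le_trans[rotated])
  have r0: "0 \<le> ?r i j" if "i < j" "j < plength \<kappa>" for i j
    using gap_factor(1)[OF that] q by linarith
  show "gap_ratio \<kappa> \<le> 1"
    unfolding gap_ratio_def using r0 gap_factor(2) by (intro prod_le_1 conjI prod_nonneg) auto
qed

lemma zonal_const_pos: "0 < zonal_const n \<kappa>"
  unfolding zonal_const_eq
  by (intro mult_pos_pos gram_moment_pos gap_ratio_bounds prod_pos) auto

context
  fixes a :: "nat \<Rightarrow> real"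
  assumes a: "\<And>i. i < n \<Longrightarrow> 0 \<le> a i"
begin

text \<open>\<open>gram_moment\<close> cancels between C_\<kappa>(I_n) and the Gaussian bound for
  the Haar average; the moments at 1/2 combine with (2 \<kappa>_i)! to 1 / \<kappa>_i!.\<close>

lemma zonal_sph_ge:
  "fact (pweight \<kappa>) * (\<Prod>i<n. a i ^ \<kappa> i / fact (\<kappa> i)) * (1 / real (Suc (pweight \<kappa>))) ^ (\<Sum>j<n. j)
    \<le> zonal_const n \<kappa> * spherical_mean n \<kappa> a"
proof -
  let ?X = "\<Prod>i<n. 2 ^ \<kappa> i / fact (2 * \<kappa> i) :: real"
  let ?M = "\<Prod>i<n. a i ^ \<kappa> i / fact (\<kappa> i)"
  have X: "0 \<le> ?X" by (intro prod_nonneg) auto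
  have "(\<Prod>i<n. a i ^ \<kappa> i / fact (\<kappa> i)) =
      (\<Prod>i<n. (a i ^ \<kappa> i * (2 ^ \<kappa> i * pochhammer (1/2) (\<kappa> i))) * (2 ^ \<kappa> i / fact (2 * \<kappa> i)))"
  proof (intro prod.cong refl)
    fix i
    have "(2::real) ^ (2 * \<kappa> i) = 2 ^ \<kappa> i * 2 ^ \<kappa> i" by (simp flip: power_add mult_2)
    moreover have "pochhammer (1/2 :: real) (\<kappa> i) \<noteq> 0"
      using pochhammer_pos[of "1/2 :: real" "\<kappa> i"] by simp
    ultimately show "a i ^ \<kappa> i / fact (\<kappa> i) = (a i ^ \<kappa> i * (2 ^ \<kappa> i * pochhammer (1/2) (\<kappa> i))) * (2 ^ \<kappa> i / fact (2 * \<kappa> i))"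
      unfolding fact_double by (simp add: field_simps)
  qed
  then have M: "?M = ((\<Prod>r<n. a r ^ \<kappa> r) * (\<Prod>i<n. 2 ^ \<kappa> i * pochhammer (1/2) (\<kappa> i))) * ?X"
    by (simp only: prod.distrib)
  have M0: "0 \<le> ?M" using a by (intro prod_nonneg) auto
  have "?M \<le> (gram_moment n \<kappa> * spherical_mean n \<kappa> a) * ?X"
    unfolding M
    by (intro mult_right_mono X spherical_mean_ge_monomial is_partitionD(1)[OF part] partition_tail_eq_0 a) auto
  then have "fact (pweight \<kappa>) * ?M * (1 / real (Suc (pweight \<kappa>))) ^ (\<Sum>j<n. j) \<le>
      fact (pweight \<kappa>) * ((gram_moment n \<kappa> * spherical_mean n \<kappa> a) * ?X) * gap_ratio \<kappa>"
    using M0 gap_ratio_bounds by (intro mult_mono mult_left_mono) auto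
  also have "\<dots> = zonal_const n \<kappa> * spherical_mean n \<kappa> a" unfolding zonal_const_eq by (simp only: mult_ac)
  finally show ?thesis .
qed

text \<open>A crude exponential bound, made for the convergence of the series.\<close>

lemma zonal_sph_le:
  assumes n: "1 \<le> n" and c: "\<And>i. i < n \<Longrightarrow> a i \<le> c"
  shows "zonal_const n \<kappa> * spherical_mean n \<kappa> a \<le> (4 * (real n)\<^sup>2 * c) ^ pweight \<kappa>"
proof -
  let ?k = "pweight \<kappa>"
  let ?X = "\<Prod>i<n. 2 ^ \<kappa> i / fact (2 * \<kappa> i) :: real"
  have k: "?k = (\<Sum>i<n. \<kappa> i)" by (rule pweight_eq_sum[OF part len])
  have c0: "0 \<le> c" using a[of 0] c[of 0] n by simp
  have "gram_moment n \<kappa> * ?X = (\<Prod>i<n. (2 ^ \<kappa> i * pochhammer (real (n - i) / 2) (\<kappa> i)) * (2 ^ \<kappa> i / fact (2 * \<kappa> i)))"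
    unfolding gram_moment_def prod.distrib ..
  also have "\<dots> \<le> (\<Prod>i<n. (4 * real n) ^ \<kappa> i / fact (\<kappa> i))"
  proof (intro prod_mono conjI)
    fix i assume i: "i \<in> {..<n}"
    have p0: "0 \<le> pochhammer (real (n - i) / 2) (\<kappa> i)" by (intro pochhammer_ge_0) simp
    then show "0 \<le> 2 ^ \<kappa> i * pochhammer (real (n - i) / 2) (\<kappa> i) * (2 ^ \<kappa> i / fact (2 * \<kappa> i))" by simp
    have "pochhammer (real (n - i) / 2) (\<kappa> i) \<le> real n ^ \<kappa> i * fact (\<kappa> i)"
      using n by (intro pochhammer_le_fact) auto
    moreover have "fact (\<kappa> i) * fact (\<kappa> i) \<le> (fact (2 * \<kappa> i) :: real)"
    proof -
      have "fact (\<kappa> i) * fact (\<kappa> i) \<le> (fact (\<kappa> i + \<kappa> i) :: nat)"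
        by (intro dvd_imp_le fact_fact_dvd_fact) simp
      then have "real (fact (\<kappa> i) * fact (\<kappa> i)) \<le> real (fact (\<kappa> i + \<kappa> i))" by (simp only: of_nat_le_iff)
      then show ?thesis by (simp add: mult_2)
    qed
    ultimately have "pochhammer (real (n - i) / 2) (\<kappa> i) * (fact (\<kappa> i) * fact (\<kappa> i)) \<le> (real n ^ \<kappa> i * fact (\<kappa> i)) * fact (2 * \<kappa> i)"
      using p0 by (intro mult_mono) auto
    then have "pochhammer (real (n - i) / 2) (\<kappa> i) * fact (\<kappa> i) \<le> real n ^ \<kappa> i * fact (2 * \<kappa> i)"
      by (simp add: mult_ac)
    then have "pochhammer (real (n - i) / 2) (\<kappa> i) / fact (2 * \<kappa> i) \<le> real n ^ \<kappa> i / fact (\<kappa> i)"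
      by (simp add: divide_simps)
    then have "4 ^ \<kappa> i * (pochhammer (real (n - i) / 2) (\<kappa> i) / fact (2 * \<kappa> i)) \<le> 4 ^ \<kappa> i * (real n ^ \<kappa> i / fact (\<kappa> i))"
      by (intro mult_left_mono) auto
    moreover have "(4::real) ^ \<kappa> i = 2 ^ \<kappa> i * 2 ^ \<kappa> i"
      using power_mult_distrib[of "2::real" 2 "\<kappa> i"] by simp
    ultimately show "2 ^ \<kappa> i * pochhammer (real (n - i) / 2) (\<kappa> i) * (2 ^ \<kappa> i / fact (2 * \<kappa> i)) \<le> (4 * real n) ^ \<kappa> i / fact (\<kappa> i)"
      by (simp add: power_mult_distrib mult_ac)
  qed
  also have "\<dots> = (4 * real n) ^ ?k / (\<Prod>i<n. fact (\<kappa> i))"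
    unfolding k power_sum prod_dividef ..
  finally have gX: "gram_moment n \<kappa> * ?X \<le> (4 * real n) ^ ?k / (\<Prod>i<n. fact (\<kappa> i))" .
  have P: "0 < (\<Prod>i<n. fact (\<kappa> i) :: real)" by (intro prod_pos) auto
  have f: "fact ?k \<le> real n ^ ?k * (\<Prod>i<n. fact (\<kappa> i))" unfolding k by (rule fact_sum_le)
  have gX0: "0 \<le> gram_moment n \<kappa> * ?X" using gram_moment_pos[of n \<kappa>] by (intro mult_nonneg_nonneg prod_nonneg) auto
  have "fact ?k * (gram_moment n \<kappa> * ?X) \<le> (real n ^ ?k * (\<Prod>i<n. fact (\<kappa> i))) * ((4 * real n) ^ ?k / (\<Prod>i<n. fact (\<kappa> i)))"
    using P by (intro mult_mono[OF f gX _ gX0] mult_nonneg_nonneg less_imp_le[OF P]) simp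
  also have "\<dots> = real n ^ ?k * (4 * real n) ^ ?k" using P by simp
  also have "\<dots> = (real n * (4 * real n)) ^ ?k" by (rule power_mult_distrib[symmetric])
  also have "real n * (4 * real n) = 4 * (real n)\<^sup>2" by (simp add: power2_eq_square)
  finally have "fact ?k * (gram_moment n \<kappa> * ?X) * gap_ratio \<kappa> \<le> (4 * (real n)\<^sup>2) ^ ?k * 1"
    using gap_ratio_bounds gX0 by (intro mult_mono) auto
  then have "zonal_const n \<kappa> \<le> (4 * (real n)\<^sup>2) ^ ?k" unfolding zonal_const_eq by (simp only: mult.assoc mult_1_right)
  moreover have "spherical_mean n \<kappa> a \<le> c ^ ?k"
    unfolding k by (intro spherical_mean_le is_partitionD(1)[OF part] partition_tail_eq_0 a c) auto
  moreover have "0 \<le> spherical_mean n \<kappa> a" by (intro spherical_mean_nonneg is_partitionD(1)[OF part] partition_tail_eq_0 a) auto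
  ultimately show ?thesis using c0 by (subst power_mult_distrib) (intro mult_mono, auto)
qed

end

end

text \<open>Each passage from dimension q to q + 1 raises the arguments of p Pochhammer symbols by
  1/2 and costs a factor (1 + k)^p.\<close>

lemma gram_moment_dimension_le:
  assumes zero: "\<And>i. p \<le> i \<Longrightarrow> \<kappa> i = 0" and k: "\<And>i. \<kappa> i \<le> k" and "p \<le> d"
  shows "gram_moment d \<kappa> \<le> real (Suc k) ^ (p * (d - p)) * gram_moment p \<kappa>"
  using \<open>p \<le> d\<close>
proof (induction d rule: dec_induct)
  case (step q)
  have restrict: "gram_moment q' \<kappa> = (\<Prod>i<p. 2 ^ \<kappa> i * pochhammer (real (q' - i) / 2) (\<kappa> i))" if "p \<le> q'" for q'
    unfolding gram_moment_def using that zero by (intro prod.mono_neutral_right) auto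
  have "gram_moment (Suc q) \<kappa> \<le> (\<Prod>i<p. real (Suc k) * (2 ^ \<kappa> i * pochhammer (real (q - i) / 2) (\<kappa> i)))"
    unfolding restrict[OF le_SucI[OF step.hyps(1)]]
  proof (intro prod_mono conjI)
    fix i assume "i \<in> {..<p}"
    then have i: "i < q" using step.hyps by simp
    show "0 \<le> 2 ^ \<kappa> i * pochhammer (real (Suc q - i) / 2) (\<kappa> i)" by (intro mult_nonneg_nonneg pochhammer_ge_0) auto
    have "pochhammer (real (Suc q - i) / 2) (\<kappa> i) = pochhammer (real (q - i) / 2 + 1/2) (\<kappa> i)"
      using i by (simp add: Suc_diff_le add_divide_distrib add.commute)
    also have "\<dots> \<le> real (Suc (\<kappa> i)) * pochhammer (real (q - i) / 2) (\<kappa> i)"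
      using i by (intro pochhammer_half_step) simp
    also have "\<dots> \<le> real (Suc k) * pochhammer (real (q - i) / 2) (\<kappa> i)"
      using k[of i] by (intro mult_right_mono pochhammer_ge_0) auto
    finally show "2 ^ \<kappa> i * pochhammer (real (Suc q - i) / 2) (\<kappa> i) \<le> real (Suc k) * (2 ^ \<kappa> i * pochhammer (real (q - i) / 2) (\<kappa> i))"
      by simp
  qed
  also have "\<dots> = real (Suc k) ^ p * gram_moment q \<kappa>"
    unfolding restrict[OF step.hyps(1)] prod.distrib by simp
  also have "\<dots> \<le> real (Suc k) ^ p * (real (Suc k) ^ (p * (q - p)) * gram_moment p \<kappa>)"
    using step.IH by (intro mult_left_mono) auto
  also have "\<dots> = real (Suc k) ^ (p * (Suc q - p)) * gram_moment p \<kappa>"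
    using step.hyps by (simp add: Suc_diff_le power_add)
  finally show ?case .
qed simp

section \<open>Partitions of given weight and bounded length\<close>

lemma partitions_of_subset:
  assumes "\<kappa> \<in> partitions_of k p"
  shows "is_partition \<kappa>" "plength \<kappa> \<le> p" "pweight \<kappa> = k" "\<And>i. p \<le> i \<Longrightarrow> \<kappa> i = 0" "\<And>i. \<kappa> i \<le> k"
proof -
  show part: "is_partition \<kappa>" "plength \<kappa> \<le> p" "pweight \<kappa> = k" using assms by (auto simp: partitions_of_def)
  show zero: "\<kappa> i = 0" if "p \<le> i" for i using partition_tail_eq_0[OF part(1,2) that] .
  have "\<kappa> i \<le> (\<Sum>i<p. \<kappa> i)" if "i < p" for i using that by (intro member_le_sum) auto
  then show "\<kappa> i \<le> k" for i
    using zero[of i] part pweight_eq_sum[OF part(1,2)] by (cases "i < p") auto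
qed

lemma card_partitions_of: "finite (partitions_of k p)" "card (partitions_of k p) \<le> Suc k ^ p"
proof -
  let ?r = "\<lambda>\<kappa>. restrict \<kappa> {..<p}" and ?T = "{..<p} \<rightarrow>\<^sub>E {..k}"
  have inj: "inj_on ?r (partitions_of k p)"
  proof (rule inj_onI, rule ext)
    fix \<kappa> \<nu> i assume k: "\<kappa> \<in> partitions_of k p" "\<nu> \<in> partitions_of k p" and eq: "?r \<kappa> = ?r \<nu>"
    show "\<kappa> i = \<nu> i"
    proof (cases "i < p")
      case True
      then show ?thesis using fun_cong[OF eq, of i] by simp
    next
      case False
      then show ?thesis using partitions_of_subset(4)[OF k(1), of i] partitions_of_subset(4)[OF k(2), of i] by simp
    qed
  qed
  have sub: "?r ` partitions_of k p \<subseteq> ?T"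
    using partitions_of_subset(5) by (intro image_subsetI restrict_PiE_iff[THEN iffD2] ballI) simp
  have fin: "finite ?T" by (intro finite_PiE) auto
  show "finite (partitions_of k p)" using finite_subset[OF sub fin] inj by (rule finite_imageD)
  have "card (partitions_of k p) \<le> card ?T" using inj sub fin by (rule card_inj_on_le)
  then show "card (partitions_of k p) \<le> Suc k ^ p" by (simp add: card_PiE)
qed

lemma partitions_ofI:
  assumes "antimono \<kappa>" "\<And>i. p \<le> i \<Longrightarrow> \<kappa> i = 0" "(\<Sum>i<p. \<kappa> i) = k"
  shows "\<kappa> \<in> partitions_of k p"
proof -
  have sub: "{i. \<kappa> i \<noteq> 0} \<subseteq> {..<p}" using assms(2) by (force simp: not_less[symmetric])
  have "plength \<kappa> \<le> p" unfolding plength_def using card_mono[OF _ sub] by simp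
  moreover have "pweight \<kappa> = k"
    unfolding pweight_def assms(3)[symmetric] using sub by (intro sum.mono_neutral_left) auto
  moreover have "is_partition \<kappa>" unfolding is_partition_def using assms(1) finite_subset[OF sub] by simp
  ultimately show ?thesis by (simp add: partitions_of_def)
qed

text \<open>The eigenvalues are the values of the quadratic form at the orthonormal columns of
  \<open>Q\<close>, hence positive; their sum is the trace because
  \<open>Q * transpose_mat Q\<close> is the identity.\<close>

lemma sym_pos_def_diagonalize:
  assumes S: "sym_pos_def n S"
  defines "e \<equiv> \<lambda>i. ordered_eigenvalue S (Suc i)"
  obtains Q where "Q \<in> orthogonal_group n" "transpose_mat Q * S * Q = diagm n e"
    "\<And>i j. i \<le> j \<Longrightarrow> j < n \<Longrightarrow> e j \<le> e i" "\<And>i. i < n \<Longrightarrow> 0 < e i" "mat_trace S = (\<Sum>i<n. e i)"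
proof -
  have SC: "S \<in> carrier_mat n n" "transpose_mat S = S"
    and pos: "\<And>x. x \<in> carrier_vec n \<Longrightarrow> x \<noteq> 0\<^sub>v n \<Longrightarrow> x \<bullet> (S *\<^sub>v x) > 0"
    using S by (auto simp: sym_pos_def_def)
  obtain Q where Q': "Q \<in> orthogonal_group n"
      "transpose_mat Q * S * Q = diagm n (\<lambda>i. ordered_eigenvalue S (Suc i))"
      "\<And>i j. i \<le> j \<Longrightarrow> j < n \<Longrightarrow> ordered_eigenvalue S (Suc j) \<le> ordered_eigenvalue S (Suc i)"
    by (rule spectral_theorem_ordered[OF SC]) (rule that)
  have Q: "Q \<in> orthogonal_group n" "transpose_mat Q * S * Q = diagm n e" using Q'(1,2) by (simp_all only: e_def)
  have mono: "e j \<le> e i" if "i \<le> j" "j < n" for i j using Q'(3)[OF that] by (simp only: e_def)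
  note QD = orthogonal_groupD[OF Q(1)]
  have diag: "e c = (\<Sum>i<n. \<Sum>j<n. Q $$ (i, c) * S $$ (i, j) * Q $$ (j, c))" if "c < n" for c
    using index_congruence[OF SC(1) QD(1) that that] that unfolding Q(2) by simp
  have e_pos: "0 < e c" if c: "c < n" for c
  proof -
    let ?x = "col Q c"
    have x: "?x \<in> carrier_vec n" using QD c by auto
    have "?x \<noteq> 0\<^sub>v n"
    proof
      assume "?x = 0\<^sub>v n"
      then have zero: "vec_index ?x i = vec_index (0\<^sub>v n) i" for i by (simp only:)
      have "Q $$ (i, c) = 0" if "i < n" for i
        using zero[of i] that QD(4,5) c by simp
      then have "(transpose_mat Q * Q) $$ (c, c) = 0" using index_gram[OF QD(1) c c] by simp
      then show False using QD(2) c by simp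
    qed
    from pos[OF x this] have "0 < ?x \<bullet> (S *\<^sub>v ?x)" .
    also have "?x \<bullet> (S *\<^sub>v ?x) = (\<Sum>i<n. Q $$ (i, c) * (\<Sum>j<n. S $$ (i, j) * Q $$ (j, c)))"
      using QD SC c by (simp add: scalar_prod_def atLeast0LessThan)
    also have "\<dots> = e c" unfolding diag[OF c] by (simp add: sum_distrib_left mult.assoc)
    finally show ?thesis .
  qed
  have trace: "mat_trace S = (\<Sum>i<n. e i)"
  proof -
    have "(\<Sum>c<n. e c) = (\<Sum>c<n. \<Sum>i<n. \<Sum>j<n. S $$ (i, j) * (Q $$ (i, c) * Q $$ (j, c)))"
      using diag by (simp add: mult_ac)
    also have "\<dots> = (\<Sum>i<n. \<Sum>c<n. \<Sum>j<n. S $$ (i, j) * (Q $$ (i, c) * Q $$ (j, c)))" by (rule sum.swap)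
    also have "\<dots> = (\<Sum>i<n. \<Sum>j<n. \<Sum>c<n. S $$ (i, j) * (Q $$ (i, c) * Q $$ (j, c)))"
      by (intro sum.cong refl sum.swap)
    also have "\<dots> = (\<Sum>i<n. \<Sum>j<n. if j = i then S $$ (i, i) else 0)"
    proof (intro sum.cong refl)
      fix i j assume ij: "i \<in> {..<n}" "j \<in> {..<n}"
      have "(Q * transpose_mat Q) $$ (i, j) = (\<Sum>c<n. Q $$ (i, c) * Q $$ (j, c))"
        using ij QD(1) by (simp add: scalar_prod_def atLeast0LessThan)
      moreover have "(Q * transpose_mat Q) $$ (i, j) = (if j = i then 1 else 0)"
        unfolding QD(3) using ij by auto
      ultimately have QQ: "(\<Sum>c<n. Q $$ (i, c) * Q $$ (j, c)) = (if j = i then 1 else 0)" by (simp only:)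
      show "(\<Sum>c<n. S $$ (i, j) * (Q $$ (i, c) * Q $$ (j, c))) = (if j = i then S $$ (i, i) else 0)"
        unfolding sum_distrib_left[symmetric] QQ by simp
    qed
    also have "\<dots> = mat_trace S" using SC by (simp add: mat_trace_def)
    finally show ?thesis by simp
  qed
  show ?thesis by (rule that[OF Q mono e_pos trace])
qed

section \<open>Lower bound and summability of the series terms\<close>

context
  fixes d p :: nat and A S :: "real mat" and a s :: "nat \<Rightarrow> real"
  assumes p: "1 \<le> p" "p \<le> d" and A: "sym_pos_def p A" and S: "sym_pos_def d S"
  defines "a \<equiv> \<lambda>i. ordered_eigenvalue A (Suc i)" and "s \<equiv> \<lambda>i. ordered_eigenvalue S (Suc i)"
begin

text \<open>The constant C_\<kappa>(I_d) cancels, so \<open>S\<close> enters only through its Haar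
  average.\<close>

lemma bingham_term_eq:
  "bingham_term d p A S k = (\<Sum>\<kappa>\<in>partitions_of k p. (zonal_const p \<kappa> * spherical_mean p \<kappa> a) * spherical_mean d \<kappa> s) / fact k"
proof -
  obtain Q where Q: "Q \<in> orthogonal_group p"
      "transpose_mat Q * A * Q = diagm p (\<lambda>i. ordered_eigenvalue A (Suc i))"
    by (rule sym_pos_def_diagonalize[OF A]) (rule that)
  obtain R where R: "R \<in> orthogonal_group d"
      "transpose_mat R * S * R = diagm d (\<lambda>i. ordered_eigenvalue S (Suc i))"
    by (rule sym_pos_def_diagonalize[OF S]) (rule that)
  have AC: "A \<in> carrier_mat p p" and SC: "S \<in> carrier_mat d d" using A S by (auto simp: sym_pos_def_def)
  have "zonal \<kappa> A * zonal \<kappa> S / zonal \<kappa> (1\<^sub>m d) = (zonal_const p \<kappa> * spherical_mean p \<kappa> a) * spherical_mean d \<kappa> s"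
    if "\<kappa> \<in> partitions_of k p" for \<kappa>
  proof -
    note \<kappa> = partitions_of_subset[OF that]
    have len: "plength \<kappa> \<le> d" using \<kappa>(2) p by simp
    have "zonal_const d \<kappa> \<noteq> 0" using zonal_const_pos[OF \<kappa>(1) len] by simp
    then show ?thesis
      unfolding zonal_diagonalized[OF \<kappa>(1,2) AC Q] zonal_diagonalized[OF \<kappa>(1) len SC R] zonal_one[OF \<kappa>(1) len]
      by (simp add: a_def s_def)
  qed
  then show ?thesis unfolding bingham_term_def by simp
qed

lemma eigenvalues_pos: "i < p \<Longrightarrow> 0 < a i" "i < d \<Longrightarrow> 0 < s i"
  and eigenvalues_mono: "i \<le> j \<Longrightarrow> j < p \<Longrightarrow> a j \<le> a i" "i \<le> j \<Longrightarrow> j < d \<Longrightarrow> s j \<le> s i"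
  and trace_eq: "mat_trace A = (\<Sum>i<p. a i)"
proof -
  obtain Q where "\<And>i j. i \<le> j \<Longrightarrow> j < p \<Longrightarrow> ordered_eigenvalue A (Suc j) \<le> ordered_eigenvalue A (Suc i)"
    "\<And>i. i < p \<Longrightarrow> 0 < ordered_eigenvalue A (Suc i)" "mat_trace A = (\<Sum>i<p. ordered_eigenvalue A (Suc i))"
    by (rule sym_pos_def_diagonalize[OF A]) (rule that)
  then show "i < p \<Longrightarrow> 0 < a i" "i \<le> j \<Longrightarrow> j < p \<Longrightarrow> a j \<le> a i" "mat_trace A = (\<Sum>i<p. a i)"
    by (simp_all only: a_def)
  obtain R where "\<And>i j. i \<le> j \<Longrightarrow> j < d \<Longrightarrow> ordered_eigenvalue S (Suc j) \<le> ordered_eigenvalue S (Suc i)"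
    "\<And>i. i < d \<Longrightarrow> 0 < ordered_eigenvalue S (Suc i)"
    by (rule sym_pos_def_diagonalize[OF S]) (rule that)
  then show "i < d \<Longrightarrow> 0 < s i" "i \<le> j \<Longrightarrow> j < d \<Longrightarrow> s j \<le> s i" by (simp_all only: s_def)
qed

lemma bingham_summand_nonneg:
  assumes "\<kappa> \<in> partitions_of k p"
  shows "0 \<le> (zonal_const p \<kappa> * spherical_mean p \<kappa> a) * spherical_mean d \<kappa> s"
proof -
  note \<kappa> = partitions_of_subset[OF assms]
  show ?thesis
    using zonal_const_pos[OF \<kappa>(1,2)] \<kappa>(4) p eigenvalues_pos
    by (intro mult_nonneg_nonneg spherical_mean_nonneg is_partitionD(1)[OF \<kappa>(1)]) (auto intro: less_imp_le)
qed

lemma bingham_term_nonneg: "0 \<le> bingham_term d p A S k"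
  unfolding bingham_term_eq by (intro divide_nonneg_pos sum_nonneg bingham_summand_nonneg) auto

text \<open>At most (1 + k)^p partitions occur, each with an exponentially bounded summand. As 1 + k
  \<le> 2^k, the terms are dominated by the exponential series at 2^p C.\<close>

lemma bingham_term_summable: "summable (bingham_term d p A S)"
proof -
  define C where "C = 4 * (real p)\<^sup>2 * a 0 * s 0"
  have a0: "0 < a 0" and s0: "0 < s 0" using eigenvalues_pos p by auto
  have C: "0 \<le> C" using a0 s0 by (simp add: C_def)
  have le: "bingham_term d p A S k \<le> inverse (fact k) * (2 ^ p * C) ^ k" for k
  proof -
    have "(zonal_const p \<kappa> * spherical_mean p \<kappa> a) * spherical_mean d \<kappa> s \<le> C ^ k" if "\<kappa> \<in> partitions_of k p" for \<kappa>
    proof -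
      note \<kappa> = partitions_of_subset[OF that]
      have len: "plength \<kappa> \<le> d" using \<kappa>(2) p by simp
      have "zonal_const p \<kappa> * spherical_mean p \<kappa> a \<le> (4 * (real p)\<^sup>2 * a 0) ^ pweight \<kappa>"
        using eigenvalues_pos(1) eigenvalues_mono(1) p by (intro zonal_sph_le \<kappa>(1,2)) (auto intro: less_imp_le)
      moreover have "spherical_mean d \<kappa> s \<le> s 0 ^ (\<Sum>r<d. \<kappa> r)"
        using eigenvalues_pos(2) eigenvalues_mono(2) p \<kappa>(4)
        by (intro spherical_mean_le is_partitionD(1)[OF \<kappa>(1)]) (auto intro: less_imp_le)
      moreover have "0 \<le> spherical_mean d \<kappa> s"
        using eigenvalues_pos(2) p \<kappa>(4) by (intro spherical_mean_nonneg is_partitionD(1)[OF \<kappa>(1)]) (auto intro: less_imp_le)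
      ultimately have "(zonal_const p \<kappa> * spherical_mean p \<kappa> a) * spherical_mean d \<kappa> s \<le> (4 * (real p)\<^sup>2 * a 0) ^ k * s 0 ^ k"
        using a0 unfolding pweight_eq_sum[OF \<kappa>(1) len, symmetric] \<kappa>(3) by (intro mult_mono) auto
      then show ?thesis by (simp add: C_def power_mult_distrib)
    qed
    then have "(\<Sum>\<kappa>\<in>partitions_of k p. (zonal_const p \<kappa> * spherical_mean p \<kappa> a) * spherical_mean d \<kappa> s) \<le> real (card (partitions_of k p)) * C ^ k"
      by (rule sum_bounded_above)
    also have "\<dots> \<le> real (Suc k ^ p) * C ^ k"
      using card_partitions_of(2)[of k p] C by (intro mult_right_mono) (auto simp only: of_nat_le_iff zero_le_power)
    also have "\<dots> \<le> real ((2 ^ k) ^ p) * C ^ k"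
    proof -
      have "Suc k \<le> 2 ^ k" by (simp add: Suc_le_eq)
      then have "Suc k ^ p \<le> (2 ^ k) ^ p" by (rule power_mono) simp
      then show ?thesis using C by (intro mult_right_mono) (simp_all only: of_nat_le_iff zero_le_power)
    qed
    also have "\<dots> = (2 ^ p * C) ^ k" by (simp add: power_mult_distrib power_mult[symmetric] mult.commute)
    finally show ?thesis unfolding bingham_term_eq by (simp add: divide_inverse mult.commute mult_left_mono)
  qed
  show ?thesis
    by (rule summable_comparison_test'[OF summable_exp[of "2 ^ p * C"], of 0]) (use le bingham_term_nonneg in auto)
qed

text \<open>In this order: the pair factors of C_\<kappa>(I_p), the moment ratio of dimensions d and
  p, the choice of one multinomial term.\<close>

definition lower_exponent :: nat where "lower_exponent = (\<Sum>j<p. j) + p * (d - p) + (p - 1)"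

text \<open>All summands are nonnegative, so a single partition may carry the bound. Indices start
  at 0, hence \<open>s (p - 1)\<close> is \<sigma>_(p).\<close>

lemma bingham_term_ge:
  "(1 / real (Suc k)) ^ lower_exponent * ((s (p - 1) * mat_trace A) ^ k / fact k) \<le> bingham_term d p A S k"
proof -
  let ?q = "1 / real (Suc k)"
  \<comment> \<open>The eigenvalues are continued by 0, because the multinomial lemmas ask for
    nonnegativity at every index.\<close>
  define b where "b i = (if i < p then a i else 0)" for i
  have b: "0 \<le> b i" for i using eigenvalues_pos(1) by (auto simp: b_def intro: less_imp_le)
  have p1: "{..p - 1} = {..<p}" using p by auto
  \<comment> \<open>The lemma counts variables up to and including q; with q = p - 1 the loss is
    \<open>Suc k\<close> to the power p - 1 instead of p.\<close>
  obtain \<mu> where \<mu>: "\<forall>i>p - 1. \<mu> i = 0" "(\<Sum>i<p. \<mu> i) = k"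
      "(\<Sum>i<p. b i) ^ k / fact k \<le> real (Suc k) ^ (p - 1) * (\<Prod>i<p. b i ^ \<mu> i / fact (\<mu> i))"
    using power_le_max_multinomial_term[of b "p - 1" k, OF b] unfolding p1 by blast
  \<comment> \<open>A partition must be decreasing; sorting the exponents along the decreasing
    eigenvalues does not decrease the term.\<close>
  obtain \<kappa> where \<kappa>: "antimono \<kappa>" "\<forall>i\<ge>p. \<kappa> i = 0" "(\<Sum>i<p. \<kappa> i) = (\<Sum>i<p. \<mu> i)"
    "(\<Prod>i<p. b i ^ \<mu> i / fact (\<mu> i)) \<le> (\<Prod>i<p. b i ^ \<kappa> i / fact (\<kappa> i))"
    using exists_sorted_exponents[of b p \<mu>, OF b] \<mu>(1) p eigenvalues_mono(1) by (force simp: b_def)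
  have mem: "\<kappa> \<in> partitions_of k p" using \<kappa> \<mu>(2) by (intro partitions_ofI) auto
  note K = partitions_of_subset[OF mem]
  let ?M = "\<Prod>i<p. a i ^ \<kappa> i / fact (\<kappa> i)"
  have ba: "(\<Prod>i<p. b i ^ \<kappa> i / fact (\<kappa> i)) = ?M" "(\<Sum>i<p. b i) = mat_trace A"
    unfolding trace_eq by (auto simp: b_def intro!: prod.cong sum.cong)
  have "mat_trace A ^ k / fact k \<le> real (Suc k) ^ (p - 1) * ?M"
    using \<mu>(3) \<kappa>(4) unfolding ba by (rule order_trans[OF _ mult_left_mono]) simp
  then have "?q ^ (p - 1) * (mat_trace A ^ k / fact k) \<le> ?q ^ (p - 1) * (real (Suc k) ^ (p - 1) * ?M)"
    by (intro mult_left_mono) auto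
  also have "\<dots> = ?M" by (simp add: power_divide)
  finally have tr: "?q ^ (p - 1) * (mat_trace A ^ k / fact k) \<le> ?M" .
  have M0: "0 \<le> ?M" using eigenvalues_pos(1) by (intro prod_nonneg) (auto intro: less_imp_le)
  have sp: "0 < s (p - 1)" using eigenvalues_pos(2) p by simp
  have zA: "fact k * ?M * ?q ^ (\<Sum>j<p. j) \<le> zonal_const p \<kappa> * spherical_mean p \<kappa> a"
    using zonal_sph_ge[OF K(1,2), of a] eigenvalues_pos(1) unfolding K(3) by (auto intro: less_imp_le)
  have zS: "s (p - 1) ^ k * ?q ^ (p * (d - p)) \<le> spherical_mean d \<kappa> s"
  proof -
    have "s (p - 1) ^ (\<Sum>r<p. \<kappa> r) * gram_moment p \<kappa> \<le> gram_moment d \<kappa> * spherical_mean d \<kappa> s"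
      using sp p K(4) eigenvalues_pos(2) eigenvalues_mono(2)
      by (intro spherical_mean_ge_truncated is_partitionD(1)[OF K(1)]) (auto intro: less_imp_le)
    moreover have "(\<Sum>r<p. \<kappa> r) = k" using \<kappa>(3) \<mu>(2) by simp
    moreover have "0 \<le> spherical_mean d \<kappa> s"
      using eigenvalues_pos(2) p K(4) by (intro spherical_mean_nonneg is_partitionD(1)[OF K(1)]) (auto intro: less_imp_le)
    ultimately have "s (p - 1) ^ k * gram_moment p \<kappa> \<le> (real (Suc k) ^ (p * (d - p)) * gram_moment p \<kappa>) * spherical_mean d \<kappa> s"
      using gram_moment_dimension_le[of p \<kappa> k d, OF K(4,5) p(2)] by (auto intro: order_trans mult_right_mono)
    then have "gram_moment p \<kappa> * s (p - 1) ^ k \<le> gram_moment p \<kappa> * (real (Suc k) ^ (p * (d - p)) * spherical_mean d \<kappa> s)"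
      by (simp only: mult_ac)
    then have "s (p - 1) ^ k \<le> real (Suc k) ^ (p * (d - p)) * spherical_mean d \<kappa> s"
      using gram_moment_pos[of p \<kappa>] by (simp only: mult_le_cancel_left_pos)
    then have "s (p - 1) ^ k * ?q ^ (p * (d - p)) \<le> (real (Suc k) ^ (p * (d - p)) * spherical_mean d \<kappa> s) * ?q ^ (p * (d - p))"
      by (intro mult_right_mono) auto
    also have "\<dots> = spherical_mean d \<kappa> s" by (simp add: power_divide)
    finally show ?thesis .
  qed
  have "?q ^ lower_exponent * ((s (p - 1) * mat_trace A) ^ k / fact k) =
      ((?q ^ (p - 1) * (mat_trace A ^ k / fact k)) * ?q ^ (\<Sum>j<p. j)) * (s (p - 1) ^ k * ?q ^ (p * (d - p)))"
    unfolding lower_exponent_def power_add power_mult_distrib by (simp only: times_divide_eq_right times_divide_eq_left mult_ac)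
  also have "\<dots> \<le> (?M * ?q ^ (\<Sum>j<p. j)) * (s (p - 1) ^ k * ?q ^ (p * (d - p)))"
    using sp tr by (intro mult_right_mono) auto
  also have "\<dots> = ((fact k * ?M * ?q ^ (\<Sum>j<p. j)) * (s (p - 1) ^ k * ?q ^ (p * (d - p)))) / fact k"
    by simp
  also have "\<dots> \<le> ((zonal_const p \<kappa> * spherical_mean p \<kappa> a) * spherical_mean d \<kappa> s) / fact k"
  proof (rule divide_right_mono, rule mult_mono[OF zA zS])
    have "0 \<le> fact k * ?M * ?q ^ (\<Sum>j<p. j)" using M0 by simp
    then show "0 \<le> zonal_const p \<kappa> * spherical_mean p \<kappa> a" using zA by (rule order_trans)
    show "0 \<le> s (p - 1) ^ k * ?q ^ (p * (d - p))" using sp by simp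
  qed simp
  also have "\<dots> \<le> bingham_term d p A S k"
    unfolding bingham_term_eq using card_partitions_of(1) mem bingham_summand_nonneg
    by (intro divide_right_mono member_le_sum) auto
  finally show ?thesis .
qed

lemma lower_exponent_le: "real lower_exponent \<le> (real d + 2) * (real d - 1) / 2"
proof -
  obtain t where t: "d = p + t" using p(2) le_Suc_ex by blast
  have "2 * (\<Sum>j<p. j) = p * (p - 1)" by (induction p) (auto simp: algebra_simps)
  moreover have "d - p = t" using t by simp
  ultimately have "2 * lower_exponent = p * (p - 1) + 2 * p * t + 2 * (p - 1)"
    unfolding lower_exponent_def by simp
  then have "2 * real lower_exponent = real p * (real p - 1) + 2 * real p * real t + 2 * (real p - 1)"
    using p(1) by (metis (mono_tags, opaque_lifting) of_nat_1 of_nat_add of_nat_diff of_nat_mult of_nat_numeral)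
  \<comment> \<open>The added t(t + 1) is exactly the gap to (d + 2)(d - 1); it vanishes for d =
    p.\<close>
  also have "\<dots> \<le> real p * (real p - 1) + 2 * real p * real t + 2 * (real p - 1) + real t * (real t + 1)" by simp
  also have "\<dots> = (real d + 2) * (real d - 1)" unfolding t by (simp add: algebra_simps)
  finally show ?thesis by simp
qed

end

section \<open>The geometric weight and the summation of the termwise bound\<close>

text \<open>Bernoulli's inequality gives \<open>1 + k + m \<le> (1 + m) ((2 + m) / (1 + m))\<^sup>k\<close>.\<close>

lemma weight_le:
  assumes N: "0 \<le> N" "real e \<le> N"
  shows "(2 + real m) powr (real m * N) * (1 + real m) powr (- (1 + real m) * N) *
      ((1 + real m) / (2 + real m)) powr (real (k + m) * N) \<le> (1 / real (Suc (k + m))) ^ e"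
proof -
  have pos: "0 < 1 + real m" "0 < 2 + real m" by auto
  let ?r = "(2 + real m) / (1 + real m)"
  have "(2 + real m) powr (real m * N) * (1 + real m) powr (- (1 + real m) * N) *
      ((1 + real m) / (2 + real m)) powr (real (k + m) * N) =
      exp (N * (- ln (1 + real m) - real k * (ln (2 + real m) - ln (1 + real m))))"
    using pos by (simp add: powr_def ln_div exp_add[symmetric] algebra_simps)
  \<comment> \<open>The powers depending on m alone collapse to one factor 1 / (1 + m); each further
    order multiplies the base by (1 + m) / (2 + m).\<close>
  also have "\<dots> = (1 / ((1 + real m) * ?r ^ k)) powr N"
    using pos by (simp add: powr_def ln_div ln_mult ln_realpow)
  also have "\<dots> \<le> (1 / real (Suc (k + m))) powr N"
  proof (intro powr_mono2 N divide_left_mono)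
    \<comment> \<open>Equality holds for k = 0 and k = 1, so the prefactor makes the weight equal to
      the power of 1 / (1 + k + m) with exponent \<open>N\<close> at the orders m and m + 1.\<close>
    have "1 + real k * (1 / (1 + real m)) \<le> (1 + 1 / (1 + real m)) ^ k"
      using pos by (intro Bernoulli_inequality) (simp add: order_trans[of _ 0])
    also have "1 + 1 / (1 + real m) = ?r" using pos by (simp add: field_simps)
    finally have "(1 + real m) * (1 + real k * (1 / (1 + real m))) \<le> (1 + real m) * ?r ^ k"
      using pos by (intro mult_left_mono) auto
    moreover have "(1 + real m) * (1 + real k * (1 / (1 + real m))) = real (Suc (k + m))"
      using pos by (simp add: field_simps)
    ultimately show "real (Suc (k + m)) \<le> (1 + real m) * ?r ^ k" by (simp only:)
  qed (use pos in auto)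
  also have "\<dots> \<le> (1 / real (Suc (k + m))) powr real e"
    using N by (intro powr_mono') auto
  also have "\<dots> = (1 / real (Suc (k + m))) ^ e" by (subst powr_realpow) auto
  finally show ?thesis .
qed

theorem theorem2p4:
  fixes d p m :: nat and A \<Sigma> :: "real mat" and N :: real
  assumes "1 \<le> p" and "p \<le> d"
    and "sym_pos_def p A" and "sym_pos_def d \<Sigma>"
    and "N = (real d + 2) * (real d - 1) / 2"
    and "1 \<le> m"
  shows "bingham_remainder d p m A \<Sigma> \<ge>
    (2 + real m) powr (real m * N) * (1 + real m) powr (- (1 + real m) * N) *
    (\<Sum>k. ((1 + real m) / (2 + real m)) powr (real (k + m) * N) *
          (ordered_eigenvalue \<Sigma> p * mat_trace A) ^ (k + m) / fact (k + m))"
proof -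
  note hyps = assms(1-4)
  let ?c = "(2 + real m) powr (real m * N) * (1 + real m) powr (- (1 + real m) * N)"
  let ?x = "ordered_eigenvalue \<Sigma> p * mat_trace A"
  let ?t = "\<lambda>k. ((1 + real m) / (2 + real m)) powr (real (k + m) * N) * ?x ^ (k + m) / fact (k + m)"
  have N: "0 \<le> N" using assms(1,2) by (simp add: assms(5))
  \<comment> \<open>\<open>eigenvalues_pos\<close> counts from 0, so \<sigma>_(p) has index
    \<open>p - 1\<close> there.\<close>
  have "0 < ordered_eigenvalue \<Sigma> p" using eigenvalues_pos(2)[OF hyps, of "p - 1"] assms(1,2) by simp
  moreover have "0 \<le> mat_trace A"
    unfolding trace_eq[OF hyps] using eigenvalues_pos(1)[OF hyps] by (intro sum_nonneg) (auto intro: less_imp_le)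
  ultimately have x: "0 \<le> ?x" by simp
  have le: "?c * ?t k \<le> bingham_term d p A \<Sigma> (k + m)" for k
  proof -
    have "?c * ?t k = (?c * ((1 + real m) / (2 + real m)) powr (real (k + m) * N)) * (?x ^ (k + m) / fact (k + m))"
      by simp
    also have "\<dots> \<le> (1 / real (Suc (k + m))) ^ lower_exponent d p * (?x ^ (k + m) / fact (k + m))"
      using x N lower_exponent_le[OF hyps] unfolding assms(5)[symmetric]
      by (intro mult_right_mono weight_le) auto
    also have "\<dots> \<le> bingham_term d p A \<Sigma> (k + m)"
      using bingham_term_ge[OF hyps, of "k + m"] assms(1) by simp
    finally show ?thesis .
  qed
  have summable: "summable (\<lambda>k. bingham_term d p A \<Sigma> (k + m))"
    using bingham_term_summable[OF hyps] by (rule summable_ignore_initial_segment)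
  have t0: "0 \<le> ?c * ?t k" for k using x by simp
  \<comment> \<open>The minorant converges because the convergent remainder series dominates it
    termwise; the nonzero prefactor is removed afterwards.\<close>
  have ct: "summable (\<lambda>k. ?c * ?t k)"
    by (rule summable_comparison_test'[OF summable, of 0]) (simp only: real_norm_def abs_of_nonneg[OF t0] le)
  have "?c \<noteq> 0" by simp
  then have "summable ?t" using ct by (simp only: summable_cmult_iff) simp
  then have "?c * (\<Sum>k. ?t k) = (\<Sum>k. ?c * ?t k)" by (rule suminf_mult[symmetric])
  also have "\<dots> \<le> bingham_remainder d p m A \<Sigma>"
    unfolding bingham_remainder_def by (rule suminf_le[OF le ct summable])
  finally show ?thesis .
qed

end
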